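(* Let $A,B$ be C*-algebras. If ${}_AX_B$ is a bi-Hilbertian bimodule of finite index, then any element of ${}_A\mathcal L(X_B)$ is adjointable with respect to the left inner product, and therefore it belongs to $\mathcal L_B({}_AX)$. Similarly, any element of $\mathcal L_B({}_AX)$ is adjointable with respect to the right inner product. Therefore ${}_A\mathcal L(X_B)=\mathcal L_B({}_AX)$ as algebras.
   Context: For a right Hilbert $B$-module $X_B$: $\mathcal L(X_B)$ denotes adjointable maps, $\theta^r_{x,y}(z)=x(y|z)_B$, $\mathcal K(X_B)$ is the closed span of the $\theta^r_{x,y}$. A right Hilbert $A$-$B$ bimodule is an $A$-$B$ bimodule that is a right Hilbert $B$-module with $\phi(a):x\mapsto ax$ adjointable, $\phi(a)^*=\phi(a^* )$; left Hilbert $A$-$B$ bimodules (inner product ${}_A(\cdot|\cdot)$) are defined symmetrically. $X$ is bi-Hilbertian if it is both, with equivalent norms $\|(x|x)_B\|^{1/2}$, $\|{}_A(x|x)\|^{1/2}$. The contragradient $\overline X=\{\overline x:x\in X\}$ is the complex conjugate space with $b\cdot\overline x=\overline{xb^*}$, $\overline x\cdot a=\overline{a^*x}$, ${}_B(\overline x|\overline y)=(x|y)_B$, $(\overline x|\overline y)_A={}_A(x|y)$; it is a bi-Hilbertian $B$-$A$ bimodule. ${}_A\mathcal L(X_B)$ is the algebra of maps on $X$ adjointable with respect to the right inner product and commuting with the left $A$-action; $\mathcal L_B({}_AX)$ is the algebra of maps on $X$ adjointable with respect to the left inner product and commuting with the right $B$-action. $X$ has finite right numerical index if for some $\lambda>0$,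 $\|\sum_1^n{}_A(x_i|x_i)\|\le\lambda\|\sum_1^n\theta^r_{x_i,x_i}\|$ for all $n$, $x_i\in X$. Then there is a unique norm continuous linear $F:\mathcal K(X_B)\to A$ with $F(\theta^r_{x,y})={}_A(x|y)$, and $r\text{-}\mathrm{Ind}[X]:=F''(I)\in A''$, $F'':\mathcal K(X_B)''\to A''$ being the normal extension to enveloping von Neumann algebras. $X$ is of finite right index if moreover $r\text{-}\mathrm{Ind}[X]\in M(A)$; of finite left index if $\overline X$ is of finite right index; of finite index if both. *)

theory Defs
  imports "HOL-Analysis.Analysis"
begin

section \<open>C*-algebras\<close>

text \<open>Neither a unit nor \<open>0 \<noteq> 1\<close> is required. The complex scalar multiplication extends the real
  one inherited from \<^class>\<open>real_normed_algebra\<close>.\<close>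

class cstar_algebra = real_normed_algebra + banach +
  fixes scaleC :: "complex \<Rightarrow> 'a \<Rightarrow> 'a" (infixr "*\<^sub>C" 75)
    and star :: "'a \<Rightarrow> 'a"
  assumes scaleC_add_right: "c *\<^sub>C (a + b) = c *\<^sub>C a + c *\<^sub>C b"
    and scaleC_add_left: "(c + d) *\<^sub>C a = c *\<^sub>C a + d *\<^sub>C a"
    and scaleC_scaleC: "c *\<^sub>C (d *\<^sub>C a) = (c * d) *\<^sub>C a"
    and scaleR_scaleC: "r *\<^sub>R a = complex_of_real r *\<^sub>C a"
    and norm_scaleC: "norm (c *\<^sub>C a) = cmod c * norm a"
    and mult_scaleC_left: "(c *\<^sub>C a) * b = c *\<^sub>C (a * b)"
    and mult_scaleC_right: "a * (c *\<^sub>C b) = c *\<^sub>C (a * b)"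
    and star_add: "star (a + b) = star a + star b"
    and star_scaleC: "star (c *\<^sub>C a) = cnj c *\<^sub>C star a"
    and star_mult: "star (a * b) = star b * star a"
    and star_star: "star (star a) = a"
    and cstar_identity: "norm (star a * a) = (norm a)\<^sup>2"

definition positive :: "'a::cstar_algebra \<Rightarrow> bool" where
  "positive a \<longleftrightarrow> (\<exists>b. a = star b * b)"


section \<open>Normed algebras with a carrier, duals and enveloping von Neumann algebras\<close>

text \<open>The algebra \<open>\<K>(X\<^sub>B)\<close> is a proper set of maps, so spaces and algebras that
  are to be dualised carry an explicit carrier.\<close>

record 'v cspace =
  elems :: "'v set"
  vadd :: "'v \<Rightarrow> 'v \<Rightarrow> 'v"
  vscale :: "complex \<Rightarrow> 'v \<Rightarrow> 'v"

record 'v nspace = "'v cspace" +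
  vnorm :: "'v \<Rightarrow> real"

record 'v nalg = "'v nspace" +
  vmult :: "'v \<Rightarrow> 'v \<Rightarrow> 'v"

text \<open>A C*-algebra given as a type.\<close>

definition cstar_alg :: "'a::cstar_algebra nalg" where
  "cstar_alg = \<lparr>elems = UNIV, vadd = (+), vscale = (*\<^sub>C), vnorm = norm, vmult = (*)\<rparr>"

definition complex_space :: "complex nspace" where
  "complex_space = \<lparr>elems = UNIV, vadd = (+), vscale = (*), vnorm = cmod\<rparr>"

definition linear_maps ::
    "('v, 'p) cspace_scheme \<Rightarrow> ('w, 'q) cspace_scheme \<Rightarrow> ('v \<Rightarrow> 'w) set" where
  "linear_maps V W = {F \<in> elems V \<rightarrow>\<^sub>E elems W.
     (\<forall>u\<in>elems V. \<forall>v\<in>elems V. F (vadd V u v) = vadd W (F u) (F v)) \<and>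
     (\<forall>c. \<forall>v\<in>elems V. F (vscale V c v) = vscale W c (F v))}"

definition continuous_linear_maps ::
    "('v, 'p) nspace_scheme \<Rightarrow> ('w, 'q) nspace_scheme \<Rightarrow> ('v \<Rightarrow> 'w) set" where
  "continuous_linear_maps V W =
     {F \<in> linear_maps V W. \<exists>C. \<forall>v\<in>elems V. vnorm W (F v) \<le> C * vnorm V v}"

definition dual :: "('v, 'p) nspace_scheme \<Rightarrow> ('v \<Rightarrow> complex) nspace" where
  "dual V =
     \<lparr>elems = continuous_linear_maps V complex_space,
      vadd = (\<lambda>f g. \<lambda>v\<in>elems V. f v + g v),
      vscale = (\<lambda>c f. \<lambda>v\<in>elems V. c * f v),
      vnorm = (\<lambda>f. SUP v\<in>{v \<in> elems V. vnorm V v \<le> 1}. cmod (f v))\<rparr>"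

text \<open>The (first) Arens product on the second dual of \<open>A\<close>, in three steps:
  \<open>(f \<cdot> a)(b) = f (a b)\<close>, \<open>(n \<cdot> f)(a) = n (f \<cdot> a)\<close>, \<open>(m n)(f) = m (n \<cdot> f)\<close>.\<close>

definition arens1 :: "('v, 'p) nalg_scheme \<Rightarrow> ('v \<Rightarrow> complex) \<Rightarrow> 'v \<Rightarrow> ('v \<Rightarrow> complex)" where
  "arens1 A f a = (\<lambda>b\<in>elems A. f (vmult A a b))"

definition arens2 ::
    "('v, 'p) nalg_scheme \<Rightarrow> (('v \<Rightarrow> complex) \<Rightarrow> complex) \<Rightarrow> ('v \<Rightarrow> complex) \<Rightarrow> ('v \<Rightarrow> complex)" where
  "arens2 A n f = (\<lambda>a\<in>elems A. n (arens1 A f a))"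

definition arens ::
    "('v, 'p) nalg_scheme \<Rightarrow> (('v \<Rightarrow> complex) \<Rightarrow> complex) \<Rightarrow> (('v \<Rightarrow> complex) \<Rightarrow> complex) \<Rightarrow>
     (('v \<Rightarrow> complex) \<Rightarrow> complex)" where
  "arens A m n = (\<lambda>f\<in>elems (dual A). m (arens2 A n f))"

text \<open>The enveloping von Neumann algebra \<open>A''\<close> of a C*-algebra \<open>A\<close>, realised on the second dual
  of \<open>A\<close>; the \<open>\<sigma>\<close>-weak topology is then the weak* topology. The involution of \<open>A''\<close> is not recorded.\<close>

definition enveloping_vN :: "('v, 'p) nalg_scheme \<Rightarrow> (('v \<Rightarrow> complex) \<Rightarrow> complex) nalg" where
  "enveloping_vN A =
     \<lparr>elems = elems (dual (dual A)), vadd = vadd (dual (dual A)),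
      vscale = vscale (dual (dual A)), vnorm = vnorm (dual (dual A)), vmult = arens A\<rparr>"

definition embed :: "('v, 'p) nspace_scheme \<Rightarrow> 'v \<Rightarrow> (('v \<Rightarrow> complex) \<Rightarrow> complex)" where
  "embed V v = (\<lambda>f\<in>elems (dual V). f v)"

definition unit_of :: "('v, 'p) nalg_scheme \<Rightarrow> 'v" where
  "unit_of N = (THE e. e \<in> elems N \<and> (\<forall>m\<in>elems N. vmult N e m = m \<and> vmult N m e = m))"

definition multiplier_algebra :: "('v, 'p) nalg_scheme \<Rightarrow> (('v \<Rightarrow> complex) \<Rightarrow> complex) set" where
  "multiplier_algebra A = {m \<in> elems (enveloping_vN A). \<forall>a\<in>elems A.
     vmult (enveloping_vN A) m (embed A a) \<in> embed A ` elems A \<and>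
     vmult (enveloping_vN A) (embed A a) m \<in> embed A ` elems A}"

text \<open>Elements of the second dual are functions on the dual with a fixed value off the dual. Hence the
  product topology that \<open>continuous_on\<close> uses on functions restricts to the weak* topology, and the
  condition below is \<open>\<sigma>\<close>-weak continuity, i.e. normality, of \<open>G\<close>.\<close>

definition normal_extension ::
    "('v, 'p) nalg_scheme \<Rightarrow> ('w, 'q) nalg_scheme \<Rightarrow> ('v \<Rightarrow> 'w) \<Rightarrow>
     ((('v \<Rightarrow> complex) \<Rightarrow> complex) \<Rightarrow> (('w \<Rightarrow> complex) \<Rightarrow> complex))" where
  "normal_extension K A F = (THE G.
     G \<in> linear_maps (enveloping_vN K) (enveloping_vN A) \<and>
     continuous_on (elems (enveloping_vN K)) G \<and>
     (\<forall>k\<in>elems K. G (embed K k) = embed A (F k)))"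


section \<open>Hilbert bimodules\<close>

record ('a, 'b, 'x) bimodule =
  scale :: "complex \<Rightarrow> 'x \<Rightarrow> 'x"
  lact :: "'a \<Rightarrow> 'x \<Rightarrow> 'x"
  ract :: "'x \<Rightarrow> 'b \<Rightarrow> 'x"
  lip :: "'x \<Rightarrow> 'x \<Rightarrow> 'a"  \<comment> \<open>the \<open>A\<close>-valued inner product, linear in the first variable\<close>
  rip :: "'x \<Rightarrow> 'x \<Rightarrow> 'b"  \<comment> \<open>the \<open>B\<close>-valued inner product, linear in the second variable\<close>

definition lnorm :: "('a::cstar_algebra, 'b, 'x) bimodule \<Rightarrow> 'x \<Rightarrow> real" where
  "lnorm X x = sqrt (norm (lip X x x))"

definition rnorm :: "('a, 'b::cstar_algebra, 'x) bimodule \<Rightarrow> 'x \<Rightarrow> real" where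
  "rnorm X x = sqrt (norm (rip X x x))"

definition complex_vector :: "('a, 'b, 'x::ab_group_add) bimodule \<Rightarrow> bool" where
  "complex_vector X \<longleftrightarrow>
     (\<forall>c x y. scale X c (x + y) = scale X c x + scale X c y) \<and>
     (\<forall>c d x. scale X (c + d) x = scale X c x + scale X d x) \<and>
     (\<forall>c d x. scale X c (scale X d x) = scale X (c * d) x) \<and>
     (\<forall>x. scale X 1 x = x)"

definition left_module :: "('a::cstar_algebra, 'b, 'x::ab_group_add) bimodule \<Rightarrow> bool" where
  "left_module X \<longleftrightarrow> complex_vector X \<and>
     (\<forall>a x y. lact X a (x + y) = lact X a x + lact X a y) \<and>
     (\<forall>a a' x. lact X (a + a') x = lact X a x + lact X a' x) \<and>
     (\<forall>a a' x. lact X (a * a') x = lact X a (lact X a' x)) \<and>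
     (\<forall>c a x. lact X (c *\<^sub>C a) x = scale X c (lact X a x)) \<and>
     (\<forall>c a x. lact X a (scale X c x) = scale X c (lact X a x))"

definition right_module :: "('a, 'b::cstar_algebra, 'x::ab_group_add) bimodule \<Rightarrow> bool" where
  "right_module X \<longleftrightarrow> complex_vector X \<and>
     (\<forall>x y b. ract X (x + y) b = ract X x b + ract X y b) \<and>
     (\<forall>x b b'. ract X x (b + b') = ract X x b + ract X x b') \<and>
     (\<forall>x b b'. ract X x (b * b') = ract X (ract X x b) b') \<and>
     (\<forall>c x b. ract X x (c *\<^sub>C b) = scale X c (ract X x b)) \<and>
     (\<forall>c x b. ract X (scale X c x) b = scale X c (ract X x b))"

definition left_hilbert_module :: "('a::cstar_algebra, 'b, 'x::ab_group_add) bimodule \<Rightarrow> bool" where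
  "left_hilbert_module X \<longleftrightarrow> left_module X \<and>
     (\<forall>x y z. lip X (x + y) z = lip X x z + lip X y z) \<and>
     (\<forall>c x y. lip X (scale X c x) y = c *\<^sub>C lip X x y) \<and>
     (\<forall>a x y. lip X (lact X a x) y = a * lip X x y) \<and>
     (\<forall>x y. star (lip X x y) = lip X y x) \<and>
     (\<forall>x. positive (lip X x x)) \<and>
     (\<forall>x. lip X x x = 0 \<longrightarrow> x = 0) \<and>
     Metric_space.mcomplete UNIV (\<lambda>x y. lnorm X (x - y))"

definition right_hilbert_module :: "('a, 'b::cstar_algebra, 'x::ab_group_add) bimodule \<Rightarrow> bool" where
  "right_hilbert_module X \<longleftrightarrow> right_module X \<and>
     (\<forall>x y z. rip X x (y + z) = rip X x y + rip X x z) \<and>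
     (\<forall>c x y. rip X x (scale X c y) = c *\<^sub>C rip X x y) \<and>
     (\<forall>x y b. rip X x (ract X y b) = rip X x y * b) \<and>
     (\<forall>x y. star (rip X x y) = rip X y x) \<and>
     (\<forall>x. positive (rip X x x)) \<and>
     (\<forall>x. rip X x x = 0 \<longrightarrow> x = 0) \<and>
     Metric_space.mcomplete UNIV (\<lambda>x y. rnorm X (x - y))"

definition is_bimodule ::
    "('a::cstar_algebra, 'b::cstar_algebra, 'x::ab_group_add) bimodule \<Rightarrow> bool" where
  "is_bimodule X \<longleftrightarrow> left_module X \<and> right_module X \<and>
     (\<forall>a x b. ract X (lact X a x) b = lact X a (ract X x b))"

definition right_hilbert_bimodule ::
    "('a::cstar_algebra, 'b::cstar_algebra, 'x::ab_group_add) bimodule \<Rightarrow> bool" where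
  "right_hilbert_bimodule X \<longleftrightarrow> is_bimodule X \<and> right_hilbert_module X \<and>
     (\<forall>a x y. rip X (lact X a x) y = rip X x (lact X (star a) y))"

definition left_hilbert_bimodule ::
    "('a::cstar_algebra, 'b::cstar_algebra, 'x::ab_group_add) bimodule \<Rightarrow> bool" where
  "left_hilbert_bimodule X \<longleftrightarrow> is_bimodule X \<and> left_hilbert_module X \<and>
     (\<forall>b x y. lip X (ract X x b) y = lip X x (ract X y (star b)))"

definition bi_hilbertian ::
    "('a::cstar_algebra, 'b::cstar_algebra, 'x::ab_group_add) bimodule \<Rightarrow> bool" where
  "bi_hilbertian X \<longleftrightarrow> left_hilbert_bimodule X \<and> right_hilbert_bimodule X \<and>
     (\<exists>c>0. \<exists>C>0. \<forall>x. c * rnorm X x \<le> lnorm X x \<and> lnorm X x \<le> C * rnorm X x)"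

text \<open>The additive group of the complex conjugate space is that of \<open>X\<close>, so the copy of \<open>x\<close> in it is \<open>x\<close> itself
  and only the scalar multiplication, the actions and the inner products change.\<close>

definition contragradient ::
    "('a::cstar_algebra, 'b::cstar_algebra, 'x) bimodule \<Rightarrow> ('b, 'a, 'x) bimodule" where
  "contragradient X =
     \<lparr>scale = (\<lambda>c x. scale X (cnj c) x),
      lact = (\<lambda>b x. ract X x (star b)),
      ract = (\<lambda>x a. lact X (star a) x),
      lip = rip X,
      rip = lip X\<rparr>"

lemma bi_hilbertian_contragradient:
  assumes "bi_hilbertian X"
  shows "bi_hilbertian (contragradient X)"
proof -
  have n: "lnorm (contragradient X) = rnorm X" "rnorm (contragradient X) = lnorm X"
    by (auto simp: lnorm_def rnorm_def contragradient_def fun_eq_iff)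
  obtain c C where "c > 0" "C > 0"
    and cC: "\<And>x. c * rnorm X x \<le> lnorm X x" "\<And>x. lnorm X x \<le> C * rnorm X x"
    using assms by (auto simp: bi_hilbertian_def)
  then have equiv: "\<exists>c>0. \<exists>C>0. \<forall>x. c * lnorm X x \<le> rnorm X x \<and> rnorm X x \<le> C * lnorm X x"
    by (intro exI[of _ "1/C"] exI[of _ "1/c"] conjI) (auto simp: field_simps)
  have L: "left_module X" and R: "right_module X" and HL: "left_hilbert_module X"
    and HR: "right_hilbert_module X"
    and assoc: "\<And>a x b. ract X (lact X a x) b = lact X a (ract X x b)"
    and adjr: "\<And>a x y. rip X (lact X a x) y = rip X x (lact X (star a) y)"
    and adjl: "\<And>b x y. lip X (ract X x b) y = lip X x (ract X y (star b))"
    using assms by (simp_all add: bi_hilbertian_def left_hilbert_bimodule_def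
        right_hilbert_bimodule_def is_bimodule_def)
  have vec: "complex_vector (contragradient X)"
    using L unfolding left_module_def complex_vector_def contragradient_def by simp
  have L': "left_module (contragradient X)"
    using R vec unfolding left_module_def right_module_def
    by (simp add: contragradient_def star_add star_mult star_scaleC)
  have R': "right_module (contragradient X)"
    using L vec unfolding left_module_def right_module_def
    by (simp add: contragradient_def star_add star_mult star_scaleC)
  have l: "\<And>x y z. lip X (x + y) z = lip X x z + lip X y z"
      "\<And>c x y. lip X (scale X c x) y = c *\<^sub>C lip X x y"
      "\<And>a x y. lip X (lact X a x) y = a * lip X x y"
      "\<And>x y. star (lip X x y) = lip X y x"
    using HL by (simp_all add: left_hilbert_module_def)
  have r: "\<And>x y z. rip X x (y + z) = rip X x y + rip X x z"
      "\<And>c x y. rip X x (scale X c y) = c *\<^sub>C rip X x y"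
      "\<And>x y b. rip X x (ract X y b) = rip X x y * b"
      "\<And>x y. star (rip X x y) = rip X y x"
    using HR by (simp_all add: right_hilbert_module_def)
  have "lip X x (y + z) = lip X x y + lip X x z"
      "lip X x (scale X (cnj c) y) = c *\<^sub>C lip X x y"
      "lip X x (lact X (star a) y) = lip X x y * a" for x y z c a
    by (subst l(4)[symmetric], simp add: l star_add star_scaleC star_mult star_star)+
  then have HR': "right_hilbert_module (contragradient X)"
    using HL R' unfolding left_hilbert_module_def right_hilbert_module_def n
    by (simp add: contragradient_def)
  have "rip X (x + y) z = rip X x z + rip X y z"
      "rip X (scale X (cnj c) x) y = c *\<^sub>C rip X x y"
      "rip X (ract X x (star b)) y = b * rip X x y" for x y z c b
    by (subst r(4)[symmetric], simp add: r star_add star_scaleC star_mult star_star)+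
  then have HL': "left_hilbert_module (contragradient X)"
    using HR L' unfolding left_hilbert_module_def right_hilbert_module_def n
    by (simp add: contragradient_def)
  show ?thesis
    unfolding bi_hilbertian_def left_hilbert_bimodule_def right_hilbert_bimodule_def
      is_bimodule_def n
    using L' R' HL' HR' equiv
    by (simp add: contragradient_def assoc adjr adjl star_star)
qed


section \<open>Adjointable and compact maps\<close>

definition right_adjointable :: "('a, 'b, 'x) bimodule \<Rightarrow> ('x \<Rightarrow> 'x) set" where
  "right_adjointable X = {T. \<exists>S. \<forall>x y. rip X (T x) y = rip X x (S y)}"

definition left_adjointable :: "('a, 'b, 'x) bimodule \<Rightarrow> ('x \<Rightarrow> 'x) set" where
  "left_adjointable X = {T. \<exists>S. \<forall>x y. lip X (T x) y = lip X x (S y)}"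

definition theta_r :: "('a, 'b, 'x) bimodule \<Rightarrow> 'x \<Rightarrow> 'x \<Rightarrow> 'x \<Rightarrow> 'x" where
  "theta_r X x y = (\<lambda>z. ract X x (rip X y z))"

definition op_norm_r :: "('a, 'b::cstar_algebra, 'x) bimodule \<Rightarrow> ('x \<Rightarrow> 'x) \<Rightarrow> real" where
  "op_norm_r X T = (SUP x\<in>{x. rnorm X x \<le> 1}. rnorm X (T x))"

text \<open>Scalars need not be mentioned in the span, since \<open>c \<theta>\<^sub>x\<^sub>,\<^sub>y\<close> is \<open>\<theta>\<^sub>c\<^sub>x\<^sub>,\<^sub>y\<close>.\<close>

definition compact_r :: "('a, 'b::cstar_algebra, 'x::ab_group_add) bimodule \<Rightarrow> ('x \<Rightarrow> 'x) set" where
  "compact_r X = {T \<in> right_adjointable X. \<forall>e>0. \<exists>(n::nat) x y.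
     op_norm_r X (\<lambda>z. T z - (\<Sum>i<n. theta_r X (x i) (y i) z)) < e}"

definition compact_alg_r ::
    "('a, 'b::cstar_algebra, 'x::ab_group_add) bimodule \<Rightarrow> ('x \<Rightarrow> 'x) nalg" where
  "compact_alg_r X =
     \<lparr>elems = compact_r X,
      vadd = (\<lambda>S T z. S z + T z),
      vscale = (\<lambda>c T z. scale X c (T z)),
      vnorm = op_norm_r X,
      vmult = (\<circ>)\<rparr>"


section \<open>Index\<close>

definition finite_right_numerical_index ::
    "('a::cstar_algebra, 'b::cstar_algebra, 'x::ab_group_add) bimodule \<Rightarrow> bool" where
  "finite_right_numerical_index X \<longleftrightarrow> (\<exists>l>0. \<forall>(n::nat) x.
     norm (\<Sum>i<n. lip X (x i) (x i)) \<le> l * op_norm_r X (\<lambda>z. \<Sum>i<n. theta_r X (x i) (x i) z))"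

definition index_map_r ::
    "('a::cstar_algebra, 'b::cstar_algebra, 'x::ab_group_add) bimodule \<Rightarrow> ('x \<Rightarrow> 'x) \<Rightarrow> 'a" where
  "index_map_r X = (THE F. F \<in> continuous_linear_maps (compact_alg_r X) cstar_alg \<and>
     (\<forall>x y. F (theta_r X x y) = lip X x y))"

definition r_Ind ::
    "('a::cstar_algebra, 'b::cstar_algebra, 'x::ab_group_add) bimodule \<Rightarrow> (('a \<Rightarrow> complex) \<Rightarrow> complex)" where
  "r_Ind X = normal_extension (compact_alg_r X) cstar_alg (index_map_r X)
     (unit_of (enveloping_vN (compact_alg_r X)))"

definition finite_right_index ::
    "('a::cstar_algebra, 'b::cstar_algebra, 'x::ab_group_add) bimodule \<Rightarrow> bool" where
  "finite_right_index X \<longleftrightarrow>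
     finite_right_numerical_index X \<and> r_Ind X \<in> multiplier_algebra cstar_alg"

definition finite_left_index ::
    "('a::cstar_algebra, 'b::cstar_algebra, 'x::ab_group_add) bimodule \<Rightarrow> bool" where
  "finite_left_index X \<longleftrightarrow> finite_right_index (contragradient X)"

definition finite_index ::
    "('a::cstar_algebra, 'b::cstar_algebra, 'x::ab_group_add) bimodule \<Rightarrow> bool" where
  "finite_index X \<longleftrightarrow> finite_right_index X \<and> finite_left_index X"


section \<open>The endomorphism algebras\<close>

definition AL_right :: "('a, 'b, 'x) bimodule \<Rightarrow> ('x \<Rightarrow> 'x) set" where
  "AL_right X = {T \<in> right_adjointable X. \<forall>a x. T (lact X a x) = lact X a (T x)}"

definition LB_left :: "('a, 'b, 'x) bimodule \<Rightarrow> ('x \<Rightarrow> 'x) set" where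
  "LB_left X = {T \<in> left_adjointable X. \<forall>x b. T (ract X x b) = ract X (T x) b}"

text \<open>Only the algebra structure is recorded: the two involutions (and the two operator norms) come
  from different inner products and need not agree.\<close>

record 'v calg = "'v cspace" +
  cmult :: "'v \<Rightarrow> 'v \<Rightarrow> 'v"

definition map_alg :: "('a, 'b, 'x::ab_group_add) bimodule \<Rightarrow> ('x \<Rightarrow> 'x) set \<Rightarrow> ('x \<Rightarrow> 'x) calg" where
  "map_alg X E =
     \<lparr>elems = E,
      vadd = (\<lambda>S T z. S z + T z),
      vscale = (\<lambda>c T z. scale X c (T z)),
      cmult = (\<circ>)\<rparr>"

definition AL_right_alg :: "('a, 'b, 'x::ab_group_add) bimodule \<Rightarrow> ('x \<Rightarrow> 'x) calg" where
  "AL_right_alg X = map_alg X (AL_right X)"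

definition LB_left_alg :: "('a, 'b, 'x::ab_group_add) bimodule \<Rightarrow> ('x \<Rightarrow> 'x) calg" where
  "LB_left_alg X = map_alg X (LB_left X)"

end

theory Submission
  imports Defs
begin

text \<open>
  A map \<open>T\<close> that is adjointable for the left inner product and commutes with the actions is shown to be
  adjointable for the right one; the converse follows by passing to the contragradient bimodule.

  Two facts about the index map \<open>F : \<K>(X\<^sub>B) \<rightarrow> A\<close> are used. It is bounded below on positive operators
  (a Pimsner-Popa inequality), because the two norms on \<open>X\<close> are equivalent. And \<open>r-Ind[X] \<in> M(A)\<close> means that
  \<open>a F(u) a\<^sup>*\<close> converges weakly to an element of \<open>A\<close> along an approximate unit \<open>u\<close> of \<open>\<K>(X\<^sub>B)\<close>, hence in norm
  along suitable convex combinations, by Hahn-Banach. Together they show that \<open>a u a\<^sup>*\<close> converges in norm to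
  \<open>\<phi>(a a\<^sup>*)\<close>, so \<open>\<phi>(a a\<^sup>*)\<close> is compact. As \<open>T\<close> is a bimodule map, \<open>T \<theta>\<^sub>x\<^sub>,\<^sub>y = \<theta>\<^sub>T\<^sub>x\<^sub>,\<^sub>y\<close>, so \<open>T \<phi>(a a\<^sup>*)\<close> is
  a norm limit of finite-rank operators and the adjoint of \<open>T\<close> is defined on \<open>a a\<^sup>* X\<close>; its domain is closed
  and \<open>A X\<close> is dense in \<open>X\<close>.

  Positivity in a C*-algebra rests on the binomial series of the square root. For operators on \<open>X\<close>,
  functional calculus is replaced by the iteration \<open>r \<mapsto> r - r h r\<close> (\<open>0 \<le> h, r \<le> 1\<close> commuting), for which
  \<open>\<Sum>\<^sub>j r\<^sub>j h r\<^sub>j \<le> 1\<close> has decreasing terms: \<open>h = \<Sum> \<theta>\<^sub>x\<^sub>,\<^sub>x\<close>, \<open>r\<^sub>0 = 1\<close> yields approximate units of the form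
  \<open>\<Sum> \<theta>\<^sub>z\<^sub>,\<^sub>z\<close>, and \<open>h = 1\<close> approximates a positive \<open>r\<^sub>0\<close> by sums of squares.
\<close>

text \<open>The obstacle: a map adjointable for one inner product is bounded and B-linear for the
  other, but on a Hilbert module this does not give an adjoint. Only products \<open>T k\<close>
  with \<open>k\<close> compact have one for free, so enough compact operators must be found among
  the left multiplications, which commute with \<open>T\<close>.

  The multiplier condition speaks about functionals on A only, and it is stated through
  \<open>THE\<close> descriptions that have to be resolved. The index map exists because the
  numerical index bound extends from diagonal sums to all finite-rank operators. The unit of the
  second dual is the weak* limit of approximate units, and its two Arens identities need different
  arguments. The normal extension is the double transpose, unique by weak* density.

  Approximate units are organised as convex sets rather than as one net, so that the convex
  combinations found by Hahn-Banach are approximate units again. They are not monotone, so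
  \<open>v - u\<close> need not be positive; the operator \<open>v - v u v\<close> takes its
  place.\<close>

lemma star_zero [simp]: "star (0::'a::cstar_algebra) = 0"
  using star_add[of "0::'a" 0] by simp

lemma star_minus [simp]: "star (- a) = - star (a::'a::cstar_algebra)"
  using star_add[of a "- a"] by (simp add: add_eq_0_iff)

lemma star_diff: "star (a - b) = star a - star (b::'a::cstar_algebra)"
  using star_add[of a "- b"] by simp

lemma star_sum: "star (\<Sum>i\<in>I. f i) = (\<Sum>i\<in>I. star (f i :: 'a::cstar_algebra))"
  by (induction I rule: infinite_finite_induct) (simp_all add: star_add)

lemma star_scaleR: "star (r *\<^sub>R a) = r *\<^sub>R star (a::'a::cstar_algebra)"
  by (simp add: scaleR_scaleC star_scaleC)

lemma scaleC_one [simp]: "1 *\<^sub>C (a::'a::cstar_algebra) = a"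
  using scaleR_scaleC[of 1 a] by simp

lemma scaleC_zero_left [simp]: "0 *\<^sub>C (a::'a::cstar_algebra) = 0"
  using scaleR_scaleC[of 0 a] by simp

lemma scaleC_zero_right [simp]: "c *\<^sub>C (0::'a::cstar_algebra) = 0"
  using scaleC_add_right[of c "0::'a" 0] by simp

lemma scaleC_minus_right: "c *\<^sub>C (- a) = - (c *\<^sub>C (a::'a::cstar_algebra))"
  using scaleC_add_right[of c a "- a"] by (simp add: add_eq_0_iff)

lemma scaleC_minus_left: "(- c) *\<^sub>C a = - (c *\<^sub>C (a::'a::cstar_algebra))"
  using scaleC_add_left[of c "- c" a] by (simp add: add_eq_0_iff)

lemma scaleC_diff_right: "c *\<^sub>C (a - b) = c *\<^sub>C a - c *\<^sub>C (b::'a::cstar_algebra)"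
  using scaleC_add_right[of c a "- b"] by (simp add: scaleC_minus_right)

lemma norm_star [simp]: "norm (star a) = norm (a::'a::cstar_algebra)"
proof -
  have "norm x \<le> norm (star x)" for x :: 'a
    using cstar_identity[of x] norm_mult_ineq[of "star x" x]
    by (cases "norm x = 0") (auto simp: power2_eq_square)
  from this[of a] this[of "star a"] show ?thesis by (simp add: star_star)
qed

lemma norm_mult_star: "norm (a * star a) = (norm (a::'a::cstar_algebra))\<^sup>2"
  using cstar_identity[of "star a"] by (simp add: star_star)

lemma norm_square_selfadj: "star a = a \<Longrightarrow> norm (a * a) = (norm (a::'a::cstar_algebra))\<^sup>2"
  using cstar_identity[of a] by simp

lemma bounded_linear_star: "bounded_linear (star :: 'a::cstar_algebra \<Rightarrow> 'a)"
  by (rule bounded_linear_intro[of _ 1]) (simp_all add: star_add star_scaleR)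

section \<open>Positivity in unital C*-algebras\<close>

lemma star_one [simp]: "star (1::'a::{cstar_algebra,real_normed_algebra_1}) = 1"
  by (metis mult_1 star_mult star_star)

lemma star_power: "star (a ^ n) = star (a::'a::{cstar_algebra,real_normed_algebra_1}) ^ n"
  by (induction n) (simp_all add: star_mult power_commutes)

section \<open>The binomial series of \<open>sqrt (1 - x)\<close>, up to the boundary of its disc of
  convergence\<close>

definition sqrt_coeff :: "nat \<Rightarrow> real" where
  "sqrt_coeff n = (- 1) ^ n * ((1/2) gchoose n)"

lemma sqrt_coeff_0 [simp]: "sqrt_coeff 0 = 1"
  by (simp add: sqrt_coeff_def)

lemma sqrt_coeff_Suc: "sqrt_coeff (Suc n) = sqrt_coeff n * (real n - 1/2) / (real n + 1)"
proof -
  have *: "(1/2 gchoose Suc n) = (1/2 gchoose n) * (1/2 - real n) / (real n + 1)"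
    using gbinomial_mult_1[of "1/2::real" n] by (simp add: field_simps)
  show ?thesis
    unfolding sqrt_coeff_def * by (simp add: divide_simps) (simp add: algebra_simps)
qed

lemma sqrt_coeff_Suc_nonpos: "sqrt_coeff (Suc n) \<le> 0"
proof (induction n)
  case 0
  show ?case by (simp add: sqrt_coeff_Suc)
next
  case (Suc n)
  have "sqrt_coeff (Suc (Suc n)) = sqrt_coeff (Suc n) * ((real (Suc n) - 1/2) / (real (Suc n) + 1))"
    by (subst sqrt_coeff_Suc) simp
  also have "\<dots> \<le> 0"
    by (intro mult_nonpos_nonneg Suc) simp_all
  finally show ?case .
qed

text \<open>The partial sums of the coefficients of \<open>sqrt (1 - x)\<close> are the Taylor
  coefficients of \<open>(1 - x)\<close> to the power -1/2. Since all terms after the first are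
  nonpositive, this bounds the sum of their absolute values by 1.\<close>

lemma sqrt_coeff_partial_sum_nonneg: "(\<Sum>k\<le>n. sqrt_coeff k) \<ge> 0"
proof -
  have "(\<Sum>k\<le>n. sqrt_coeff k) = (-1) ^ n * ((-1/2) gchoose n)"
    using gbinomial_sum_lower_neg[of "1/2::real" n] by (simp add: sqrt_coeff_def mult.commute)
  also have "\<dots> = ((1/2 + real n - 1) gchoose n)"
    using gbinomial_minus[of "1/2::real" n] by (simp flip: power_mult_distrib mult.assoc)
  also have "\<dots> \<ge> 0"
    unfolding gbinomial_prod_rev
    by (intro divide_nonneg_nonneg prod_nonneg) auto
  finally show ?thesis .
qed

lemma summable_abs_sqrt_coeff: "summable (\<lambda>n. \<bar>sqrt_coeff n\<bar>)"
proof (rule bounded_imp_summable)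
  fix n
  have "(\<Sum>k\<le>n. \<bar>sqrt_coeff k\<bar>) = 2 - (\<Sum>k\<le>n. sqrt_coeff k)"
    using sqrt_coeff_Suc_nonpos by (induction n) (simp_all add: abs_of_nonpos)
  then show "(\<Sum>k\<le>n. \<bar>sqrt_coeff k\<bar>) \<le> 2"
    using sqrt_coeff_partial_sum_nonneg[of n] by simp
qed simp

text \<open>Vandermonde with upper indices 1/2 and 1/2 leaves the binomial coefficients of 1, so the
  Cauchy square of the series is \<open>1 - x\<close>.\<close>

lemma sqrt_coeff_convolution:
  "(\<Sum>i\<le>n. sqrt_coeff i * sqrt_coeff (n - i)) = (if n = 0 then 1 else if n = 1 then -1 else 0)"
proof -
  have "(\<Sum>i\<le>n. sqrt_coeff i * sqrt_coeff (n - i))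
      = (-1) ^ n * (\<Sum>i=0..n. ((1/2) gchoose i) * ((1/2) gchoose (n - i)))"
    unfolding sum_distrib_left atMost_atLeast0
  proof (intro sum.cong refl)
    fix i assume "i \<in> {0..n}"
    then have "(-1) ^ n = (-1) ^ i * (-1::real) ^ (n - i)"
      by (simp flip: power_add)
    then show "sqrt_coeff i * sqrt_coeff (n - i) = (-1) ^ n * (((1/2) gchoose i) * ((1/2) gchoose (n - i)))"
      by (simp add: sqrt_coeff_def)
  qed
  also have "\<dots> = (-1) ^ n * (of_nat 1 gchoose n)"
    by (subst gbinomial_Vandermonde) simp
  also have "\<dots> = (if n = 0 then 1 else if n = 1 then -1 else 0)"
    by (simp only: binomial_gbinomial[symmetric]) (auto simp: binomial_eq_0)
  finally show ?thesis .
qed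

text \<open>Absolute summability of the coefficients makes the series converge on the closed unit
  ball, boundary included. The last two clauses replace functional calculus later on: the norm bound
  allows a root to be taken of the root, and \<open>s\<close> commutes with whatever commutes with
  \<open>a\<close>, being a limit of polynomials in \<open>a\<close>.\<close>

lemma sqrt_one_minus:
  fixes a :: "'a::{cstar_algebra,real_normed_algebra_1}"
  assumes sa: "star a = a" and le: "norm a \<le> 1"
  obtains s where "star s = s" "s * s = 1 - a" "norm (1 - s) \<le> 1"
    "\<And>x. x * a = a * x \<Longrightarrow> x * s = s * x"
proof
  define f where "f n = sqrt_coeff n *\<^sub>R a ^ n" for n
  have nf: "norm (f n) \<le> \<bar>sqrt_coeff n\<bar>" for n
    using mult_left_mono[OF order_trans[OF norm_power_ineq[of a n] power_le_one[OF norm_ge_zero le]],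
        of "\<bar>sqrt_coeff n\<bar>"]
    by (simp add: f_def)
  have sn: "summable (\<lambda>n. norm (f n))"
    by (rule summable_comparison_test'[OF summable_abs_sqrt_coeff, of 0]) (simp add: nf)
  note sf = summable_norm_cancel[OF sn]
  define s where "s = suminf f"
  show "norm (1 - s) \<le> 1"
  proof -
    have "s = (\<Sum>n. f (Suc n)) + f 0"
      unfolding s_def using suminf_split_initial_segment[OF sf, of 1] by simp
    then have "norm (1 - s) = norm (\<Sum>n. f (Suc n))"
      by (simp add: f_def norm_minus_commute)
    also have "\<dots> \<le> (\<Sum>n. \<bar>sqrt_coeff (Suc n)\<bar>)"
      using summable_abs_sqrt_coeff nf
      by (intro norm_suminf_le) (auto simp: summable_Suc_iff[of "\<lambda>n. \<bar>sqrt_coeff n\<bar>"])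
    also have "\<dots> \<le> 1"
    proof (rule suminf_le_const)
      show "(\<Sum>k<n. \<bar>sqrt_coeff (Suc k)\<bar>) \<le> 1" for n
      proof -
        have "(\<Sum>k<n. \<bar>sqrt_coeff (Suc k)\<bar>) = 1 - (\<Sum>k\<le>n. sqrt_coeff k)"
          using sqrt_coeff_Suc_nonpos by (induction n) (simp_all add: abs_of_nonpos)
        then show ?thesis using sqrt_coeff_partial_sum_nonneg[of n] by simp
      qed
    qed (use summable_abs_sqrt_coeff in \<open>simp add: summable_Suc_iff[of "\<lambda>n. \<bar>sqrt_coeff n\<bar>"]\<close>)
    finally show ?thesis .
  qed
  show "star s = s"
  proof -
    have "star s = (\<Sum>n. star (f n))"
      unfolding s_def by (rule bounded_linear.suminf[OF bounded_linear_star sf])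
    also have "\<dots> = s"
      by (simp add: s_def f_def[abs_def] star_scaleR star_power sa)
    finally show ?thesis .
  qed
  have "(\<Sum>i\<le>n. f i * f (n - i)) = (if n = 0 then 1 else if n = 1 then - a else 0)" for n
  proof -
    have "(\<Sum>i\<le>n. f i * f (n - i)) = (\<Sum>i\<le>n. sqrt_coeff i * sqrt_coeff (n - i)) *\<^sub>R a ^ n"
      unfolding scaleR_sum_left
      by (intro sum.cong refl) (simp add: f_def mult.commute flip: power_add)
    then show ?thesis unfolding sqrt_coeff_convolution by auto
  qed
  then have 1: "(\<lambda>n. if n = 0 then 1 else if n = 1 then - a else 0) sums (s * s)"
    using Cauchy_product_sums[OF sn sn] by (simp add: s_def)
  have 2: "(\<lambda>n. if n = 0 then 1 else if n = 1 then - a else 0)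
      sums (\<Sum>n\<in>{0,1::nat}. if n = 0 then 1 else if n = 1 then - a else 0)"
    by (rule sums_finite) auto
  show "s * s = 1 - a"
    using sums_unique2[OF 1 2] by simp
  show "x * s = s * x" if "x * a = a * x" for x
  proof -
    have "x * a ^ n = a ^ n * x" for n
      using that by (metis power_commuting_commutes)
    then have "x * f n = f n * x" for n
      by (simp add: f_def)
    then show ?thesis
      unfolding s_def suminf_mult[OF sf, symmetric] suminf_mult2[OF sf] by simp
  qed
qed

text \<open>The working form of positivity, with a self-adjoint root. That \<open>star b * b\<close>
  is always of this form is the deep fact of the section, reached in
  \<open>is_square_star_mult\<close>.\<close>

definition is_square :: "'a::cstar_algebra \<Rightarrow> bool" where
  "is_square a \<longleftrightarrow> (\<exists>h. star h = h \<and> a = h * h)"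

text \<open>The element \<open>u = h + \<i> *\<^sub>C k\<close> satisfies
  \<open>star u * u = r *\<^sub>R 1\<close>, which determines its norm, and \<open>h\<close> is its
  real part.\<close>

lemma norm_le_of_commuting_squares:
  fixes h k :: "'a::{cstar_algebra,real_normed_algebra_1}"
  assumes sa: "star h = h" "star k = k" and comm: "h * k = k * h"
    and eq: "h * h + k * k = r *\<^sub>R 1"
  shows "norm h ^ 2 \<le> \<bar>r\<bar>"
proof -
  define u where "u = h + \<i> *\<^sub>C k"
  have su: "star u = h - \<i> *\<^sub>C k"
    by (simp add: u_def star_add star_scaleC sa scaleC_minus_left)
  have "star u * u = h * h + k * k"
    unfolding su unfolding u_def
    by (simp add: algebra_simps mult_scaleC_left mult_scaleC_right scaleC_scaleC scaleC_minus_left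
        scaleC_diff_right comm)
  then have nu: "norm u ^ 2 = \<bar>r\<bar>"
    using cstar_identity[of u] eq by simp
  have "2 *\<^sub>R h = u + star u"
    unfolding su unfolding u_def by (simp add: scaleR_2)
  then have "2 * norm h \<le> norm u + norm (star u)"
    by (metis norm_scaleR norm_triangle_ineq abs_numeral)
  then have "norm h \<le> norm u" by simp
  then show ?thesis using nu by (metis norm_ge_zero power_mono)
qed

text \<open>The root \<open>k\<close> of \<open>1 - h * h\<close> commutes with \<open>h\<close> and
  \<open>h * h + k * k = 1\<close>, so the preceding bound applies to \<open>k\<close>.\<close>

lemma norm_one_minus_square:
  fixes h :: "'a::{cstar_algebra,real_normed_algebra_1}"
  assumes sa: "star h = h" and le: "norm h \<le> 1"
  shows "norm (1 - h * h) \<le> 1"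
proof -
  have "star (h * h) = h * h" by (simp add: star_mult sa)
  moreover have "norm (h * h) \<le> 1"
    using le by (simp add: norm_square_selfadj[OF sa] power_le_one)
  ultimately obtain k where k: "star k = k" "k * k = 1 - h * h"
      "\<And>x. x * (h * h) = h * h * x \<Longrightarrow> x * k = k * x"
    by (rule sqrt_one_minus) blast
  have "norm k ^ 2 \<le> \<bar>1\<bar>"
    using k by (intro norm_le_of_commuting_squares[of k h]) (auto simp: sa mult.assoc)
  then show ?thesis
    using norm_square_selfadj[OF k(1)] k(2) by simp
qed

text \<open>With \<open>is_square_root\<close> as converse, this describes squares by a condition on
  distances. In that form the triangle inequality shows that they are closed under sums.\<close>

lemma is_square_norm_bound:
  fixes a :: "'a::{cstar_algebra,real_normed_algebra_1}"
  assumes "is_square a" and t: "norm a \<le> t"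
  shows "norm (t *\<^sub>R 1 - a) \<le> t"
proof (cases "t = 0")
  case False
  then have tpos: "t > 0" using t norm_ge_zero[of a] by linarith
  obtain h where h: "star h = h" "a = h * h" using assms by (auto simp: is_square_def)
  define g where "g = (1 / sqrt t) *\<^sub>R h"
  have gg: "g * g = (1/t) *\<^sub>R a" using tpos by (simp add: g_def h)
  have "norm g ^ 2 \<le> 1"
    using norm_square_selfadj[of g] t tpos
    by (simp add: gg) (simp add: g_def h star_scaleR divide_simps)
  then have "norm g \<le> 1" by (simp add: power2_le_iff_abs_le abs_square_le_1)
  then have "norm (1 - g * g) \<le> 1"
    by (intro norm_one_minus_square) (simp_all add: g_def h star_scaleR)
  moreover have "t *\<^sub>R 1 - a = t *\<^sub>R (1 - g * g)"
    using tpos by (simp add: gg algebra_simps)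
  ultimately show ?thesis using tpos by simp
qed (use assms in auto)

text \<open>The root of \<open>a / t\<close> comes from the series at \<open>1 - a / t\<close>. The
  conclusion on \<open>sqrt t *\<^sub>R 1 - h\<close> has the shape of the hypothesis on
  \<open>a\<close>, so the lemma can be iterated.\<close>

lemma is_square_root:
  fixes a :: "'a::{cstar_algebra,real_normed_algebra_1}"
  assumes sa: "star a = a" and le: "norm (t *\<^sub>R 1 - a) \<le> t"
  obtains h where "star h = h" "h * h = a" "norm (sqrt t *\<^sub>R 1 - h) \<le> sqrt t"
    "\<And>x. x * a = a * x \<Longrightarrow> x * h = h * x"
proof (cases "t = 0")
  case True
  then have "a = 0" using le by simp
  then show ?thesis using that[of 0] True by simp
next
  case False
  then have tpos: "t > 0" using le by (metis norm_ge_zero order_trans order_le_less)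
  have "norm ((1/t) *\<^sub>R (t *\<^sub>R 1 - a)) \<le> 1"
    using le tpos by simp
  moreover have eq: "(1/t) *\<^sub>R (t *\<^sub>R 1 - a) = 1 - (1/t) *\<^sub>R a"
    using tpos by (simp add: algebra_simps)
  ultimately have le': "norm (1 - (1/t) *\<^sub>R a) \<le> 1" by metis
  have sa': "star (1 - (1/t) *\<^sub>R a) = 1 - (1/t) *\<^sub>R a"
    by (simp add: star_diff star_scaleR sa)
  obtain s where s: "star s = s" "s * s = 1 - (1 - (1/t) *\<^sub>R a)" "norm (1 - s) \<le> 1"
      "\<And>x. x * (1 - (1/t) *\<^sub>R a) = (1 - (1/t) *\<^sub>R a) * x \<Longrightarrow> x * s = s * x"
    by (rule sqrt_one_minus[OF sa' le']) blast
  show ?thesis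
  proof
    show "star (sqrt t *\<^sub>R s) = sqrt t *\<^sub>R s" by (simp add: star_scaleR s)
    show "(sqrt t *\<^sub>R s) * (sqrt t *\<^sub>R s) = a" using tpos by (simp add: s)
    have "sqrt t *\<^sub>R 1 - sqrt t *\<^sub>R s = sqrt t *\<^sub>R (1 - s)"
      by (simp add: scaleR_diff_right)
    then show "norm (sqrt t *\<^sub>R 1 - sqrt t *\<^sub>R s) \<le> sqrt t"
      using s(3) tpos by simp
    show "x * (sqrt t *\<^sub>R s) = (sqrt t *\<^sub>R s) * x" if "x * a = a * x" for x
    proof -
      have "x * s = s * x"
        by (rule s(4)) (simp add: right_diff_distrib left_diff_distrib that)
      then show ?thesis by simp
    qed
  qed
qed

lemma is_square_add:
  fixes a b :: "'a::{cstar_algebra,real_normed_algebra_1}"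
  assumes "is_square a" "is_square b"
  shows "is_square (a + b)"
proof -
  have "norm ((norm a + norm b) *\<^sub>R 1 - (a + b)) \<le> norm (norm a *\<^sub>R 1 - a) + norm (norm b *\<^sub>R 1 - b)"
    by (rule order_trans[OF _ norm_triangle_ineq]) (simp add: algebra_simps)
  also have "\<dots> \<le> norm a + norm b"
    by (intro add_mono is_square_norm_bound assms order_refl)
  finally have le: "norm ((norm a + norm b) *\<^sub>R 1 - (a + b)) \<le> norm a + norm b" .
  have "star (a + b) = a + b"
    using assms by (auto simp: is_square_def star_add star_mult)
  then obtain h where "star h = h" "h * h = a + b"
    using le by (rule is_square_root) blast
  then show ?thesis unfolding is_square_def by metis
qed

lemma is_square_self_adjoint: "is_square a \<Longrightarrow> star a = a"
  by (auto simp: is_square_def star_mult)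

lemma is_square_scaleR:
  assumes "r \<ge> 0" "is_square a"
  shows "is_square (r *\<^sub>R a)"
proof -
  obtain h where "star h = h" "a = h * h" using assms by (auto simp: is_square_def)
  then show ?thesis
    unfolding is_square_def using assms(1)
    by (intro exI[of _ "sqrt r *\<^sub>R h"]) (simp add: star_scaleR)
qed

text \<open>Exponential growth beats linear growth. Only exponents \<open>2 ^ m\<close> are tested,
  because the norm of a self-adjoint element is multiplicative along them.\<close>

lemma power_growth_le_1:
  fixes r :: real
  assumes "\<And>m. r ^ (2 ^ m) \<le> 1 + 2 ^ m"
  shows "r \<le> 1"
proof (rule ccontr)
  assume "\<not> r \<le> 1"
  \<comment> \<open>Bernoulli for \<open>r\<close> itself gives linear growth, which does not
    contradict the bound. Applied to the square root of \<open>r\<close> and squared, it gives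
    quadratic growth.\<close>
  define s where "s = sqrt r"
  have s: "s > 1" "r = s * s" using \<open>\<not> r \<le> 1\<close> by (auto simp: s_def)
  have *: "2 ^ m * (s - 1)\<^sup>2 \<le> 2" for m :: nat
  proof -
    have "2 ^ m * (s - 1) \<le> s ^ (2 ^ m)"
      using Bernoulli_inequality[of "s - 1" "2 ^ m"] s by simp
    then have "(2 ^ m * (s - 1)) * (2 ^ m * (s - 1)) \<le> s ^ (2 ^ m) * s ^ (2 ^ m)"
      using s by (intro mult_mono) auto
    also have "\<dots> = r ^ (2 ^ m)" by (simp add: s power_mult_distrib)
    also have "\<dots> \<le> 1 + 2 ^ m" by (rule assms)
    also have "\<dots> \<le> 2 ^ m * 2" by simp
    also have "(2 ^ m * (s - 1)) * (2 ^ m * (s - 1)) = 2 ^ m * (2 ^ m * (s - 1)\<^sup>2)"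
      by (simp add: power2_eq_square)
    finally show ?thesis by (subst (asm) mult_le_cancel_left_pos) simp_all
  qed
  obtain m where "2 / (s - 1)\<^sup>2 < 2 ^ m"
    using real_arch_pow[of 2] by auto
  then show False using *[of m] s by (simp add: divide_simps split: if_splits)
qed

text \<open>\<open>c\<^sup>* c\<close> and \<open>c c\<^sup>*\<close> have the same spectrum up to \<open>0\<close>; here the powers of \<open>t + c c\<^sup>*\<close> are
  compared with those of \<open>t + c\<^sup>* c\<close>.\<close>

lemma is_square_minus_star_swap:
  fixes c :: "'a::{cstar_algebra,real_normed_algebra_1}"
  assumes sq: "is_square (- (star c * c))"
  shows "is_square (- (c * star c))"
proof (cases "c = 0")
  case True
  then show ?thesis using sq by simp
next
  case False
  define t where "t = (norm c)\<^sup>2"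
  define e where "e = t *\<^sub>R 1 + star c * c"
  define d where "d = t *\<^sub>R 1 + c * star c"
  have t: "t > 0" using False by (simp add: t_def)
  have ne: "norm e \<le> t"
    using is_square_norm_bound[OF sq, of t] by (simp add: e_def t_def cstar_identity)
  have dc: "d * c = c * e"
    by (simp add: d_def e_def algebra_simps)
  \<comment> \<open>By \<open>d * c = c * e\<close> the factor between \<open>c\<close> and
    \<open>star c\<close> obeys the recursion \<open>g \<mapsto> t ^ n + e * g\<close>. As
    \<open>norm e \<le> t\<close>, it grows only linearly in comparison with
    \<open>t ^ n\<close>.\<close>
  have "\<exists>g. d ^ n = t ^ n *\<^sub>R 1 + c * g * star c \<and> norm g * t \<le> real n * t ^ n" for n
  proof (induction n)
    case 0
    then show ?case by (intro exI[of _ 0]) simp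
  next
    case (Suc n)
    then obtain g where g: "d ^ n = t ^ n *\<^sub>R 1 + c * g * star c" "norm g * t \<le> real n * t ^ n"
      by blast
    have "d ^ Suc n = t ^ n *\<^sub>R d + (d * c) * g * star c"
      by (simp add: g(1) algebra_simps)
    also have "\<dots> = t ^ Suc n *\<^sub>R 1 + c * (t ^ n *\<^sub>R 1 + e * g) * star c"
      unfolding dc by (simp add: d_def algebra_simps)
    finally have 1: "d ^ Suc n = t ^ Suc n *\<^sub>R 1 + c * (t ^ n *\<^sub>R 1 + e * g) * star c" .
    have "norm (t ^ n *\<^sub>R 1 + e * g) \<le> t ^ n + t * norm g"
      using t by (intro order_trans[OF norm_triangle_ineq] add_mono order_trans[OF norm_mult_ineq]
          mult_right_mono ne) auto
    then have "norm (t ^ n *\<^sub>R 1 + e * g) * t \<le> (t ^ n + t * norm g) * t"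
      using t by simp
    also have "\<dots> = t ^ Suc n + t * (norm g * t)"
      by (simp add: algebra_simps)
    also have "\<dots> \<le> t ^ Suc n + t * (real n * t ^ n)"
      using t g(2) by (intro add_left_mono mult_left_mono) auto
    also have "\<dots> = real (Suc n) * t ^ Suc n"
      by (simp add: algebra_simps)
    finally show ?case using 1 by blast
  qed
  then have dual_norm: "norm (d ^ n) \<le> (1 + real n) * t ^ n" for n
  proof -
    obtain g where g: "d ^ n = t ^ n *\<^sub>R 1 + c * g * star c" "norm g * t \<le> real n * t ^ n"
      using \<open>\<And>n. \<exists>g. d ^ n = t ^ n *\<^sub>R 1 + c * g * star c \<and> norm g * t \<le> real n * t ^ n\<close> by blast
    have "norm (c * g * star c) \<le> norm (c * g) * norm c"
      using norm_mult_ineq[of "c * g" "star c"] by simp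
    also have "\<dots> \<le> norm c * norm g * norm c"
      by (intro mult_right_mono norm_mult_ineq) simp
    also have "\<dots> = norm g * t" by (simp add: t_def power2_eq_square)
    finally have "norm (c * g * star c) \<le> real n * t ^ n" using g(2) by simp
    then show ?thesis
      using norm_triangle_ineq[of "t ^ n *\<^sub>R 1" "c * g * star c"] t
      unfolding g(1) by (simp add: algebra_simps)
  qed
  have sd: "star d = d" by (simp add: d_def star_add star_scaleR star_mult star_star)
  \<comment> \<open>The spectral radius formula in elementary form: for self-adjoint
    \<open>d\<close>, polynomial growth of the norms of \<open>d ^ n / t ^ n\<close> forces
    \<open>norm d \<le> t\<close>.\<close>
  have pow2: "norm (d ^ (2 ^ m)) = norm d ^ (2 ^ m)" for m
  proof (induction m)
    case (Suc m)
    have "d ^ (2 ^ Suc m) = d ^ (2 ^ m) * d ^ (2 ^ m)"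
      by (simp flip: power_add add: mult_2)
    moreover have "star (d ^ (2 ^ m)) = d ^ (2 ^ m)"
      by (simp add: star_power sd)
    ultimately show ?case
      using Suc by (simp add: norm_square_selfadj flip: power_mult) (simp add: mult.commute)
  qed simp
  have "norm d / t \<le> 1"
  proof (rule power_growth_le_1)
    show "(norm d / t) ^ (2 ^ m) \<le> 1 + 2 ^ m" for m
      using dual_norm[of "2 ^ m"] t unfolding pow2 by (simp add: power_divide divide_le_eq)
  qed
  then have le: "norm (t *\<^sub>R 1 - (- (c * star c))) \<le> t"
    using t by (simp add: d_def divide_le_eq)
  have sa: "star (- (c * star c)) = - (c * star c)"
    by (simp add: star_mult star_star)
  obtain h where "star h = h" "h * h = - (c * star c)"
    by (rule is_square_root[OF sa le]) blast
  then show ?thesis unfolding is_square_def by metis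
qed

text \<open>The root of \<open>- a\<close> commutes with any root of \<open>a\<close>, and the two
  squares add up to 0; \<open>norm_le_of_commuting_squares\<close> is applied with
  \<open>r = 0\<close>.\<close>

lemma eq_zero_of_is_square_minus:
  fixes a :: "'a::{cstar_algebra,real_normed_algebra_1}"
  assumes a: "is_square a" and b: "is_square (- a)"
  shows "a = 0"
proof -
  obtain h where h: "star h = h" "h * h = a" using a by (auto simp: is_square_def)
  obtain k where k: "star k = k" "k * k = - a" "\<And>x. x * - a = - a * x \<Longrightarrow> x * k = k * x"
    by (rule is_square_root[OF is_square_self_adjoint[OF b] is_square_norm_bound[OF b order_refl]]) blast
  have "h * k = k * h"
    by (rule k(3)) (simp add: mult.assoc flip: h(2))
  then have "norm h ^ 2 \<le> \<bar>0\<bar>"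
    by (intro norm_le_of_commuting_squares[of h k]) (use h k(1,2) in auto)
  then show ?thesis using h(2) by simp
qed

text \<open>With \<open>x\<close> and \<open>y\<close> twice the real and (up to sign) imaginary
  parts of \<open>c\<close>, the sum \<open>star c * c + c * star c\<close> is half of
  \<open>x * x + y * y\<close>. Swapping the factors makes \<open>- (c * star c)\<close> a square
  too, so \<open>star c * c\<close> and its negative are both squares.\<close>

lemma eq_zero_of_is_square_minus_star_mult:
  fixes c :: "'a::{cstar_algebra,real_normed_algebra_1}"
  assumes sq: "is_square (- (star c * c))"
  shows "c = 0"
proof -
  define x where "x = c + star c"
  define y where "y = \<i> *\<^sub>C (star c - c)"
  have "star x = x" "star y = y"
    by (simp_all add: x_def y_def star_add star_diff star_star star_scaleC scaleC_minus_left
        scaleC_diff_right)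
  then have "is_square ((1/2) *\<^sub>R (x * x) + (1/2) *\<^sub>R (y * y) + - (c * star c))"
    by (intro is_square_add is_square_scaleR is_square_minus_star_swap sq) (auto simp: is_square_def)
  also have "y * y = - ((star c - c) * (star c - c))"
    by (simp add: y_def mult_scaleC_left mult_scaleC_right scaleC_scaleC scaleC_minus_left)
  then have "x * x + y * y = 2 *\<^sub>R (star c * c + c * star c)"
    by (simp add: x_def algebra_simps scaleR_2)
  then have "(1/2) *\<^sub>R (x * x) + (1/2) *\<^sub>R (y * y) + - (c * star c) = star c * c"
    by (simp flip: scaleR_add_right)
  finally have "star c * c = 0"
    using sq eq_zero_of_is_square_minus by blast
  then show ?thesis using cstar_identity[of c] by simp
qed

text \<open>Here \<open>p\<close> is the absolute value of \<open>a = star b * b\<close> and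
  \<open>q = p - a\<close> is twice its negative part. Then \<open>q * a * q\<close> is minus a
  square, which says that \<open>b * q\<close> satisfies the hypothesis of the preceding lemma. So
  \<open>b * q = 0\<close>, the cube of \<open>q\<close> vanishes, and \<open>a = p\<close>.\<close>

lemma is_square_star_mult:
  fixes b :: "'a::{cstar_algebra,real_normed_algebra_1}"
  shows "is_square (star b * b)"
proof -
  define a where "a = star b * b"
  have sa: "star a = a" by (simp add: a_def star_mult star_star)
  have "is_square (a * a)" using sa by (auto simp: is_square_def)
  then have "star (a * a) = a * a" "norm (norm (a * a) *\<^sub>R 1 - a * a) \<le> norm (a * a)"
    by (simp_all add: is_square_norm_bound is_square_self_adjoint)
  then obtain p where p: "star p = p" "p * p = a * a"
      "norm (sqrt (norm (a * a)) *\<^sub>R 1 - p) \<le> sqrt (norm (a * a))"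
      "\<And>x. x * (a * a) = a * a * x \<Longrightarrow> x * p = p * x"
    by (rule is_square_root) blast
  have ap: "a * p = p * a" using p(4)[of a] by (simp add: mult.assoc)
  obtain h where h: "star h = h" "h * h = p" "\<And>x. x * p = p * x \<Longrightarrow> x * h = h * x"
    by (rule is_square_root[OF p(1) p(3)]) blast
  define q where "q = p - a"
  have sq: "star q = q" by (simp add: q_def star_diff p sa)
  have qp: "q * p = p * q" by (simp add: q_def algebra_simps ap)
  have qh: "q * h = h * q" using h(3)[OF qp] .
  have qa: "2 *\<^sub>R (q * a) = - (q * q)" and qqp: "2 *\<^sub>R (q * p) = q * q"
    by (simp_all add: q_def algebra_simps ap p(2) scaleR_2)
  have "2 *\<^sub>R (q * a * q) = - (q * q * q)"
    using arg_cong[OF qa, of "\<lambda>z. z * q"] by simp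
  also have "\<dots> = - (q * (2 *\<^sub>R (q * p)))"
    by (simp add: qqp mult.assoc)
  finally have "2 *\<^sub>R (q * a * q) = 2 *\<^sub>R (- (q * q * p))"
    by (simp add: mult.assoc)
  then have "q * a * q = - (q * q * p)"
    by (simp only: scaleR_cancel_left) simp
  also have "\<dots> = - ((q * h) * (q * h))"
    by (metis h(2) mult.assoc qh)
  finally have qaq: "q * a * q = - ((q * h) * (q * h))" .
  have "star (q * h) = q * h" by (simp add: star_mult sq h qh)
  moreover have "- (star (b * q) * (b * q)) = (q * h) * (q * h)"
    using qaq by (simp add: star_mult sq a_def mult.assoc)
  ultimately have "is_square (- (star (b * q) * (b * q)))"
    unfolding is_square_def by metis
  then have "b * q = 0" by (rule eq_zero_of_is_square_minus_star_mult)
  then have "q * a * q = 0" by (simp add: a_def mult.assoc)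
  then have "q * q * q = 0"
    using \<open>2 *\<^sub>R (q * a * q) = - (q * q * q)\<close> by simp
  then have "norm ((q * q) * (q * q)) = 0" by (simp add: mult.assoc)
  then have "q = 0"
    using norm_square_selfadj[of "q * q"] norm_square_selfadj[OF sq] by (simp add: star_mult sq)
  then have "a = h * h" using h(2) by (simp add: q_def)
  then show ?thesis using h(1) by (auto simp: is_square_def a_def)
qed

lemma positive_iff_is_square:
  "positive (a::'a::{cstar_algebra,real_normed_algebra_1}) \<longleftrightarrow> is_square a"
proof
  show "positive a \<Longrightarrow> is_square a" using is_square_star_mult by (auto simp: positive_def)
  show "is_square a \<Longrightarrow> positive a" unfolding positive_def is_square_def by metis
qed

lemma positive_self_adjoint: "positive a \<Longrightarrow> star a = a"
  by (auto simp: positive_def star_mult star_star)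

lemma positive_conj: "positive a \<Longrightarrow> positive (star c * a * c)"
  unfolding positive_def by (metis mult.assoc star_mult)

text \<open>Commuting roots of \<open>a\<close> and of \<open>r *\<^sub>R 1 - a\<close> have squares
  with sum \<open>r *\<^sub>R 1\<close>.\<close>

lemma norm_le_of_positive_diff:
  fixes a :: "'a::{cstar_algebra,real_normed_algebra_1}"
  assumes a: "positive a" and b: "positive (r *\<^sub>R 1 - a)" and r: "r \<ge> 0"
  shows "norm a \<le> r"
proof -
  note a' = a[unfolded positive_iff_is_square] and b' = b[unfolded positive_iff_is_square]
  obtain h where h: "star h = h" "h * h = a"
    using a' by (auto simp: is_square_def)
  obtain k where k: "star k = k" "k * k = r *\<^sub>R 1 - a"
      "\<And>x. x * (r *\<^sub>R 1 - a) = (r *\<^sub>R 1 - a) * x \<Longrightarrow> x * k = k * x"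
    by (rule is_square_root[OF positive_self_adjoint[OF b] is_square_norm_bound[OF b' order_refl]]) blast
  have "h * k = k * h"
    by (rule k(3)) (simp add: right_diff_distrib left_diff_distrib mult.assoc flip: h(2))
  then have "norm h ^ 2 \<le> \<bar>r\<bar>"
    by (intro norm_le_of_commuting_squares[of h k]) (use h k(1,2) in auto)
  then show ?thesis using norm_square_selfadj[OF h(1)] h(2) r by simp
qed

lemma positive_norm_diff:
  fixes a :: "'a::{cstar_algebra,real_normed_algebra_1}"
  assumes "star a = a" "norm a \<le> r"
  shows "positive (r *\<^sub>R 1 - a)"
proof -
  have sa: "star (r *\<^sub>R 1 - a) = r *\<^sub>R 1 - a" and le: "norm (r *\<^sub>R 1 - (r *\<^sub>R 1 - a)) \<le> r"
    using assms by (simp_all add: star_diff star_scaleR)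
  obtain h where "star h = h" "h * h = r *\<^sub>R 1 - a"
    by (rule is_square_root[OF sa le]) blast
  then show ?thesis unfolding positive_iff_is_square is_square_def by metis
qed

section \<open>Unitization\<close>

text \<open>The maximum with the modulus of the scalar part makes the norm definite even if the algebra
  already has a unit.\<close>

datatype 'a unitization = Unz (upart: 'a) (uscal: complex)

text \<open>The unitization acts on the original algebra by left multiplication; the operator norm
  of this action is the first entry of the maximum in the norm below.\<close>

definition umul :: "'a::cstar_algebra unitization \<Rightarrow> 'a \<Rightarrow> 'a" where
  "umul x b = upart x * b + uscal x *\<^sub>C b"

lemma bounded_linear_umul: "bounded_linear (umul x)"
proof (rule bounded_linear_intro[of _ "norm (upart x) + cmod (uscal x)"])
  show "umul x (a + b) = umul x a + umul x b" for a b
    by (simp add: umul_def distrib_left scaleC_add_right)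
  show "umul x (r *\<^sub>R b) = r *\<^sub>R umul x b" for r b
    by (simp add: umul_def scaleR_scaleC mult_scaleC_right scaleC_scaleC scaleC_add_right mult.commute)
  show "norm (umul x b) \<le> norm b * (norm (upart x) + cmod (uscal x))" for b
    using norm_triangle_ineq[of "upart x * b" "uscal x *\<^sub>C b"] norm_mult_ineq[of "upart x" b]
    by (simp add: umul_def norm_scaleC algebra_simps)
qed

instantiation unitization :: (cstar_algebra) real_normed_algebra_1
begin

definition "0 = Unz 0 0"
definition "1 = Unz 0 1"
definition "x + y = Unz (upart x + upart y) (uscal x + uscal y)"
definition "x - y = Unz (upart x - upart y) (uscal x - uscal y)"
definition "- x = Unz (- upart x) (- uscal x)"
definition "x * y = Unz (upart x * upart y + uscal x *\<^sub>C upart y + uscal y *\<^sub>C upart x) (uscal x * uscal y)"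
definition "r *\<^sub>R x = Unz (r *\<^sub>R upart x) (r *\<^sub>R uscal x)"
definition "norm x = max (onorm (umul x)) (cmod (uscal x))"
definition "sgn x = Unz (inverse (norm x) *\<^sub>R upart x) (inverse (norm x) *\<^sub>R uscal x)"
definition "dist x y = norm (x - y :: 'a unitization)"
definition [code del]: "(uniformity :: ('a unitization \<times> 'a unitization) filter) =
  (INF e\<in>{0<..}. principal {(x, y). dist x y < e})"
definition [code del]: "open (U :: 'a unitization set) \<longleftrightarrow>
  (\<forall>x\<in>U. eventually (\<lambda>(x', y). x' = x \<longrightarrow> y \<in> U) uniformity)"

lemmas unitization_defs = zero_unitization_def one_unitization_def plus_unitization_def
  minus_unitization_def uminus_unitization_def times_unitization_def scaleR_unitization_def

lemma unitization_sel [simp]: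
  "upart 0 = 0" "uscal 0 = 0" "upart 1 = 0" "uscal 1 = 1"
  "upart (x + y) = upart x + upart y" "uscal (x + y) = uscal x + uscal y"
  "upart (x - y) = upart x - upart y" "uscal (x - y) = uscal x - uscal y"
  "upart (- x) = - upart x" "uscal (- x) = - uscal x"
  "upart (x * y) = upart x * upart y + uscal x *\<^sub>C upart y + uscal y *\<^sub>C upart x"
  "uscal (x * y) = uscal x * uscal y"
  "upart (r *\<^sub>R x) = r *\<^sub>R upart x" "uscal (r *\<^sub>R x) = r *\<^sub>R uscal x"
  by (simp_all add: unitization_defs)

lemma umul_mult: "umul (x * y) b = umul x (umul y b)"
  by (simp add: umul_def algebra_simps scaleC_add_left scaleC_add_right scaleC_scaleC
      mult_scaleC_left mult_scaleC_right mult.commute)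

lemma umul_add: "umul (x + y) b = umul x b + umul y b"
  by (simp add: umul_def algebra_simps scaleC_add_left)

lemma umul_scaleR: "umul (r *\<^sub>R x) b = r *\<^sub>R umul x b"
  by (simp add: umul_def scaleR_scaleC mult_scaleC_left scaleC_scaleC scaleC_add_right scaleR_conv_of_real)

instance
proof
  fix x y z :: "'a unitization" and r s :: real
  show "x + y + z = x + (y + z)" "x + y = y + x" "0 + x = x" "- x + x = 0" "x - y = x + - y"
    by (simp_all add: unitization.expand)
  show "x * y * z = x * (y * z)"
    by (rule unitization.expand)
      (simp add: algebra_simps scaleC_add_right scaleC_scaleC mult_scaleC_left mult_scaleC_right)
  show "1 * x = x" "x * 1 = x"
    by (simp_all add: unitization.expand)
  show "(x + y) * z = x * z + y * z" "x * (y + z) = x * y + x * z"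
    by (simp_all add: unitization.expand algebra_simps scaleC_add_left scaleC_add_right)
  show "(0::'a unitization) \<noteq> 1"
    by (metis unitization_sel(2,4) zero_neq_one)
  show "r *\<^sub>R (x + y) = r *\<^sub>R x + r *\<^sub>R y" "(r + s) *\<^sub>R x = r *\<^sub>R x + s *\<^sub>R x"
    "r *\<^sub>R s *\<^sub>R x = (r * s) *\<^sub>R x" "1 *\<^sub>R x = x"
    by (simp_all add: unitization.expand scaleR_add_right scaleR_add_left)
  show "(r *\<^sub>R x) * y = r *\<^sub>R (x * y)" "x * (r *\<^sub>R y) = r *\<^sub>R (x * y)"
    by (simp_all add: unitization.expand scaleR_scaleC scaleC_add_right scaleC_scaleC
        mult_scaleC_left mult_scaleC_right scaleR_conv_of_real mult_ac)
  show "dist x y = norm (x - y)" by (rule dist_unitization_def)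
  show "sgn x = scaleR (inverse (norm x)) x" by (simp add: sgn_unitization_def scaleR_unitization_def)
  show "uniformity = (INF e\<in>{0<..}. principal {(x, y). dist x y < (e::real)} :: ('a unitization \<times> 'a unitization) filter)"
    by (rule uniformity_unitization_def)
  show "open U \<longleftrightarrow> (\<forall>x\<in>U. eventually (\<lambda>(x', y). x' = x \<longrightarrow> y \<in> U) uniformity)" for U :: "'a unitization set"
    by (rule open_unitization_def)
  show "norm x = 0 \<longleftrightarrow> x = 0"
  proof
    assume "norm x = 0"
    then have "cmod (uscal x) \<le> 0" "onorm (umul x) \<le> 0"
      unfolding norm_unitization_def by (metis max.cobounded2, metis max.cobounded1)
    then have 0: "uscal x = 0" "onorm (umul x) = 0"
      using onorm_pos_le[OF bounded_linear_umul, of x] by auto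
    \<comment> \<open>Testing the action on the adjoint of the algebra part turns its vanishing into
      \<open>a * star a = 0\<close>. The same test vector yields the two lower norm estimates that
      follow.\<close>
    then have "umul x (star (upart x)) = 0"
      using onorm_eq_0[OF bounded_linear_umul] by blast
    then have "upart x * star (upart x) = 0"
      using 0 by (simp add: umul_def)
    then show "x = 0"
      using 0 norm_mult_star[of "upart x"] by (simp add: unitization.expand)
  next
    assume "x = 0"
    then have "umul x = (\<lambda>_. 0)" "uscal x = 0" by (auto simp: umul_def fun_eq_iff)
    then show "norm x = 0" by (simp add: norm_unitization_def onorm_zero)
  qed
  show "norm (x + y) \<le> norm x + norm y"
  proof -
    have "onorm (umul (x + y)) \<le> onorm (umul x) + onorm (umul y)"
      using onorm_triangle[OF bounded_linear_umul bounded_linear_umul, of x y]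
      by (simp add: umul_add[abs_def])
    then show ?thesis
      using norm_triangle_ineq[of "uscal x" "uscal y"] by (auto simp: norm_unitization_def)
  qed
  show "norm (r *\<^sub>R x) = \<bar>r\<bar> * norm x"
    using onorm_scaleR[OF bounded_linear_umul, of r x]
    by (simp add: norm_unitization_def umul_scaleR[abs_def] max_mult_distrib_left)
  show "norm (x * y) \<le> norm x * norm y"
  proof -
    have "onorm (umul (x * y)) \<le> onorm (umul x) * onorm (umul y)"
      using onorm_compose[OF bounded_linear_umul bounded_linear_umul, of x y]
      by (simp add: umul_mult[abs_def] comp_def)
    also have "\<dots> \<le> norm x * norm y"
      unfolding norm_unitization_def
      by (intro mult_mono) (auto simp: onorm_pos_le bounded_linear_umul le_max_iff_disj)
    finally have "onorm (umul (x * y)) \<le> norm x * norm y" .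
    moreover have "cmod (uscal (x * y)) \<le> norm x * norm y"
      unfolding norm_unitization_def
      by (simp add: norm_mult) (intro mult_mono, auto simp: le_max_iff_disj)
    ultimately show ?thesis by (simp add: norm_unitization_def[of "x * y"])
  qed
  have "umul 1 = (\<lambda>b::'a. b)" by (simp add: umul_def fun_eq_iff)
  then show "norm (1::'a unitization) = 1"
    using onorm_id_le[where 'a='a] by (simp add: norm_unitization_def max_def)
qed

end

lemma norm_uscal_le: "cmod (uscal x) \<le> norm x"
  by (simp add: norm_unitization_def)

lemma norm_umul_le: "norm (umul x b) \<le> norm x * norm b"
proof -
  have "onorm (umul x) * norm b \<le> norm x * norm b"
    by (intro mult_right_mono) (simp_all add: norm_unitization_def)
  then show ?thesis using onorm[OF bounded_linear_umul, of x b] by linarith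
qed

lemma norm_Unz_0 [simp]: "norm (Unz a 0) = norm (a::'a::cstar_algebra)"
proof (rule antisym)
  show "norm (Unz a 0) \<le> norm a"
    by (simp add: norm_unitization_def umul_def norm_mult_ineq onorm_bound)
  have "norm a * norm a \<le> norm (Unz a 0) * norm a"
    using norm_umul_le[of "Unz a 0" "star a"] norm_mult_star[of a]
    by (simp add: umul_def power2_eq_square)
  then show "norm a \<le> norm (Unz a 0)"
    by (cases "norm a = 0") auto
qed

lemma Unz_0_simps:
  "Unz (a + b) 0 = Unz a 0 + Unz b 0" "Unz (a - b) 0 = Unz a 0 - Unz b 0"
  "Unz (a * b) 0 = Unz a 0 * Unz b 0" "Unz (r *\<^sub>R a) 0 = r *\<^sub>R Unz a 0" "Unz (- a) 0 = - Unz a 0"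
  by (simp_all add: unitization_defs)

instance unitization :: (cstar_algebra) banach
proof
  fix X :: "nat \<Rightarrow> 'a unitization"
  assume X: "Cauchy X"
  have "Cauchy (\<lambda>n. uscal (X n))"
    unfolding Cauchy_def
  proof (intro allI impI)
    fix e :: real assume "e > 0"
    then obtain M where "\<And>m n. m \<ge> M \<Longrightarrow> n \<ge> M \<Longrightarrow> dist (X m) (X n) < e"
      using X unfolding Cauchy_def by blast
    moreover have "dist (uscal (X m)) (uscal (X n)) \<le> dist (X m) (X n)" for m n
      using norm_uscal_le[of "X m - X n"] by (simp add: dist_norm)
    ultimately show "\<exists>M. \<forall>m\<ge>M. \<forall>n\<ge>M. dist (uscal (X m)) (uscal (X n)) < e"
      by (meson order_le_less_trans)
  qed
  then obtain z where z: "(\<lambda>n. uscal (X n)) \<longlonglongrightarrow> z"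
    by (auto simp: Cauchy_convergent_iff convergent_def)
  \<comment> \<open>Continuity of the algebra part is what lets a Cauchy sequence be split into its
    two components.\<close>
  have nu: "norm (upart x) \<le> 2 * norm x" for x :: "'a unitization"
  proof -
    have "norm (upart x) * norm (upart x) \<le> norm (umul x (star (upart x))) + cmod (uscal x) * norm (upart x)"
      using norm_triangle_ineq4[of "umul x (star (upart x))" "uscal x *\<^sub>C star (upart x)"] norm_mult_star[of "upart x"]
      by (simp add: umul_def norm_scaleC power2_eq_square)
    also have "\<dots> \<le> norm x * norm (upart x) + norm x * norm (upart x)"
      using norm_umul_le[of x "star (upart x)"] by (intro add_mono mult_right_mono norm_uscal_le) auto
    also have "\<dots> = (2 * norm x) * norm (upart x)" by simp
    finally show ?thesis
      by (cases "norm (upart x) = 0") (simp, metis mult_right_le_imp_le norm_ge_zero order_le_less)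
  qed
  have "Cauchy (\<lambda>n. upart (X n))"
    unfolding Cauchy_def
  proof (intro allI impI)
    fix e :: real assume "e > 0"
    then obtain M where "\<And>m n. m \<ge> M \<Longrightarrow> n \<ge> M \<Longrightarrow> dist (X m) (X n) < e / 2"
      using X unfolding Cauchy_def by (meson half_gt_zero)
    moreover have "dist (upart (X m)) (upart (X n)) \<le> 2 * dist (X m) (X n)" for m n
      using nu[of "X m - X n"] by (simp add: dist_norm)
    ultimately show "\<exists>M. \<forall>m\<ge>M. \<forall>n\<ge>M. dist (upart (X m)) (upart (X n)) < e"
      by (intro exI[of _ M]) (smt (verit) field_sum_of_halves)
  qed
  then obtain a where a: "(\<lambda>n. upart (X n)) \<longlonglongrightarrow> a"
    by (auto simp: Cauchy_convergent_iff convergent_def)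
  have nb: "norm x \<le> norm (upart x) + cmod (uscal x)" for x :: "'a unitization"
  proof -
    have "norm (umul x b) \<le> (norm (upart x) + cmod (uscal x)) * norm b" for b
      using norm_triangle_ineq[of "upart x * b" "uscal x *\<^sub>C b"] norm_mult_ineq[of "upart x" b]
      by (simp add: umul_def norm_scaleC algebra_simps)
    then show ?thesis
      by (simp add: norm_unitization_def onorm_bound)
  qed
  have "(\<lambda>n. norm (upart (X n) - a) + cmod (uscal (X n) - z)) \<longlonglongrightarrow> 0 + 0"
    using a z by (intro tendsto_add) (simp_all add: LIM_zero_iff tendsto_norm_zero_iff)
  then have "(\<lambda>n. norm (upart (X n) - a) + cmod (uscal (X n) - z)) \<longlonglongrightarrow> 0"
    by simp
  moreover have "norm (X n - Unz a z) \<le> norm (upart (X n) - a) + cmod (uscal (X n) - z)" for n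
    using nb[of "X n - Unz a z"] by simp
  ultimately have "(\<lambda>n. X n - Unz a z) \<longlonglongrightarrow> 0"
    by (rule Lim_null_comparison[OF always_eventually[OF allI], rotated])
  then show "convergent X"
    unfolding convergent_def by (blast dest: LIM_zero_cancel)
qed

instantiation unitization :: (cstar_algebra) cstar_algebra
begin

definition "c *\<^sub>C x = Unz (c *\<^sub>C upart x) (c * uscal x)"
definition "star x = Unz (star (upart x)) (cnj (uscal x))"

lemma unitization_sel2 [simp]:
  "upart (c *\<^sub>C x) = c *\<^sub>C upart x" "uscal (c *\<^sub>C x) = c * uscal x"
  "upart (star x) = star (upart x)" "uscal (star x) = cnj (uscal x)"
  by (simp_all add: scaleC_unitization_def star_unitization_def)

lemma umul_scaleC: "umul (c *\<^sub>C x) b = c *\<^sub>C umul x b"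
  by (simp add: umul_def mult_scaleC_left scaleC_scaleC scaleC_add_right)

text \<open>The operator part follows from
  \<open>norm (x b) ^ 2 = norm (star b * (star x * x) b)\<close>. This half of the C*-identity
  already forces the involution to be isometric, which gives the other half.\<close>

lemma norm_square_le_unitization: "(norm x)\<^sup>2 \<le> norm (star x * x :: 'a unitization)"
proof -
  have "norm (umul x b) \<le> sqrt (norm (star x * x)) * norm b" for b
  proof -
    have "(norm (umul x b))\<^sup>2 = norm (star b * umul (star x * x) b)"
      unfolding cstar_identity[symmetric]
      by (simp add: umul_def algebra_simps star_add star_mult star_scaleC
          mult_scaleC_left mult_scaleC_right scaleC_add_right scaleC_add_left scaleC_scaleC)
    also have "\<dots> \<le> norm b * (norm (star x * x) * norm b)"
      by (intro order_trans[OF norm_mult_ineq] mult_mono) (simp_all add: norm_umul_le)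
    also have "\<dots> = (sqrt (norm (star x * x)) * norm b)\<^sup>2"
      by (simp add: power_mult_distrib power2_eq_square)
    finally show ?thesis by (rule power2_le_imp_le) simp
  qed
  then have "onorm (umul x) \<le> sqrt (norm (star x * x))"
    by (intro onorm_bound) auto
  moreover have "cmod (uscal x) \<le> sqrt (norm (star x * x))"
    using norm_uscal_le[of "star x * x"]
    by (intro real_le_rsqrt) (simp add: norm_mult power2_eq_square)
  ultimately have "norm x \<le> sqrt (norm (star x * x))"
    by (simp add: norm_unitization_def[of x])
  then show ?thesis
    by (metis norm_ge_zero power_mono real_sqrt_pow2)
qed

instance
proof
  fix x y :: "'a unitization" and c d :: complex and r :: real
  show "c *\<^sub>C (x + y) = c *\<^sub>C x + c *\<^sub>C y" "(c + d) *\<^sub>C x = c *\<^sub>C x + d *\<^sub>C x"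
    "c *\<^sub>C (d *\<^sub>C x) = (c * d) *\<^sub>C x" "r *\<^sub>R x = complex_of_real r *\<^sub>C x"
    by (simp_all add: unitization.expand algebra_simps scaleC_add_left scaleC_add_right
        scaleC_scaleC scaleR_scaleC[where 'a='a] scaleR_conv_of_real[where 'a=complex])
  show "(c *\<^sub>C x) * y = c *\<^sub>C (x * y)" "x * (c *\<^sub>C y) = c *\<^sub>C (x * y)"
    by (simp_all add: unitization.expand scaleC_add_right scaleC_scaleC
        mult_scaleC_left mult_scaleC_right mult_ac)
  show "star (x + y) = star x + star y" "star (c *\<^sub>C x) = cnj c *\<^sub>C star x"
    "star (x * y) = star y * star x" and star_star': "star (star x) = x" for x y :: "'a unitization"
    by (simp_all add: unitization.expand star_add star_scaleC star_mult star_star add_ac)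
  have le: "norm (c *\<^sub>C x) \<le> cmod c * norm x" for c and x :: "'a unitization"
  proof -
    have "norm (umul (c *\<^sub>C x) b) \<le> cmod c * norm x * norm b" for b
      unfolding umul_scaleC norm_scaleC
      using mult_left_mono[OF norm_umul_le[of x b], of "cmod c"] by (simp add: mult.assoc)
    moreover have "cmod (uscal (c *\<^sub>C x)) \<le> cmod c * norm x"
      by (simp add: norm_mult mult_left_mono norm_uscal_le)
    ultimately show ?thesis
      by (simp add: norm_unitization_def[of "c *\<^sub>C x"] onorm_bound)
  qed
  show "norm (c *\<^sub>C x) = cmod c * norm x"
  proof (cases "c = 0")
    case True
    then show ?thesis using le[of c x] by simp
  next
    case False
    have "x = inverse c *\<^sub>C (c *\<^sub>C x)"
      using False by (simp add: unitization.expand scaleC_scaleC)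
    then have "norm x \<le> cmod (inverse c) * norm (c *\<^sub>C x)"
      by (metis le)
    then show ?thesis
      using le[of c x] False by (intro antisym) (simp_all add: norm_inverse norm_divide field_simps)
  qed
  have "norm x \<le> norm (star x)" for x :: "'a unitization"
  proof (cases "norm x = 0")
    case False
    have "norm x * norm x \<le> norm (star x) * norm x"
      using norm_square_le_unitization[of x] norm_mult_ineq[of "star x" x] by (simp add: power2_eq_square)
    then show ?thesis using False by auto
  qed simp
  then have "norm (star x) = norm x" for x :: "'a unitization"
    by (metis star_star' antisym)
  then show "norm (star x * x) = (norm x)\<^sup>2"
    using norm_square_le_unitization[of x] norm_mult_ineq[of "star x" x]
    by (simp add: power2_eq_square)
qed

end

section \<open>Positive elements of a C*-algebra\<close>

text \<open>Positivity is tested in the unitization because the square roots are built around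
  \<open>1\<close>. Inner squares qualify by \<open>positive_imp_cpos\<close>.\<close>

definition cpos :: "'a::cstar_algebra \<Rightarrow> bool" where
  "cpos a \<longleftrightarrow> positive (Unz a 0)"

lemma star_Unz_0: "star (Unz a 0) = Unz (star a) 0"
  by (simp add: star_unitization_def)

lemma cpos_self_adjoint: "cpos a \<Longrightarrow> star a = a"
  using positive_self_adjoint[of "Unz a 0"] by (simp add: cpos_def star_Unz_0)

lemma positive_imp_cpos: "positive a \<Longrightarrow> cpos a"
  unfolding positive_def cpos_def by (metis star_Unz_0 Unz_0_simps(3))

lemma cpos_zero [simp]: "cpos 0"
  by (rule positive_imp_cpos) (auto simp: positive_def intro: exI[of _ 0])

lemma cpos_star_mult: "cpos (star a * a)"
  by (rule positive_imp_cpos) (auto simp: positive_def)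

lemma cpos_add: "cpos a \<Longrightarrow> cpos b \<Longrightarrow> cpos (a + b)"
  by (simp add: cpos_def Unz_0_simps positive_iff_is_square is_square_add)

lemma cpos_sum: "(\<And>i. i \<in> I \<Longrightarrow> cpos (f i)) \<Longrightarrow> cpos (\<Sum>i\<in>I. f i)"
  by (induction I rule: infinite_finite_induct) (auto intro: cpos_add)

lemma cpos_scaleR: "r \<ge> 0 \<Longrightarrow> cpos a \<Longrightarrow> cpos (r *\<^sub>R a)"
  by (simp add: cpos_def Unz_0_simps positive_iff_is_square is_square_scaleR)

text \<open>In the unitization, \<open>b\<close> lies below \<open>norm b *\<^sub>R 1\<close>, hence
  so does \<open>a\<close>.\<close>

lemma norm_mono_cpos:
  assumes "cpos a" "cpos (b - a)"
  shows "norm a \<le> norm b"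
proof -
  have "star (Unz b 0) = Unz b 0"
    using cpos_self_adjoint[OF cpos_add[OF assms]] by (simp add: star_Unz_0)
  then have "positive (norm b *\<^sub>R 1 - Unz b 0)"
    by (intro positive_norm_diff) simp_all
  moreover have "positive (Unz b 0 - Unz a 0)"
    using assms(2) by (simp add: cpos_def Unz_0_simps)
  ultimately have "positive ((norm b *\<^sub>R 1 - Unz b 0) + (Unz b 0 - Unz a 0))"
    unfolding positive_iff_is_square by (rule is_square_add)
  then have "norm (Unz a 0) \<le> norm b"
    using assms(1) by (intro norm_le_of_positive_diff) (simp_all add: cpos_def)
  then show ?thesis by simp
qed

lemma cpos_norm_conj_diff:
  assumes "star a = a" "norm a \<le> r"
  shows "cpos (r *\<^sub>R (star b * b) - star b * a * b)"
proof -
  have "positive (star (Unz b 0) * (r *\<^sub>R 1 - Unz a 0) * Unz b 0)"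
    using assms by (intro positive_conj positive_norm_diff) (simp_all add: star_Unz_0)
  also have "star (Unz b 0) * (r *\<^sub>R 1 - Unz a 0) * Unz b 0 = Unz (r *\<^sub>R (star b * b) - star b * a * b) 0"
    by (simp add: star_Unz_0 Unz_0_simps algebra_simps)
  finally show ?thesis by (simp add: cpos_def)
qed

section \<open>Right Hilbert modules\<close>

text \<open>A relation instead of an adjoint operation: the adjoint is supplied explicitly each
  time, and linearity of the maps follows from the existence of the partner by nondegeneracy of the
  inner product.\<close>

definition is_adjoint :: "('a, 'b, 'x) bimodule \<Rightarrow> ('x \<Rightarrow> 'x) \<Rightarrow> ('x \<Rightarrow> 'x) \<Rightarrow> bool" where
  "is_adjoint X T S \<longleftrightarrow> (\<forall>x y. rip X (T x) y = rip X x (S y))"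

definition op_bound :: "('a, 'b::cstar_algebra, 'x) bimodule \<Rightarrow> real \<Rightarrow> ('x \<Rightarrow> 'x) \<Rightarrow> bool" where
  "op_bound X M T \<longleftrightarrow> (\<forall>x. rnorm X (T x) \<le> M * rnorm X x)"

definition op_positive :: "('a, 'b::cstar_algebra, 'x) bimodule \<Rightarrow> ('x \<Rightarrow> 'x) \<Rightarrow> bool" where
  "op_positive X T \<longleftrightarrow> is_adjoint X T T \<and> (\<forall>x. cpos (rip X x (T x)))"

text \<open>The list of pairs is kept as data because \<open>lip_sum\<close> below is computed from
  the list. That it depends on the operator alone comes out of \<open>lip_sum_bound\<close>.\<close>

definition finite_rank :: "('a, 'b, 'x::ab_group_add) bimodule \<Rightarrow> ('x \<times> 'x) list \<Rightarrow> 'x \<Rightarrow> 'x" where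
  "finite_rank X ps = (\<lambda>z. \<Sum>(x, y)\<leftarrow>ps. theta_r X x y z)"

definition diag :: "'x list \<Rightarrow> ('x \<times> 'x) list" where
  "diag xs = map (\<lambda>x. (x, x)) xs"

primrec quadratic_iterate :: "('x::ab_group_add \<Rightarrow> 'x) \<Rightarrow> ('x \<Rightarrow> 'x) \<Rightarrow> nat \<Rightarrow> 'x \<Rightarrow> 'x" where
  "quadratic_iterate h r 0 = r"
| "quadratic_iterate h r (Suc n) = (\<lambda>x. quadratic_iterate h r n x - quadratic_iterate h r n (h (quadratic_iterate h r n x)))"

locale right_hilbert =
  fixes X :: "('a, 'b::cstar_algebra, 'x::ab_group_add) bimodule"
  assumes rhm: "right_hilbert_module X"
begin

abbreviation "ip \<equiv> rip X"
abbreviation "nr \<equiv> rnorm X"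
abbreviation "rs r x \<equiv> scale X (complex_of_real r) x"

lemma vec: "complex_vector X"
  using rhm by (simp add: right_hilbert_module_def right_module_def)

lemma scale_simps:
  "scale X c (x + y) = scale X c x + scale X c y"
  "scale X (c + d) x = scale X c x + scale X d x"
  "scale X c (scale X d x) = scale X (c * d) x"
  "scale X 1 x = x"
  using vec by (simp_all add: complex_vector_def)

lemma ract_simps:
  "ract X (x + y) b = ract X x b + ract X y b"
  "ract X x (b + b') = ract X x b + ract X x b'"
  "ract X x (b * b') = ract X (ract X x b) b'"
  "ract X x (c *\<^sub>C b) = scale X c (ract X x b)"
  "ract X (scale X c x) b = scale X c (ract X x b)"
  using rhm by (simp_all add: right_hilbert_module_def right_module_def)

lemma ip_star: "star (ip x y) = ip y x"
  using rhm by (simp add: right_hilbert_module_def)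

lemma cpos_ip: "cpos (ip x x)"
  using rhm by (simp add: right_hilbert_module_def positive_imp_cpos)

lemma ip_eq_0: "ip x x = 0 \<Longrightarrow> x = 0"
  using rhm by (simp add: right_hilbert_module_def)

lemma ip_simps:
  "ip x (y + z) = ip x y + ip x z"
  "ip x (scale X c y) = c *\<^sub>C ip x y"
  "ip x (ract X y b) = ip x y * b"
  "ip (x + y) z = ip x z + ip y z"
  "ip (scale X c x) y = cnj c *\<^sub>C ip x y"
  "ip (ract X x b) y = star b * ip x y"
proof -
  show r: "ip x (y + z) = ip x y + ip x z" "ip x (scale X c y) = c *\<^sub>C ip x y"
    "ip x (ract X y b) = ip x y * b" for x y z c b
    using rhm by (simp_all add: right_hilbert_module_def)
  show "ip (x + y) z = ip x z + ip y z" "ip (scale X c x) y = cnj c *\<^sub>C ip x y"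
    "ip (ract X x b) y = star b * ip x y"
    by (subst ip_star[symmetric], simp add: r star_add star_scaleC star_mult ip_star)+
qed

lemma ip_zero [simp]: "ip 0 y = 0" "ip x 0 = 0"
  using ip_simps(1)[of x 0 0] ip_simps(4)[of 0 0 y] by simp_all

lemma ip_minus [simp]: "ip (- x) y = - ip x y" "ip x (- y) = - ip x y"
  using ip_simps(1)[of x y "- y"] ip_simps(4)[of x "- x" y] by (simp_all add: add_eq_0_iff)

lemma ip_diff: "ip (x - y) z = ip x z - ip y z" "ip x (y - z) = ip x y - ip x z"
  using ip_simps(4)[of x "- y" z] ip_simps(1)[of x y "- z"] by simp_all

lemma ip_sum: "ip (\<Sum>i\<in>I. f i) y = (\<Sum>i\<in>I. ip (f i) y)" "ip x (\<Sum>i\<in>I. f i) = (\<Sum>i\<in>I. ip x (f i))"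
  by (induction I rule: infinite_finite_induct; simp add: ip_simps)+

lemma ip_sum_list: "ip (\<Sum>i\<leftarrow>xs. f i) y = (\<Sum>i\<leftarrow>xs. ip (f i) y)" "ip x (\<Sum>i\<leftarrow>xs. f i) = (\<Sum>i\<leftarrow>xs. ip x (f i))"
  by (induction xs; simp add: ip_simps)+

lemma eq_by_ip: "(\<And>z. ip z x = ip z y) \<Longrightarrow> x = y"
  using ip_eq_0[of "x - y"] by (simp add: ip_diff)

lemma ract_zero [simp]: "ract X 0 b = 0" "ract X x 0 = 0"
  using ract_simps(1)[of 0 0 b] ract_simps(2)[of x 0 0] by simp_all

lemma ract_diff: "ract X (x - y) b = ract X x b - ract X y b"
  using ract_simps(1)[of "x - y" y b] by (simp add: algebra_simps)

text \<open>Expand the sum of the inner squares of \<open>x\<^sub>i c - y\<^sub>i\<close> with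
  \<open>c = b / N\<close>, \<open>b\<close> being the mixed sum. The bound \<open>N\<close> need
  not equal the norm of the sum of squares, so that one can always divide by it.\<close>

lemma cauchy_schwarz_cpos:
  fixes I :: "'i set"
  assumes N: "N > 0" "norm (\<Sum>i\<in>I. ip (x i) (x i)) \<le> N"
  shows "cpos ((\<Sum>i\<in>I. ip (y i) (y i))
    - (1 / N) *\<^sub>R (star (\<Sum>i\<in>I. ip (x i) (y i)) * (\<Sum>i\<in>I. ip (x i) (y i))))"
proof -
  define b where "b = (\<Sum>i\<in>I. ip (x i) (y i))"
  define c where "c = (1 / N) *\<^sub>R b"
  define P where "P = (\<Sum>i\<in>I. ip (x i) (x i))"
  define Q where "Q = (\<Sum>i\<in>I. ip (y i) (y i))"
  have sb: "star b = (\<Sum>i\<in>I. ip (y i) (x i))"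
    by (simp add: b_def star_sum ip_star)
  have "cpos (\<Sum>i\<in>I. ip (ract X (x i) c - y i) (ract X (x i) c - y i))"
    by (intro cpos_sum cpos_ip)
  also have "(\<Sum>i\<in>I. ip (ract X (x i) c - y i) (ract X (x i) c - y i))
      = star c * P * c - star c * b - star b * c + Q"
    unfolding sb
    by (simp add: P_def Q_def b_def ip_diff ip_simps sum.distrib sum_subtractf sum_distrib_left
        sum_distrib_right algebra_simps)
  finally have 1: "cpos (star c * P * c - star c * b - star b * c + Q)" .
  have "star P = P" by (simp add: P_def star_sum ip_star)
  then have 2: "cpos (N *\<^sub>R (star c * c) - star c * P * c)"
    using N by (intro cpos_norm_conj_diff) (simp_all add: P_def)
  have 3: "N *\<^sub>R (star c * c) - star c * b - star b * c + Q = Q - (1 / N) *\<^sub>R (star b * b)"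
    using N by (simp add: c_def star_scaleR)
  have "cpos (N *\<^sub>R (star c * c) - star c * b - star b * c + Q)"
    using cpos_add[OF 1 2] by (simp add: algebra_simps)
  then show ?thesis
    unfolding 3 by (simp add: b_def Q_def)
qed

text \<open>Cauchy-Schwarz in the direct sum of copies of the module: the norms stand outside the
  sums, which is much stronger than summing the individual estimates. The constant \<open>N\<close>
  decreases to the norm of the first sum.\<close>

lemma cauchy_schwarz_family:
  "(norm (\<Sum>i\<in>I. ip (x i) (y i)))\<^sup>2 \<le> norm (\<Sum>i\<in>I. ip (x i) (x i)) * norm (\<Sum>i\<in>I. ip (y i) (y i))"
proof -
  define b where "b = (\<Sum>i\<in>I. ip (x i) (y i))"
  define P where "P = norm (\<Sum>i\<in>I. ip (x i) (x i))"
  define Q where "Q = norm (\<Sum>i\<in>I. ip (y i) (y i))"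
  have le: "(norm b)\<^sup>2 \<le> N * Q" if "N > P" for N
  proof -
    have N: "N > 0" using that norm_ge_zero[of "\<Sum>i\<in>I. ip (x i) (x i)"] unfolding P_def by linarith
    have "norm ((1 / N) *\<^sub>R (star b * b)) \<le> Q"
      unfolding Q_def b_def using N that
      by (intro norm_mono_cpos cauchy_schwarz_cpos cpos_scaleR cpos_star_mult) (auto simp: P_def)
    then show ?thesis using N by (simp add: cstar_identity divide_le_eq mult.commute)
  qed
  show ?thesis
  proof (cases "Q = 0")
    case True
    then show ?thesis using le[of "P + 1"] by (simp add: b_def Q_def)
  next
    case False
    then have Q: "Q > 0" by (simp add: Q_def)
    have "(norm b)\<^sup>2 / Q \<le> P"
      by (rule dense_ge) (use le Q in \<open>simp add: divide_le_eq\<close>)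
    then show ?thesis using Q by (simp add: divide_le_eq b_def Q_def P_def)
  qed
qed

lemma nr_square: "(nr x)\<^sup>2 = norm (ip x x)"
  by (simp add: rnorm_def)

lemma nr_ge_0 [simp]: "nr x \<ge> 0"
  by (simp add: rnorm_def)

lemma nr_eq_0 [simp]: "nr x = 0 \<longleftrightarrow> x = 0"
  by (auto simp: rnorm_def ip_eq_0)

lemma nr_0 [simp]: "nr 0 = 0"
  by simp

lemma norm_ip_le: "norm (ip x y) \<le> nr x * nr y"
proof (rule power2_le_imp_le)
  show "(norm (ip x y))\<^sup>2 \<le> (nr x * nr y)\<^sup>2"
    using cauchy_schwarz_family[of "\<lambda>_. x" "\<lambda>_. y" "{()}"]
    by (simp add: power_mult_distrib nr_square)
qed simp

lemma nr_triangle: "nr (x + y) \<le> nr x + nr y"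
proof (rule power2_le_imp_le)
  have "ip (x + y) (x + y) = (ip x x + ip x y) + (ip y x + ip y y)"
    by (simp add: ip_simps algebra_simps)
  then have "norm (ip (x + y) (x + y)) \<le> norm (ip x x) + norm (ip x y) + (norm (ip y x) + norm (ip y y))"
    by (metis norm_triangle_ineq norm_triangle_mono)
  also have "\<dots> \<le> (nr x)\<^sup>2 + nr x * nr y + (nr y * nr x + (nr y)\<^sup>2)"
    unfolding nr_square by (intro add_mono order_refl norm_ip_le)
  finally show "(nr (x + y))\<^sup>2 \<le> (nr x + nr y)\<^sup>2"
    unfolding nr_square[of "x + y"] by (simp add: power2_eq_square algebra_simps)
qed simp

lemma nr_minus [simp]: "nr (- x) = nr x"
  by (simp add: rnorm_def)

lemma nr_triangle_diff: "nr (x - y) \<le> nr x + nr y"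
  using nr_triangle[of x "- y"] by simp

lemma nr_diff_commute: "nr (x - y) = nr (y - x)"
  using nr_minus[of "x - y"] by simp

lemma nr_scale: "nr (scale X c x) = cmod c * nr x"
  by (simp add: rnorm_def ip_simps norm_scaleC real_sqrt_mult)

lemma nr_ract: "nr (ract X x b) \<le> nr x * norm b"
proof (rule power2_le_imp_le)
  have "(nr (ract X x b))\<^sup>2 = norm (star b * ip x x * b)"
    by (simp add: nr_square ip_simps mult.assoc)
  also have "\<dots> \<le> norm b * norm (ip x x) * norm b"
    by (intro order_trans[OF norm_mult_ineq] mult_right_mono) (use norm_mult_ineq[of "star b" "ip x x"] in auto)
  finally show "(nr (ract X x b))\<^sup>2 \<le> (nr x * norm b)\<^sup>2"
    by (simp add: power_mult_distrib nr_square power2_eq_square[of "norm b"] mult_ac)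
qed simp

text \<open>The type of vectors carries no topology of its own, so completeness and Baire category
  are used for this metric on \<open>UNIV\<close>.\<close>

sublocale M: Metric_space UNIV "\<lambda>x y. nr (x - y)"
proof
  show "nr (x - z) \<le> nr (x - y) + nr (y - z)" for x y z
    using nr_triangle[of "x - y" "y - z"] by simp
qed (auto simp: nr_diff_commute)

lemma complete: "M.mcomplete"
  using rhm by (simp add: right_hilbert_module_def)

lemma complete_sequence:
  assumes "\<And>e. e > 0 \<Longrightarrow> \<exists>N. \<forall>m\<ge>N. \<forall>n\<ge>N. nr (s m - s n) < e"
  obtains l where "(\<lambda>n. nr (s n - l)) \<longlonglongrightarrow> 0"
proof -
  have "M.MCauchy s"
    unfolding M.MCauchy_def using assms by auto
  then obtain l where "limitin M.mtopology s l sequentially"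
    using complete by (auto simp: M.mcomplete_def)
  then have "(\<lambda>n. nr (s n - l)) \<longlonglongrightarrow> 0"
    by (subst (asm) M.limitin_metric_dist_null) auto
  then show ?thesis by (rule that)
qed

subsection \<open>Adjointable maps\<close>

lemma is_adjointD: "is_adjoint X T S \<Longrightarrow> ip (T x) y = ip x (S y)"
  by (simp add: is_adjoint_def)

lemma is_adjoint_sym: "is_adjoint X T S \<Longrightarrow> is_adjoint X S T"
  unfolding is_adjoint_def by (metis ip_star)

lemma adjD': "is_adjoint X T S \<Longrightarrow> ip (S x) y = ip x (T y)"
  by (drule is_adjoint_sym) (rule is_adjointD)

lemma is_adjoint_linear:
  assumes "is_adjoint X T S"
  shows "T (x + y) = T x + T y" "T (x - y) = T x - T y" "T 0 = 0" "T (- x) = - T x"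
    "T (scale X c x) = scale X c (T x)" "T (ract X x b) = ract X (T x) b"
    "T (\<Sum>i\<in>I. f i) = (\<Sum>i\<in>I. T (f i))" "T (\<Sum>i\<leftarrow>xs. g i) = (\<Sum>i\<leftarrow>xs. T (g i))"
  by (rule eq_by_ip;
      simp add: adjD'[OF assms, symmetric] ip_simps ip_diff ip_sum ip_sum_list)+

lemma is_adjoint_id: "is_adjoint X (\<lambda>x. x) (\<lambda>x. x)"
  and is_adjoint_zero: "is_adjoint X (\<lambda>x. 0) (\<lambda>x. 0)"
  and is_adjoint_comp: "is_adjoint X T T' \<Longrightarrow> is_adjoint X S S' \<Longrightarrow> is_adjoint X (\<lambda>x. T (S x)) (\<lambda>x. S' (T' x))"
  and is_adjoint_add: "is_adjoint X T T' \<Longrightarrow> is_adjoint X S S' \<Longrightarrow> is_adjoint X (\<lambda>x. T x + S x) (\<lambda>x. T' x + S' x)"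
  and is_adjoint_diff: "is_adjoint X T T' \<Longrightarrow> is_adjoint X S S' \<Longrightarrow> is_adjoint X (\<lambda>x. T x - S x) (\<lambda>x. T' x - S' x)"
  and is_adjoint_scale: "is_adjoint X T T' \<Longrightarrow> is_adjoint X (\<lambda>x. scale X c (T x)) (\<lambda>x. scale X (cnj c) (T' x))"
  and is_adjoint_theta: "is_adjoint X (theta_r X u v) (theta_r X v u)"
  by (simp_all add: is_adjoint_def ip_simps ip_diff theta_r_def star_mult ip_star)

lemma is_adjoint_finite_rank: "is_adjoint X (finite_rank X ps) (finite_rank X (map prod.swap ps))"
  unfolding finite_rank_def
  by (induction ps) (auto intro!: is_adjoint_zero is_adjoint_add is_adjoint_theta)

lemma op_boundD: "op_bound X M T \<Longrightarrow> nr (T x) \<le> M * nr x"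
  by (simp add: op_bound_def)

lemma op_bound_is_adjoint:
  assumes "is_adjoint X T S" "op_bound X M T"
  shows "op_bound X M S"
  unfolding op_bound_def
proof
  fix y
  have "(nr (S y))\<^sup>2 = norm (ip (T (S y)) y)"
    by (simp add: nr_square is_adjointD[OF assms(1)])
  also have "\<dots> \<le> nr (T (S y)) * nr y" by (rule norm_ip_le)
  also have "\<dots> \<le> M * nr (S y) * nr y"
    by (intro mult_right_mono op_boundD assms) simp
  finally have *: "nr (S y) * nr (S y) \<le> (M * nr y) * nr (S y)"
    by (simp add: power2_eq_square mult_ac)
  show "nr (S y) \<le> M * nr y"
  proof (cases "S y = 0")
    case True
    \<comment> \<open>No sign is assumed for \<open>M\<close>; nonnegativity of the right side comes
      from the bound on \<open>T y\<close>.\<close>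
    have "0 \<le> nr (T y)" by simp
    also have "\<dots> \<le> M * nr y" by (rule op_boundD[OF assms(2)])
    finally show ?thesis using True by simp
  next
    case False
    then have "nr (S y) > 0" using nr_ge_0[of "S y"] nr_eq_0[of "S y"] by linarith
    then show ?thesis using * by (rule mult_right_le_imp_le[rotated])
  qed
qed

text \<open>Uniform boundedness: \<open>nr (T x)\<close> is a supremum of continuous functions of
  \<open>x\<close>, namely the norms of \<open>ip (S y) x\<close> over unit vectors
  \<open>y\<close>. So its sublevel sets are closed, and by Baire one of them contains a
  ball.\<close>

lemma is_adjoint_bounded:
  assumes T: "is_adjoint X T S"
  obtains M where "M > 0" "op_bound X M T"
proof -
  define F where "F n = {x. nr (T x) \<le> real n}" for n :: nat
  have closed: "closedin M.mtopology (F n)" for n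
    unfolding M.closedin_metric
  proof (intro conjI allI impI)
    fix x assume "x \<in> UNIV - F n"
    then have gt: "nr (T x) > real n" by (simp add: F_def)
    then have pos: "nr (T x) > 0" by (metis of_nat_0_le_iff order_le_less_trans)
    \<comment> \<open>The unit vector in direction \<open>T x\<close> attains the supremum at
      \<open>x\<close>; its function stays above \<open>real n\<close> near
      \<open>x\<close>.\<close>
    define y where "y = rs (1 / nr (T x)) (T x)"
    have eq: "norm (ip (S y) z) \<le> nr (T z)" for z
      using norm_ip_le[of y "T z"] pos
      by (auto simp: adjD'[OF T] y_def nr_scale norm_divide split: if_splits)
    have "ip (S y) x = complex_of_real (1 / nr (T x)) *\<^sub>C ip (T x) (T x)"
      by (simp add: adjD'[OF T] y_def ip_simps)
    then have eqx: "norm (ip (S y) x) = nr (T x)"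
      using pos by (simp add: norm_scaleC nr_square[symmetric] power2_eq_square norm_divide)
    define r where "r = (nr (T x) - real n) / (nr (S y) + 1)"
    have r: "r > 0" using gt nr_ge_0[of "S y"] by (simp add: r_def add_nonneg_pos)
    have "M.mball x r \<inter> F n = {}"
    proof (intro equals0I)
      fix z assume "z \<in> M.mball x r \<inter> F n"
      then have z: "nr (x - z) < r" "nr (T z) \<le> real n" by (auto simp: F_def)
      have "nr (T x) = norm (ip (S y) z + ip (S y) (x - z))"
        using eqx by (simp add: ip_diff)
      also have "\<dots> \<le> nr (T z) + nr (S y) * nr (x - z)"
        by (intro order_trans[OF norm_triangle_ineq] add_mono eq norm_ip_le)
      also have "\<dots> \<le> real n + nr (S y) * r"
        using z by (intro add_mono mult_left_mono) auto
      also have "\<dots> < real n + (nr (S y) + 1) * r"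
        using r by (simp add: algebra_simps)
      also have "\<dots> = nr (T x)"
        using nr_ge_0[of "S y"] by (simp add: r_def add_nonneg_pos less_imp_neq[symmetric])
      finally show False by simp
    qed
    then show "\<exists>r>0. disjnt (F n) (M.mball x r)"
      using r by (auto simp: disjnt_def)
  qed auto
  have "\<exists>n. M.mtopology interior_of (F n) \<noteq> {}"
  proof (rule ccontr)
    assume "\<not> ?thesis"
    then have "M.mtopology interior_of \<Union>(range F) = {}"
      using closed by (intro M.metric_Baire_category_alt complete) auto
    moreover have "\<Union>(range F) = topspace M.mtopology"
      using real_arch_simple by (auto simp: F_def)
    ultimately show False by (simp only: interior_of_topspace) simp
  qed
  then obtain n x0 where "x0 \<in> M.mtopology interior_of (F n)" by blast
  then obtain r where r: "r > 0" "M.mball x0 r \<subseteq> F n"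
    by (auto simp: M.metric_interior_of)
  have small: "nr (T z) \<le> 2 * real n" if "nr z < r" for z
  proof -
    have "x0 - z \<in> F n" "x0 \<in> F n" using r that by (auto simp: subset_iff)
    then have "nr (T x0 - T (x0 - z)) \<le> 2 * real n"
      using nr_triangle_diff[of "T x0" "T (x0 - z)"] by (simp add: F_def)
    then show ?thesis by (simp add: is_adjoint_linear[OF T])
  qed
  have "op_bound X (4 * real n / r + 1) T"
    unfolding op_bound_def
  proof
    fix x
    show "nr (T x) \<le> (4 * real n / r + 1) * nr x"
    proof (cases "x = 0")
      case False
      then have x: "nr x > 0" using nr_ge_0[of x] nr_eq_0[of x] by linarith
      have "nr (T (rs (r / (2 * nr x)) x)) \<le> 2 * real n"
        using x r by (intro small) (simp add: nr_scale norm_divide norm_mult)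
      then have "r / (2 * nr x) * nr (T x) \<le> 2 * real n"
        using x r by (simp add: is_adjoint_linear[OF T] nr_scale norm_divide norm_mult)
      then have "nr (T x) \<le> 4 * real n / r * nr x"
        using x r by (simp add: field_simps)
      also have "\<dots> \<le> (4 * real n / r + 1) * nr x"
        using x by (simp add: algebra_simps)
      finally show ?thesis .
    qed (simp add: is_adjoint_linear[OF T])
  qed
  moreover have "4 * real n / r + 1 > 0" using r by (simp add: add_nonneg_pos)
  ultimately show ?thesis using that by blast
qed

lemma op_bound_mono:
  assumes "op_bound X M T" "M \<le> M'"
  shows "op_bound X M' T"
  unfolding op_bound_def
proof
  fix x
  show "nr (T x) \<le> M' * nr x"
    using op_boundD[OF assms(1), of x] mult_right_mono[OF assms(2) nr_ge_0[of x]] by linarith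
qed

lemma op_bound_comp:
  assumes "op_bound X M S" "op_bound X N T" "M \<ge> 0"
  shows "op_bound X (M * N) (\<lambda>x. S (T x))"
  unfolding op_bound_def
proof
  fix x
  show "nr (S (T x)) \<le> M * N * nr x"
    using op_boundD[OF assms(1), of "T x"] mult_left_mono[OF op_boundD[OF assms(2), of x] assms(3)]
    by (simp add: mult.assoc)
qed

lemma op_bound_add:
  assumes "op_bound X M S" "op_bound X N T"
  shows "op_bound X (M + N) (\<lambda>x. S x + T x)"
  unfolding op_bound_def
proof
  fix x
  show "nr (S x + T x) \<le> (M + N) * nr x"
    using op_boundD[OF assms(1), of x] op_boundD[OF assms(2), of x] nr_triangle[of "S x" "T x"]
    by (simp add: distrib_right)
qed

lemma op_bound_diff:
  assumes "op_bound X M S" "op_bound X N T"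
  shows "op_bound X (M + N) (\<lambda>x. S x - T x)"
  unfolding op_bound_def
proof
  fix x
  show "nr (S x - T x) \<le> (M + N) * nr x"
    using op_boundD[OF assms(1), of x] op_boundD[OF assms(2), of x] nr_triangle_diff[of "S x" "T x"]
    by (simp add: distrib_right)
qed

text \<open>The squared norm of a row of operators is the norm of the sum of
  \<open>c\<^sub>i c\<^sub>i'\<close>. The estimate is used for the right actions on the left module
  and for rows of two operators in \<open>row_bound\<close>.\<close>

lemma row_column_cauchy_schwarz:
  assumes is_adjoint: "\<And>i. i \<in> I \<Longrightarrow> is_adjoint X (c i) (c' i)"
    and bd: "op_bound X M (\<lambda>x. \<Sum>i\<in>I. c i (c' i x))" and M: "M \<ge> 0"
  shows "(nr (\<Sum>i\<in>I. c i (y i)))\<^sup>2 \<le> M * norm (\<Sum>i\<in>I. ip (y i) (y i))"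
proof -
  define w where "w = (\<Sum>i\<in>I. c i (y i))"
  have "ip w w = (\<Sum>i\<in>I. ip w (c i (y i)))"
    by (subst (2) w_def) (simp add: ip_sum)
  also have "\<dots> = (\<Sum>i\<in>I. ip (c' i w) (y i))"
    by (intro sum.cong refl) (simp add: adjD'[OF is_adjoint])
  finally have ww: "ip w w = (\<Sum>i\<in>I. ip (c' i w) (y i))" .
  have "(\<Sum>i\<in>I. ip (c' i w) (c' i w)) = ip w (\<Sum>i\<in>I. c i (c' i w))"
    unfolding ip_sum by (intro sum.cong refl) (simp add: adjD'[OF is_adjoint])
  then have "norm (\<Sum>i\<in>I. ip (c' i w) (c' i w)) \<le> nr w * (M * nr w)"
    using norm_ip_le[of w "\<Sum>i\<in>I. c i (c' i w)"] mult_left_mono[OF op_boundD[OF bd, of w], of "nr w"]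
    by simp
  then have "(norm (ip w w))\<^sup>2 \<le> nr w * (M * nr w) * norm (\<Sum>i\<in>I. ip (y i) (y i))"
    unfolding ww by (intro order_trans[OF cauchy_schwarz_family] mult_right_mono) auto
  then have *: "(nr w)\<^sup>2 * (nr w)\<^sup>2 \<le> (M * norm (\<Sum>i\<in>I. ip (y i) (y i))) * (nr w)\<^sup>2"
    by (simp add: nr_square[symmetric] power2_eq_square mult_ac)
  show ?thesis
  proof (cases "w = 0")
    case True
    then show ?thesis using M by (simp add: w_def)
  next
    case False
    then have "(nr w)\<^sup>2 > 0" by simp
    then show ?thesis
      using mult_right_le_imp_le[OF *] unfolding w_def by simp
  qed
qed

subsection \<open>Positive operators\<close>

lemma op_positive_is_adjoint: "op_positive X T \<Longrightarrow> is_adjoint X T T"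
  by (simp add: op_positive_def)

lemma op_positive_cpos: "op_positive X T \<Longrightarrow> cpos (ip x (T x))"
  by (simp add: op_positive_def)

lemma op_positive_id: "op_positive X (\<lambda>x. x)" and op_positive_0: "op_positive X (\<lambda>x. 0)"
  by (simp_all add: op_positive_def cpos_ip is_adjoint_id is_adjoint_zero)

lemma op_positive_add: "op_positive X S \<Longrightarrow> op_positive X T \<Longrightarrow> op_positive X (\<lambda>x. S x + T x)"
  by (simp add: op_positive_def is_adjoint_add ip_simps cpos_add)

lemma op_positive_conj:
  assumes "op_positive X T" "is_adjoint X S S'"
  shows "op_positive X (\<lambda>x. S (T (S' x)))"
  unfolding op_positive_def
proof
  show "is_adjoint X (\<lambda>x. S (T (S' x))) (\<lambda>x. S (T (S' x)))"
    by (simp add: is_adjoint_def is_adjointD[OF assms(2)] adjD'[OF assms(2)] is_adjointD[OF op_positive_is_adjoint[OF assms(1)]])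
  show "\<forall>x. cpos (ip x (S (T (S' x))))"
    using assms by (simp add: adjD'[OF assms(2), symmetric] op_positive_cpos)
qed

text \<open>The identity \<open>r - r\<^sup>2 = r (1 - r) r + (1 - r) r (1 - r)\<close> makes
  positivity visible without a square root of \<open>r\<close>.\<close>

lemma op_positive_sub_square:
  assumes r: "op_positive X r" and r1: "op_positive X (\<lambda>x. x - r x)"
  shows "op_positive X (\<lambda>x. r x - r (r x))"
proof -
  note a = op_positive_is_adjoint[OF r] and b = op_positive_is_adjoint[OF r1]
  have "op_positive X (\<lambda>x. r (r x - r (r x)) + (r (x - r x) - r (r (x - r x))))"
    using op_positive_add[OF op_positive_conj[OF r1 a] op_positive_conj[OF r b]] by simp
  then show ?thesis by (simp add: is_adjoint_linear[OF a])
qed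

lemma op_bound_1_of_op_positive:
  assumes r: "op_positive X r" and r1: "op_positive X (\<lambda>x. x - r x)"
  shows "op_bound X 1 r"
  unfolding op_bound_def
proof
  fix x
  have "cpos ((ip x x - ip x (r x)) + (ip x (r x) - ip x (r (r x))))"
    using op_positive_cpos[OF op_positive_sub_square[OF assms], of x] op_positive_cpos[OF r1, of x]
    by (intro cpos_add) (simp_all add: ip_diff)
  then have "norm (ip (r x) (r x)) \<le> norm (ip x x)"
    by (intro norm_mono_cpos cpos_ip) (simp add: is_adjointD[OF op_positive_is_adjoint[OF r]])
  then show "nr (r x) \<le> 1 * nr x"
    by (simp add: rnorm_def)
qed

section \<open>The iteration \<open>r - r h r\<close>, a substitute for functional calculus\<close>

lemma quadratic_iterate_commute:
  assumes h: "is_adjoint X h h" and c: "\<And>x. r (h x) = h (r x)" and rr: "is_adjoint X r r"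
  shows "is_adjoint X (quadratic_iterate h r n) (quadratic_iterate h r n) \<and> (\<forall>x. quadratic_iterate h r n (h x) = h (quadratic_iterate h r n x))"
proof (induction n)
  case (Suc n)
  then have I: "is_adjoint X (quadratic_iterate h r n) (quadratic_iterate h r n)" and C: "\<And>x. quadratic_iterate h r n (h x) = h (quadratic_iterate h r n x)"
    by auto
  have "is_adjoint X (\<lambda>x. quadratic_iterate h r n (h (quadratic_iterate h r n x))) (\<lambda>x. quadratic_iterate h r n (h (quadratic_iterate h r n x)))"
    using is_adjoint_comp[OF I is_adjoint_comp[OF h I]] by (simp add: C)
  then show ?case
    using I by (simp add: is_adjoint_diff C is_adjoint_linear[OF h])
qed (simp_all add: rr c)

context
  fixes h r :: "'x \<Rightarrow> 'x"
  assumes h: "op_positive X h" and h1: "op_positive X (\<lambda>x. x - h x)"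
    and r: "op_positive X r" and r1: "op_positive X (\<lambda>x. x - r x)"
    and comm: "\<And>x. r (h x) = h (r x)"
begin

abbreviation "rn \<equiv> quadratic_iterate h r"

lemma rn_is_adjoint: "is_adjoint X (rn n) (rn n)" and rn_comm: "rn n (h x) = h (rn n x)"
  using quadratic_iterate_commute[OF op_positive_is_adjoint[OF h] comm op_positive_is_adjoint[OF r]] by auto

text \<open>The next iterate is \<open>r (1 - h) r + (r - r\<^sup>2)\<close>, and its complement is
  \<open>(1 - r) + r h r\<close>.\<close>

lemma rn_op_positive: "op_positive X (rn n)" and rn_opos1: "op_positive X (\<lambda>x. x - rn n x)"
proof -
  have "op_positive X (rn n) \<and> op_positive X (\<lambda>x. x - rn n x)"
  proof (induction n)
    case 0
    then show ?case using r r1 by simp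
  next
    case (Suc n)
    note a = rn_is_adjoint[of n]
    have "op_positive X (\<lambda>x. rn n (rn n x - h (rn n x)) + (rn n x - rn n (rn n x)))"
      using Suc by (intro op_positive_add op_positive_conj[OF h1 a] op_positive_sub_square) auto
    moreover have "op_positive X (\<lambda>x. (x - rn n x) + rn n (h (rn n x)))"
      using Suc by (intro op_positive_add op_positive_conj[OF h a]) auto
    ultimately show ?case
      by (simp add: is_adjoint_linear[OF a] algebra_simps)
  qed
  then show "op_positive X (rn n)" "op_positive X (\<lambda>x. x - rn n x)" by auto
qed

abbreviation "an n x \<equiv> rn n (h (rn n x))"

text \<open>Since everything commutes, with \<open>r'\<close> the next iterate and
  \<open>r - r' = r h r\<close>, the difference \<open>r h r - r' h r'\<close> equals
  \<open>h r (r + r') r h\<close>.\<close>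

lemma an_decreasing: "op_positive X (\<lambda>x. an n x - an (Suc n) x)"
proof -
  note a = rn_is_adjoint[of n]
  have H: "is_adjoint X h h" by (rule op_positive_is_adjoint[OF h])
  have "is_adjoint X (\<lambda>x. h (rn n x)) (\<lambda>x. rn n (h x))"
    by (rule is_adjoint_comp[OF H a])
  from op_positive_conj[OF op_positive_add[OF rn_op_positive[of n] rn_op_positive[of "Suc n"]] this]
  show ?thesis
    by (simp add: is_adjoint_linear[OF a] is_adjoint_linear[OF H] rn_comm algebra_simps)
qed

lemma an_antimono: "j \<le> n \<Longrightarrow> cpos (ip x (an j x) - ip x (an n x))"
proof (induction rule: dec_induct)
  case (step m)
  have "cpos (ip x (an m x) - ip x (an (Suc m) x))"
    using op_positive_cpos[OF an_decreasing[of m], of x] by (simp only: ip_diff)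
  from cpos_add[OF step.IH this] show ?case
    by (simp only: diff_add_cancel add_diff_eq)
qed simp

lemma quadratic_iterate_telescope: "r x = rn n x + (\<Sum>j<n. an j x)"
  by (induction n) simp_all

text \<open>The terms up to index \<open>n\<close> add up to at most \<open>r\<close>, hence to at
  most 1, and each dominates the \<open>n\<close>-th. So \<open>n\<close> times the
  \<open>n\<close>-th term is at most 1.\<close>

lemma an_small: "cpos (ip x x - real n *\<^sub>R ip x (an n x))"
proof -
  have "cpos ((ip x x - ip x (r x)) + ip x (rn n x) + (\<Sum>j<n. ip x (an j x) - ip x (an n x)))"
    by (intro cpos_add cpos_sum an_antimono op_positive_cpos[OF rn_op_positive])
      (use op_positive_cpos[OF r1, of x] in \<open>auto simp: ip_diff\<close>)
  also have "(ip x x - ip x (r x)) + ip x (rn n x) + (\<Sum>j<n. ip x (an j x) - ip x (an n x))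
      = ip x x - real n *\<^sub>R ip x (an n x)"
    by (subst quadratic_iterate_telescope[of _ n]) (simp add: ip_simps ip_sum sum_subtractf sum_constant_scaleR)
  finally show ?thesis .
qed

end

text \<open>For \<open>h = 1\<close> the terms are the squares of the iterates, so
  \<open>an_small\<close> bounds the square of the \<open>n\<close>-th iterate by
  \<open>1 / n\<close>. That iterate is the error of approximating \<open>k\<close> by a sum of
  squares.\<close>

lemma square_decomposition:
  assumes k: "op_positive X k" "op_positive X (\<lambda>x. x - k x)" and n: "n > 0"
  shows "op_bound X (1 / sqrt (real n)) (quadratic_iterate (\<lambda>x. x) k n)"
  unfolding op_bound_def
proof
  fix x
  have id1: "op_positive X (\<lambda>x. x - x)" using op_positive_0 by simp
  note A = rn_is_adjoint[OF op_positive_id id1 k refl, of n]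
  have "cpos (ip x x - real n *\<^sub>R ip (quadratic_iterate (\<lambda>x. x) k n x) (quadratic_iterate (\<lambda>x. x) k n x))"
    using an_small[OF op_positive_id id1 k refl, of x n] by (simp add: is_adjointD[OF A])
  then have "norm (real n *\<^sub>R ip (quadratic_iterate (\<lambda>x. x) k n x) (quadratic_iterate (\<lambda>x. x) k n x)) \<le> norm (ip x x)"
    by (intro norm_mono_cpos cpos_scaleR cpos_ip) simp_all
  then have "(nr (quadratic_iterate (\<lambda>x. x) k n x))\<^sup>2 \<le> (1 / sqrt (real n) * nr x)\<^sup>2"
    using n by (simp add: nr_square power_mult_distrib power_divide field_simps)
  then show "nr (quadratic_iterate (\<lambda>x. x) k n x) \<le> 1 / sqrt (real n) * nr x"
    by (rule power2_le_imp_le) simp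
qed

subsection \<open>Finite-rank operators and the approximate unit\<close>

lemma finite_rank_simps [simp]: "finite_rank X [] z = 0" "finite_rank X ((x, y) # ps) z = ract X x (ip y z) + finite_rank X ps z"
  "finite_rank X (ps @ qs) z = finite_rank X ps z + finite_rank X qs z"
  by (simp_all add: finite_rank_def theta_r_def)

lemma diag_simps [simp]: "diag [] = []" "diag (x # xs) = (x, x) # diag xs" "diag (xs @ ys) = diag xs @ diag ys"
  by (simp_all add: diag_def)

lemma finite_rank_conj:
  assumes "is_adjoint X T T'" "is_adjoint X S S'"
  shows "T (finite_rank X ps (S z)) = finite_rank X (map (\<lambda>(x, y). (T x, S' y)) ps) z"
  by (induction ps) (auto simp: is_adjoint_linear[OF assms(1)] adjD'[OF assms(2)])

lemma finite_rank_diag_conj: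
  assumes "is_adjoint X T T'"
  shows "T (finite_rank X (diag xs) (T' z)) = finite_rank X (diag (map T xs)) z"
  using finite_rank_conj[OF assms is_adjoint_sym[OF assms], of "diag xs"] by (simp add: diag_def comp_def)

lemma ip_finite_rank_diag: "ip z (finite_rank X (diag xs) z) = (\<Sum>x\<leftarrow>xs. star (ip x z) * ip x z)"
  by (induction xs) (simp_all add: ip_simps ip_star)

lemma op_positive_finite_rank_diag: "op_positive X (finite_rank X (diag xs))"
proof -
  have "map prod.swap (diag xs) = diag xs" by (simp add: diag_def)
  then have "is_adjoint X (finite_rank X (diag xs)) (finite_rank X (diag xs))"
    using is_adjoint_finite_rank[of "diag xs"] by simp
  moreover have "cpos (\<Sum>x\<leftarrow>xs. star (ip x z) * ip x z)" for z
    by (induction xs) (auto intro: cpos_add cpos_star_mult)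
  ultimately show ?thesis by (simp add: op_positive_def ip_finite_rank_diag)
qed

text \<open>By Cauchy-Schwarz each \<open>\<theta>\<^sub>x\<^sub>,\<^sub>x\<close> is at most
  \<open>N\<close>, so their sum is at most \<open>length xs * N\<close> before scaling. The added
  ones keep both factors positive for the empty list.\<close>

lemma op_positive_id_minus_finite_rank_diag:
  assumes s: "(length xs + 1) * (s\<^sup>2 * (1 + (\<Sum>x\<leftarrow>xs. (nr x)\<^sup>2))) \<le> 1" and s0: "s > 0"
  shows "op_positive X (\<lambda>x. x - finite_rank X (diag (map (rs s) xs)) x)"
  unfolding op_positive_def
proof (intro conjI allI)
  show "is_adjoint X (\<lambda>x. x - finite_rank X (diag (map (rs s) xs)) x) (\<lambda>x. x - finite_rank X (diag (map (rs s) xs)) x)"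
    by (intro is_adjoint_diff[OF is_adjoint_id] op_positive_is_adjoint op_positive_finite_rank_diag)
  fix z
  define N where "N = 1 + (\<Sum>x\<leftarrow>xs. (nr x)\<^sup>2)"
  have N: "N \<ge> 1" unfolding N_def by (auto intro!: sum_list_nonneg)
  have sN: "s\<^sup>2 * N > 0" using s0 N by simp
  have "cpos (ip z z - (1 / N) *\<^sub>R (star (ip x z) * ip x z))" if "x \<in> set xs" for x
  proof -
    have "(nr x)\<^sup>2 \<le> (\<Sum>x\<leftarrow>xs. (nr x)\<^sup>2)"
      using that by (intro member_le_sum_list) (auto simp: image_iff)
    then show ?thesis
      using cauchy_schwarz_cpos[where I="{()}" and N=N and x="\<lambda>_. x" and y="\<lambda>_. z"] N by (simp add: N_def nr_square)
  qed
  then have "cpos (real (length ys) *\<^sub>R ip z z - (\<Sum>x\<leftarrow>ys. (1 / N) *\<^sub>R (star (ip x z) * ip x z)))"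
    if "set ys \<subseteq> set xs" for ys
    using that
  proof (induction ys)
    case (Cons y ys)
    then have "cpos ((ip z z - (1 / N) *\<^sub>R (star (ip y z) * ip y z)) +
        (real (length ys) *\<^sub>R ip z z - (\<Sum>x\<leftarrow>ys. (1 / N) *\<^sub>R (star (ip x z) * ip x z))))"
      by (intro cpos_add) auto
    then show ?case by (simp add: algebra_simps)
  qed simp
  then have "cpos ((s\<^sup>2 * N) *\<^sub>R (real (length xs) *\<^sub>R ip z z
      - (\<Sum>x\<leftarrow>xs. (1 / N) *\<^sub>R (star (ip x z) * ip x z))))"
    using sN by (intro cpos_scaleR) auto
  moreover have "cpos ((1 - s\<^sup>2 * N * real (length xs)) *\<^sub>R ip z z)"
    using s sN by (intro cpos_scaleR cpos_ip) (simp add: N_def algebra_simps)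
  ultimately have "cpos ((1 - s\<^sup>2 * N * real (length xs)) *\<^sub>R ip z z + (s\<^sup>2 * N) *\<^sub>R (real (length xs) *\<^sub>R ip z z
      - (\<Sum>x\<leftarrow>xs. (1 / N) *\<^sub>R (star (ip x z) * ip x z))))"
    by (rule cpos_add[rotated])
  also have "(1 - s\<^sup>2 * N * real (length xs)) *\<^sub>R ip z z + (s\<^sup>2 * N) *\<^sub>R (real (length xs) *\<^sub>R ip z z
      - (\<Sum>x\<leftarrow>xs. (1 / N) *\<^sub>R (star (ip x z) * ip x z)))
      = ip z z - (s\<^sup>2 * N) *\<^sub>R (\<Sum>x\<leftarrow>xs. (1 / N) *\<^sub>R (star (ip x z) * ip x z))"
    by (simp add: algebra_simps)
  also have "(s\<^sup>2 * N) *\<^sub>R (\<Sum>x\<leftarrow>xs. (1 / N) *\<^sub>R (star (ip x z) * ip x z))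
      = (\<Sum>x\<leftarrow>xs. s\<^sup>2 *\<^sub>R (star (ip x z) * ip x z))"
    using N by (induction xs) (simp_all add: scaleR_add_right)
  also have "\<dots> = ip z (finite_rank X (diag (map (rs s) xs)) z)"
    unfolding ip_finite_rank_diag
    by (simp add: comp_def ip_simps star_scaleC mult_scaleC_left mult_scaleC_right scaleC_scaleC scaleR_scaleC
        power2_eq_square)
  finally show "cpos (ip z (z - finite_rank X (diag (map (rs s) xs)) z))"
    by (simp add: ip_diff)
qed

text \<open>The complement of the \<open>n\<close>-th iterate is diagonal because each subtracted
  term \<open>R\<^sub>j h R\<^sub>j\<close> is the sum of the
  \<open>\<theta>\<^sub>z\<^sub>,\<^sub>z\<close> with \<open>z = R\<^sub>j y\<close>. Evaluating
  \<open>n R\<^sub>n h R\<^sub>n \<le> 1\<close> at one such \<open>z\<close> for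
  \<open>j = n\<close> and keeping only its own summand gives
  \<open>n (z|z)\<^sup>2 \<le> (z|z)\<close>. Hence \<open>z\<close> has norm at most
  \<open>1 / sqrt n\<close>.\<close>

lemma approximate_unit:
  assumes "\<delta> > 0"
  obtains zs where "op_positive X (\<lambda>x. x - finite_rank X (diag zs) x)" "\<forall>x\<in>set xs. nr (finite_rank X (diag zs) x - x) < \<delta>"
proof -
  define N where "N = (length xs + 1) * (1 + (\<Sum>x\<leftarrow>xs. (nr x)\<^sup>2))"
  have N: "N > 0" unfolding N_def by (intro mult_pos_pos add_pos_nonneg sum_list_nonneg) auto
  define s where "s = 1 / sqrt N"
  have s: "s > 0" "s\<^sup>2 * N = 1" using N by (simp_all add: s_def power_divide)
  define ys where "ys = map (rs s) xs"
  define h where "h = finite_rank X (diag ys)"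
  have h1: "op_positive X (\<lambda>x. x - h x)"
    unfolding h_def ys_def using s by (intro op_positive_id_minus_finite_rank_diag) (simp_all add: N_def mult_ac)
  have h: "op_positive X h" unfolding h_def by (rule op_positive_finite_rank_diag)
  have id1: "op_positive X (\<lambda>x. x - x)" using op_positive_0 by simp
  define R where "R = quadratic_iterate h (\<lambda>x. x)"
  note A = rn_is_adjoint[OF h h1 op_positive_id id1 refl, folded R_def]
  have ex: "\<exists>zs. \<forall>x. x - R n x = finite_rank X (diag zs) x" for n
  proof (induction n)
    case 0
    show ?case by (intro exI[of _ "[]"]) (simp add: R_def)
  next
    case (Suc n)
    then obtain zs where zs: "\<And>x. x - R n x = finite_rank X (diag zs) x" by blast
    have "x - R (Suc n) x = finite_rank X (diag (zs @ map (R n) ys)) x" for x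
      using finite_rank_diag_conj[OF A, of n ys x] by (simp add: zs[symmetric]) (simp add: R_def h_def)
    then show ?case by blast
  qed
  \<comment> \<open>The factor \<open>s\<^sup>2\<close> undoes the scaling of the vectors in
    \<open>ys\<close>.\<close>
  obtain n :: nat where n: "1 / (s\<^sup>2 * \<delta>\<^sup>2) < real n"
    using reals_Archimedean2 by blast
  moreover have "0 < 1 / (s\<^sup>2 * \<delta>\<^sup>2)" using s assms by simp
  ultimately have n0: "real n > 0" by linarith
  obtain zs where zs: "\<And>x. x - R n x = finite_rank X (diag zs) x" using ex by blast
  have "op_positive X (\<lambda>x. x - (x - R n x))"
    using rn_op_positive[OF h h1 op_positive_id id1 refl, of n] by (simp add: R_def)
  then have 1: "op_positive X (\<lambda>x. x - finite_rank X (diag zs) x)" by (simp add: zs)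
  have "nr (finite_rank X (diag zs) x - x) < \<delta>" if x: "x \<in> set xs" for x
  proof -
    define z where "z = R n (rs s x)"
    have zin: "z \<in> set (map (R n) ys)" using x by (simp add: z_def ys_def)
    have "cpos (ip z z - real n *\<^sub>R ip z (R n (h (R n z))))"
      using an_small[OF h h1 op_positive_id id1 refl, of z n] by (simp add: R_def)
    also have "ip z (R n (h (R n z))) = (\<Sum>x\<leftarrow>map (R n) ys. star (ip x z) * ip x z)"
      unfolding h_def finite_rank_diag_conj[OF A] ip_finite_rank_diag ..
    finally have c1: "cpos (ip z z - real n *\<^sub>R (\<Sum>x\<leftarrow>map (R n) ys. star (ip x z) * ip x z))" .
    have "cpos ((\<Sum>x\<leftarrow>us. star (ip x z) * ip x z) - star (ip z z) * ip z z)" if "z \<in> set us" for us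
    proof -
      obtain us1 us2 where "us = us1 @ z # us2" using \<open>z \<in> set us\<close> by (auto simp: in_set_conv_decomp)
      moreover have "cpos (\<Sum>x\<leftarrow>us. star (ip x z) * ip x z)" for us
        by (induction us) (auto intro: cpos_add cpos_star_mult)
      ultimately show ?thesis using cpos_add[of "\<Sum>x\<leftarrow>us1. star (ip x z) * ip x z" "\<Sum>x\<leftarrow>us2. star (ip x z) * ip x z"]
        by simp
    qed
    from cpos_add[OF c1 cpos_scaleR[OF less_imp_le[OF n0] this[OF zin]]]
    have "cpos (ip z z - real n *\<^sub>R (star (ip z z) * ip z z))"
      by (simp add: scaleR_diff_right)
    then have "norm (real n *\<^sub>R (star (ip z z) * ip z z)) \<le> norm (ip z z)"
      by (intro norm_mono_cpos cpos_scaleR cpos_star_mult) simp_all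
    then have "real n * ((nr z)\<^sup>2 * (nr z)\<^sup>2) \<le> (nr z)\<^sup>2"
      unfolding nr_square by (simp add: cstar_identity power2_eq_square)
    then have *: "(real n * (nr z)\<^sup>2) * (nr z)\<^sup>2 \<le> 1 * (nr z)\<^sup>2" by (simp add: mult.assoc)
    have le: "real n * (nr z)\<^sup>2 \<le> 1"
    proof (cases "z = 0")
      case False
      then show ?thesis by (intro mult_right_le_imp_le[OF *]) simp
    qed simp
    have "nr z = s * nr (R n x)"
      using s by (simp add: z_def is_adjoint_linear[OF A] nr_scale norm_divide norm_mult)
    then have "real n * (s\<^sup>2 * (nr (R n x))\<^sup>2) \<le> 1" using le by (simp add: power_mult_distrib)
    then have "(nr (R n x))\<^sup>2 \<le> 1 / (real n * s\<^sup>2)"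
      using n0 s by (simp add: field_simps)
    also have "\<dots> < \<delta>\<^sup>2"
      using n n0 s assms by (simp add: field_simps)
    finally have "nr (R n x) < \<delta>"
      using assms by (intro power2_less_imp_less[of _ \<delta>]) auto
    moreover have "finite_rank X (diag zs) x - x = - R n x"
      by (simp add: zs[symmetric])
    ultimately show ?thesis by simp
  qed
  with 1 show ?thesis using that by blast
qed

end

context right_hilbert
begin

subsection \<open>Compact operators\<close>

lemma bdd_above_unit_ball: "op_bound X M T \<Longrightarrow> M \<ge> 0 \<Longrightarrow> nr x \<le> 1 \<Longrightarrow> nr (T x) \<le> M"
  using op_boundD[of M T x] mult_left_mono[of "nr x" 1 M] by simp

lemma op_norm_le: "op_bound X M T \<Longrightarrow> M \<ge> 0 \<Longrightarrow> op_norm_r X T \<le> M"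
  unfolding op_norm_r_def
  by (rule cSUP_least) (auto intro: bdd_above_unit_ball exI[of _ 0])

lemma op_norm:
  assumes T: "is_adjoint X T S"
  shows "op_bound X (op_norm_r X T) T"
  unfolding op_bound_def
proof
  fix x
  obtain M where M: "M > 0" "op_bound X M T" using is_adjoint_bounded[OF T] .
  have ba: "bdd_above ((\<lambda>x. nr (T x)) ` {x. nr x \<le> 1})"
    using M by (intro bdd_aboveI[of _ M]) (auto intro: bdd_above_unit_ball)
  show "nr (T x) \<le> op_norm_r X T * nr x"
  proof (cases "x = 0")
    case False
    then have x: "nr x > 0" using nr_ge_0[of x] nr_eq_0[of x] by linarith
    have "nr (T (rs (1 / nr x) x)) \<le> op_norm_r X T"
      unfolding op_norm_r_def using x
      by (intro cSUP_upper ba) (simp add: nr_scale norm_divide)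
    then show ?thesis
      using x by (auto simp: is_adjoint_linear[OF T] nr_scale norm_divide field_simps split: if_splits)
  qed (simp add: is_adjoint_linear[OF T])
qed

lemma op_norm_nonneg:
  assumes T: "is_adjoint X T S"
  shows "op_norm_r X T \<ge> 0"
proof -
  obtain M where M: "M > 0" "op_bound X M T" using is_adjoint_bounded[OF T] .
  have "nr (T 0) \<le> op_norm_r X T"
    unfolding op_norm_r_def using M
    by (intro cSUP_upper bdd_aboveI[of _ M]) (auto intro: bdd_above_unit_ball)
  then show ?thesis using nr_ge_0[of "T 0"] by linarith
qed

lemma finite_rank_eq_sum: "finite_rank X ps z = (\<Sum>i<length ps. theta_r X (fst (ps ! i)) (snd (ps ! i)) z)"
  by (simp add: finite_rank_def sum_list_sum_nth atLeast0LessThan case_prod_unfold)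

text \<open>Replaces the supremum in \<open>op_norm_r\<close> by explicit bounds, which compose
  without checking that a set is bounded above. Automatic boundedness of adjointable maps is behind
  the equivalence.\<close>

lemma compact_r_iff:
  "T \<in> compact_r X \<longleftrightarrow> (\<exists>S. is_adjoint X T S) \<and> (\<forall>e>0. \<exists>ps. op_bound X e (\<lambda>z. T z - finite_rank X ps z))"
proof (intro iffI conjI allI impI)
  assume T: "T \<in> compact_r X"
  then show "\<exists>S. is_adjoint X T S" by (auto simp: compact_r_def right_adjointable_def is_adjoint_def)
  then obtain S where S: "is_adjoint X T S" by blast
  fix e :: real assume "e > 0"
  then obtain n x y where n: "op_norm_r X (\<lambda>z. T z - (\<Sum>i<(n::nat). theta_r X (x i) (y i) z)) < e"
    using T by (auto simp: compact_r_def)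
  define ps where "ps = map (\<lambda>i. (x i, y i)) [0..<n]"
  have eq: "(\<Sum>i<n. theta_r X (x i) (y i) z) = finite_rank X ps z" for z
    by (simp add: finite_rank_eq_sum ps_def)
  have "op_bound X (op_norm_r X (\<lambda>z. T z - finite_rank X ps z)) (\<lambda>z. T z - finite_rank X ps z)"
    by (rule op_norm[OF is_adjoint_diff[OF S is_adjoint_finite_rank]])
  then show "\<exists>ps. op_bound X e (\<lambda>z. T z - finite_rank X ps z)"
    using n unfolding eq by (blast intro: op_bound_mono less_imp_le)
next
  assume *: "(\<exists>S. is_adjoint X T S) \<and> (\<forall>e>0. \<exists>ps. op_bound X e (\<lambda>z. T z - finite_rank X ps z))"
  show "T \<in> compact_r X"
    unfolding compact_r_def
  proof (intro CollectI conjI allI impI)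
    show "T \<in> right_adjointable X" using * by (auto simp: right_adjointable_def is_adjoint_def)
    fix e :: real assume e: "e > 0"
    then obtain ps where "op_bound X (e/2) (\<lambda>z. T z - finite_rank X ps z)" using * half_gt_zero by blast
    then have "op_norm_r X (\<lambda>z. T z - finite_rank X ps z) < e"
      using op_norm_le[of "e/2"] e by fastforce
    then show "\<exists>(n::nat) x y. op_norm_r X (\<lambda>z. T z - (\<Sum>i<n. theta_r X (x i) (y i) z)) < e"
      unfolding finite_rank_eq_sum
      by (intro exI[of _ "length ps"] exI[of _ "\<lambda>i. fst (ps ! i)"] exI[of _ "\<lambda>i. snd (ps ! i)"])
  qed
qed

lemma compact_r_is_adjoint:
  assumes "T \<in> compact_r X"
  obtains S where "is_adjoint X T S"
  using assms compact_r_iff by blast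

lemma compact_r_approx:
  assumes "T \<in> compact_r X" "e > 0"
  obtains ps where "op_bound X e (\<lambda>z. T z - finite_rank X ps z)"
  using assms compact_r_iff by blast

lemma compact_finite_rank: "finite_rank X ps \<in> compact_r X"
proof -
  have "op_bound X e (\<lambda>z. finite_rank X ps z - finite_rank X ps z)" if "e > 0" for e
    using that by (simp add: op_bound_def)
  then show ?thesis unfolding compact_r_iff using is_adjoint_finite_rank by blast
qed

lemma compact_limit:
  assumes T: "is_adjoint X T S" and lim: "\<And>e. e > 0 \<Longrightarrow> \<exists>T'\<in>compact_r X. op_bound X e (\<lambda>z. T z - T' z)"
  shows "T \<in> compact_r X"
  unfolding compact_r_iff
proof (intro conjI allI impI exI[of _ S] T)
  fix e :: real assume e: "e > 0"
  then obtain T' where T': "T' \<in> compact_r X" "op_bound X (e/2) (\<lambda>z. T z - T' z)"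
    using lim[of "e/2"] by auto
  obtain ps where "op_bound X (e/2) (\<lambda>z. T' z - finite_rank X ps z)"
    using compact_r_approx[OF T'(1), of "e/2"] e by auto
  from op_bound_add[OF T'(2) this] show "\<exists>ps. op_bound X e (\<lambda>z. T z - finite_rank X ps z)"
    by (auto intro: exI[of _ ps])
qed

lemma compact_zero: "(\<lambda>z. 0) \<in> compact_r X"
  using compact_finite_rank[of "[]"] by (simp add: finite_rank_def)

lemma compact_add:
  assumes "S \<in> compact_r X" "T \<in> compact_r X"
  shows "(\<lambda>z. S z + T z) \<in> compact_r X"
proof -
  obtain S' T' where a: "is_adjoint X S S'" "is_adjoint X T T'" using assms compact_r_is_adjoint by metis
  show ?thesis
  proof (rule compact_limit[OF is_adjoint_add[OF a]])
    fix e :: real assume e: "e > 0"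
    obtain ps where ps: "op_bound X (e/2) (\<lambda>z. S z - finite_rank X ps z)"
      using compact_r_approx[OF assms(1), of "e/2"] e by auto
    obtain qs where qs: "op_bound X (e/2) (\<lambda>z. T z - finite_rank X qs z)"
      using compact_r_approx[OF assms(2), of "e/2"] e by auto
    from op_bound_add[OF ps qs] have "op_bound X e (\<lambda>z. (S z + T z) - finite_rank X (ps @ qs) z)"
      by (simp add: algebra_simps)
    then show "\<exists>T'\<in>compact_r X. op_bound X e (\<lambda>z. (S z + T z) - T' z)"
      using compact_finite_rank by blast
  qed
qed

lemma compact_comp:
  assumes T: "T \<in> compact_r X" and R: "is_adjoint X R R'" and S: "is_adjoint X S S'"
  shows "(\<lambda>z. R (T (S z))) \<in> compact_r X"
proof -
  obtain T' where T': "is_adjoint X T T'" using compact_r_is_adjoint[OF T] .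
  obtain M N where M: "M > 0" "op_bound X M R" and N: "N > 0" "op_bound X N S"
    using is_adjoint_bounded[OF R] is_adjoint_bounded[OF S] by metis
  show ?thesis
  proof (rule compact_limit[OF is_adjoint_comp[OF R is_adjoint_comp[OF T' S]]])
    fix e :: real assume e: "e > 0"
    obtain ps where ps: "op_bound X (e / (M * N)) (\<lambda>z. T z - finite_rank X ps z)"
      using compact_r_approx[OF T, of "e / (M * N)"] e M N by auto
    have "op_bound X (M * (e / (M * N) * N)) (\<lambda>z. R (T (S z) - finite_rank X ps (S z)))"
      using e M N by (intro op_bound_comp[OF M(2) op_bound_comp[OF ps N(2)]]) auto
    then have "op_bound X e (\<lambda>z. R (T (S z)) - R (finite_rank X ps (S z)))"
      using M N by (simp add: is_adjoint_linear[OF R])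
    then have "op_bound X e (\<lambda>z. R (T (S z)) - finite_rank X (map (\<lambda>(x, y). (R x, S' y)) ps) z)"
      by (simp add: finite_rank_conj[OF R S])
    then show "\<exists>T'\<in>compact_r X. op_bound X e (\<lambda>z. R (T (S z)) - T' z)"
      using compact_finite_rank by blast
  qed
qed

lemma compact_scale: "T \<in> compact_r X \<Longrightarrow> (\<lambda>z. scale X c (T z)) \<in> compact_r X"
  using compact_comp[OF _ is_adjoint_scale[OF is_adjoint_id] is_adjoint_id] by blast

lemma scale_minus_one: "scale X (- 1) x = - x"
proof -
  have "scale X (- 1) x + x = scale X (- 1 + 1) x"
    by (simp only: scale_simps(2,4))
  also have "\<dots> = 0" using nr_scale[of 0 x] by simp
  finally show ?thesis by (simp add: eq_neg_iff_add_eq_0)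
qed

lemma compact_diff: "S \<in> compact_r X \<Longrightarrow> T \<in> compact_r X \<Longrightarrow> (\<lambda>z. S z - T z) \<in> compact_r X"
  using compact_add[of S "\<lambda>z. scale X (- 1) (T z)"] compact_scale[of T "- 1"]
  by (simp add: scale_minus_one)

lemma compact_mult: "S \<in> compact_r X \<Longrightarrow> T \<in> compact_r X \<Longrightarrow> (\<lambda>z. S (T z)) \<in> compact_r X"
  using compact_comp[OF _ _ is_adjoint_id, of T S] by (blast elim: compact_r_is_adjoint)

lemma compact_is_adjoint:
  assumes T: "T \<in> compact_r X" and S: "is_adjoint X T S"
  shows "S \<in> compact_r X"
proof (rule compact_limit[OF is_adjoint_sym[OF S]])
  fix e :: real assume "e > 0"
  then obtain ps where "op_bound X e (\<lambda>z. T z - finite_rank X ps z)" using compact_r_approx[OF T] by blast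
  then have "op_bound X e (\<lambda>z. S z - finite_rank X (map prod.swap ps) z)"
    by (rule op_bound_is_adjoint[OF is_adjoint_diff[OF S is_adjoint_finite_rank]])
  then show "\<exists>T'\<in>compact_r X. op_bound X e (\<lambda>z. S z - T' z)"
    using compact_finite_rank by blast
qed

text \<open>These sets are a filter base, and each is convex. The first property allows limits along
  all approximate units at once; the second keeps the result of the Hahn-Banach argument inside a
  prescribed set.\<close>

definition approx_units :: "'x list \<Rightarrow> real \<Rightarrow> ('x \<Rightarrow> 'x) set" where
  "approx_units xs \<delta> = {u. (\<exists>zs. u = finite_rank X (diag zs)) \<and> op_positive X (\<lambda>x. x - u x) \<and> (\<forall>x\<in>set xs. nr (u x - x) < \<delta>)}"

lemma approx_unitsD:
  assumes "u \<in> approx_units xs \<delta>"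
  shows "op_positive X u" "op_positive X (\<lambda>x. x - u x)" "is_adjoint X u u" "op_bound X 1 u" "u \<in> compact_r X"
    "x \<in> set xs \<Longrightarrow> nr (u x - x) < \<delta>"
proof -
  show 1: "op_positive X u" "op_positive X (\<lambda>x. x - u x)" "u \<in> compact_r X" "x \<in> set xs \<Longrightarrow> nr (u x - x) < \<delta>"
    using assms by (auto simp: approx_units_def op_positive_finite_rank_diag compact_finite_rank)
  show "op_bound X 1 u" "is_adjoint X u u"
    using op_bound_1_of_op_positive[OF 1(1,2)] op_positive_is_adjoint[OF 1(1)] by auto
qed

lemma approx_units_nonempty:
  assumes "\<delta> > 0"
  shows "approx_units xs \<delta> \<noteq> {}"
proof -
  obtain zs where "op_positive X (\<lambda>x. x - finite_rank X (diag zs) x)" "\<forall>x\<in>set xs. nr (finite_rank X (diag zs) x - x) < \<delta>"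
    by (rule approximate_unit[OF assms])
  then have "finite_rank X (diag zs) \<in> approx_units xs \<delta>" by (auto simp: approx_units_def)
  then show ?thesis by blast
qed

lemma approx_units_inter: "approx_units (xs @ ys) (min \<delta> \<epsilon>) \<subseteq> approx_units xs \<delta> \<inter> approx_units ys \<epsilon>"
  by (auto simp: approx_units_def)

lemma approx_units_convex:
  assumes u: "u \<in> approx_units xs \<delta>" and v: "v \<in> approx_units xs \<delta>" and t: "0 \<le> t" "t \<le> 1"
  shows "(\<lambda>x. rs t (u x) + rs (1 - t) (v x)) \<in> approx_units xs \<delta>"
proof -
  \<comment> \<open>The diagonal form survives because the scalar is split as \<open>sqrt t\<close>
    on each of the two equal vectors.\<close>
  have finite_rank_rs: "rs t (finite_rank X (diag zs) x) = finite_rank X (diag (map (rs (sqrt t)) zs)) x" if t: "t \<ge> 0" for t zs x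
  proof -
    have t': "complex_of_real t = complex_of_real (sqrt t) * complex_of_real (sqrt t)"
      using t by (simp flip: of_real_mult)
    show ?thesis
    proof (induction zs)
      case (Cons z zs)
      have "rs t (ract X z (ip z x)) = ract X (rs (sqrt t) z) (ip (rs (sqrt t) z) x)"
        unfolding t' by (simp add: scale_simps ip_simps ract_simps)
      then show ?case by (simp add: scale_simps Cons)
    qed (use nr_scale[of "complex_of_real t" 0] in simp)
  qed
  have rs1: "rs t x + rs (1 - t) x = x" for x
    using scale_simps(2)[of "complex_of_real t" "complex_of_real (1 - t)" x] scale_simps(4)[of x] by simp
  have rpos: "op_positive X (\<lambda>x. rs t (w x))" if "t \<ge> 0" "op_positive X w" for t w
  proof -
    have "is_adjoint X (\<lambda>x. rs t (w x)) (\<lambda>x. rs t (w x))"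
      using is_adjoint_scale[OF op_positive_is_adjoint[OF that(2)], of "complex_of_real t"] by simp
    moreover have "ip x (rs t (w x)) = t *\<^sub>R ip x (w x)" for x
      by (simp add: ip_simps scaleR_scaleC)
    ultimately show ?thesis
      unfolding op_positive_def using op_positive_cpos[OF that(2)] that(1) by (simp add: cpos_scaleR)
  qed
  obtain zs ws where zs: "u = finite_rank X (diag zs)" "v = finite_rank X (diag ws)"
    using u v by (auto simp: approx_units_def)
  have "(\<lambda>x. rs t (u x) + rs (1 - t) (v x)) =
      finite_rank X (diag (map (rs (sqrt t)) zs @ map (rs (sqrt (1 - t))) ws))"
    using t by (simp add: fun_eq_iff zs finite_rank_rs[symmetric])
  moreover have "op_positive X (\<lambda>x. x - (rs t (u x) + rs (1 - t) (v x)))"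
  proof -
    have "op_positive X (\<lambda>x. rs t (x - u x) + rs (1 - t) (x - v x))"
      using t by (intro op_positive_add rpos approx_unitsD(2)[OF u] approx_unitsD(2)[OF v]) auto
    moreover have "rs t (x - u x) + rs (1 - t) (x - v x) = x - (rs t (u x) + rs (1 - t) (v x))" for x
      using rs1[of x] by (simp add: is_adjoint_linear(2)[OF is_adjoint_scale[OF is_adjoint_id]] algebra_simps del: of_real_diff)
    ultimately show ?thesis by simp
  qed
  moreover have "nr (rs t (u x) + rs (1 - t) (v x) - x) < \<delta>" if x: "x \<in> set xs" for x
  proof -
    have "rs t (u x) + rs (1 - t) (v x) - x = rs t (u x - x) + rs (1 - t) (v x - x)"
      using rs1[of x] by (simp add: is_adjoint_linear(2)[OF is_adjoint_scale[OF is_adjoint_id]] algebra_simps del: of_real_diff)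
    then have "nr (rs t (u x) + rs (1 - t) (v x) - x) \<le> t * nr (u x - x) + (1 - t) * nr (v x - x)"
      using nr_triangle[of "rs t (u x - x)" "rs (1 - t) (v x - x)"] t
      by (simp add: nr_scale del: of_real_diff)
    also have "\<dots> < \<delta>"
      using approx_unitsD(6)[OF u x] approx_unitsD(6)[OF v x] t
      by (intro convex_bound_lt) auto
    finally show ?thesis .
  qed
  ultimately show ?thesis
    unfolding approx_units_def by blast
qed

definition approx_filter :: "('x \<Rightarrow> 'x) filter" where
  "approx_filter = (INF (xs, \<delta>)\<in>UNIV \<times> {0<..}. principal (approx_units xs \<delta>))"

lemma eventually_approx_filter: "eventually P approx_filter \<longleftrightarrow> (\<exists>xs \<delta>. \<delta> > 0 \<and> (\<forall>u\<in>approx_units xs \<delta>. P u))"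
  unfolding approx_filter_def
proof (subst eventually_INF_base)
  show "\<exists>x\<in>UNIV \<times> {0<..}. (case x of (xs, \<delta>) \<Rightarrow> principal (approx_units xs \<delta>))
      \<le> inf (case a of (xs, \<delta>) \<Rightarrow> principal (approx_units xs \<delta>)) (case b of (xs, \<delta>) \<Rightarrow> principal (approx_units xs \<delta>))"
    if "a \<in> UNIV \<times> {0<..}" "b \<in> UNIV \<times> {0<..}" for a b :: "'x list \<times> real"
    using that approx_units_inter[of "fst a" "fst b" "snd a" "snd b"]
    by (intro bexI[of _ "(fst a @ fst b, min (snd a) (snd b))"]) (auto simp: case_prod_unfold)
qed (auto simp: eventually_principal)

lemma approx_filter_neq_bot: "approx_filter \<noteq> bot"
  unfolding trivial_limit_def eventually_approx_filter using approx_units_nonempty by blast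

lemma eventually_approx_filter_approx_units: "\<delta> > 0 \<Longrightarrow> eventually (\<lambda>u. u \<in> approx_units xs \<delta>) approx_filter"
  unfolding eventually_approx_filter by blast

lemma eventually_approx_filter_left_unit:
  assumes T: "T \<in> compact_r X" and e: "e > 0"
  shows "eventually (\<lambda>u. op_bound X e (\<lambda>z. u (T z) - T z)) approx_filter"
proof -
  obtain ps where ps: "op_bound X (e/4) (\<lambda>z. T z - finite_rank X ps z)"
    using compact_r_approx[OF T, of "e/4"] e by auto
  define Y where "Y = (\<Sum>(x, y)\<leftarrow>ps. nr y)"
  have Y: "Y \<ge> 0" unfolding Y_def by (rule sum_list_nonneg) auto
  \<comment> \<open>Replacing \<open>T\<close> by a finite-rank operator costs \<open>e/4\<close>
    twice, once under the contraction \<open>u\<close>. The remaining \<open>e/2\<close> covers the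
    finite-rank part, where only the first vectors of the pairs have to be nearly fixed.\<close>
  define \<delta> where "\<delta> = e / (2 * (1 + Y))"
  have \<delta>: "\<delta> > 0" using e Y by (simp add: \<delta>_def)
  have "op_bound X e (\<lambda>z. u (T z) - T z)" if u: "u \<in> approx_units (map fst ps) \<delta>" for u
  proof -
    note ua = approx_unitsD(3)[OF u]
    have "op_bound X (\<delta> * (\<Sum>(x, y)\<leftarrow>qs. nr y)) (\<lambda>z. u (finite_rank X qs z) - finite_rank X qs z)" if "set qs \<subseteq> set ps" for qs
      using that
    proof (induction qs)
      case (Cons p qs)
      obtain x y where p: "p = (x, y)" by fastforce
      have x: "nr (u x - x) < \<delta>" using Cons.prems p by (intro approx_unitsD(6)[OF u]) force
      have "op_bound X (\<delta> * nr y) (\<lambda>z. ract X (u x - x) (ip y z))"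
        unfolding op_bound_def
      proof
        fix z
        have "nr (ract X (u x - x) (ip y z)) \<le> nr (u x - x) * (nr y * nr z)"
          by (intro order_trans[OF nr_ract] mult_left_mono norm_ip_le) simp
        also have "\<dots> \<le> \<delta> * (nr y * nr z)"
          using x by (intro mult_right_mono) auto
        finally show "nr (ract X (u x - x) (ip y z)) \<le> \<delta> * nr y * nr z" by (simp add: mult.assoc)
      qed
      from op_bound_add[OF this Cons.IH] Cons.prems show ?case
        by (simp add: p is_adjoint_linear[OF ua] ract_diff algebra_simps)
    qed (simp add: op_bound_def is_adjoint_linear[OF ua])
    then have 1: "op_bound X (\<delta> * Y) (\<lambda>z. u (finite_rank X ps z) - finite_rank X ps z)" by (simp add: Y_def)
    have 2: "op_bound X (1 * (e/4)) (\<lambda>z. u (T z - finite_rank X ps z))"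
      by (rule op_bound_comp[OF approx_unitsD(4)[OF u] ps]) simp
    from op_bound_diff[OF op_bound_add[OF 1 2] ps]
    have "op_bound X (\<delta> * Y + e/4 + e/4) (\<lambda>z. u (T z) - T z)"
      by (simp add: is_adjoint_linear[OF ua])
    moreover have "\<delta> * Y \<le> e/2"
      using e Y by (simp add: \<delta>_def field_simps)
    then have "\<delta> * Y + e/4 + e/4 \<le> e" by simp
    ultimately show ?thesis by (rule op_bound_mono)
  qed
  then show ?thesis unfolding eventually_approx_filter using \<delta> by blast
qed

lemma eventually_approx_filter_right_unit:
  assumes T: "T \<in> compact_r X" and e: "e > 0"
  shows "eventually (\<lambda>u. op_bound X e (\<lambda>z. T (u z) - T z)) approx_filter"
proof -
  obtain S where S: "is_adjoint X T S" using compact_r_is_adjoint[OF T] .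
  have "eventually (\<lambda>u. op_bound X e (\<lambda>z. u (S z) - S z)) approx_filter"
    by (rule eventually_approx_filter_left_unit[OF compact_is_adjoint[OF T S] e])
  moreover have "eventually (\<lambda>u. is_adjoint X u u) approx_filter"
    using eventually_approx_filter_approx_units[of 1 "[]"] by (rule eventually_mono) (auto dest: approx_unitsD(3))
  ultimately show ?thesis
  proof eventually_elim
    case (elim u)
    show ?case
      by (rule op_bound_is_adjoint[OF is_adjoint_diff[OF is_adjoint_comp[OF elim(2) is_adjoint_sym[OF S]] is_adjoint_sym[OF S]] elim(1)])
  qed
qed

end

section \<open>Bi-Hilbertian bimodules\<close>

lemma contragradient_sel [simp]:
  "rip (contragradient X) = lip X" "lip (contragradient X) = rip X"
  "ract (contragradient X) = (\<lambda>x a. lact X (star a) x)"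
  "lact (contragradient X) = (\<lambda>b x. ract X x (star b))"
  "scale (contragradient X) c = scale X (cnj c)"
  "rnorm (contragradient X) = lnorm X" "lnorm (contragradient X) = rnorm X"
  by (auto simp: contragradient_def rnorm_def lnorm_def fun_eq_iff)

text \<open>The value that the index map is to take on the finite-rank operator represented by the
  list.\<close>

definition lip_sum :: "('a::cstar_algebra, 'b, 'x) bimodule \<Rightarrow> ('x \<times> 'x) list \<Rightarrow> 'a" where
  "lip_sum X ps = (\<Sum>(x, y)\<leftarrow>ps. lip X x y)"

lemma lip_sum_simps [simp]: "lip_sum X [] = 0" "lip_sum X ((x, y) # ps) = lip X x y + lip_sum X ps"
  "lip_sum X (ps @ qs) = lip_sum X ps + lip_sum X qs"
  by (simp_all add: lip_sum_def)

lemma lip_sum_diag: "lip_sum X (diag zs) = (\<Sum>i<length zs. lip X (zs ! i) (zs ! i))"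
  by (simp add: lip_sum_def diag_def sum_list_sum_nth atLeast0LessThan)

locale bihilbertian =
  fixes X :: "('a::cstar_algebra, 'b::cstar_algebra, 'x::ab_group_add) bimodule"
  assumes bi: "bi_hilbertian X"

sublocale bihilbertian \<subseteq> right_hilbert X
  using bi by unfold_locales (simp add: bi_hilbertian_def right_hilbert_bimodule_def)

text \<open>Makes the whole theory of right modules available for the left inner product, under the
  prefix \<open>L\<close>.\<close>

sublocale bihilbertian \<subseteq> L: right_hilbert "contragradient X"
  using bi_hilbertian_contragradient[OF bi]
  by unfold_locales (simp add: bi_hilbertian_def right_hilbert_bimodule_def)

context bihilbertian
begin

abbreviation "nl \<equiv> lnorm X"

lemma lact_simps:
  "lact X a (x + y) = lact X a x + lact X a y"
  "lact X (a + a') x = lact X a x + lact X a' x"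
  "lact X (a * a') x = lact X a (lact X a' x)"
  "lact X (c *\<^sub>C a) x = scale X c (lact X a x)"
  "lact X a (scale X c x) = scale X c (lact X a x)"
  using bi by (simp_all add: bi_hilbertian_def right_hilbert_bimodule_def is_bimodule_def left_module_def)

lemma lip_simps:
  "lip X (x + y) z = lip X x z + lip X y z"
  "lip X x (y + z) = lip X x y + lip X x z"
  "lip X (scale X c x) y = c *\<^sub>C lip X x y"
  "lip X x (scale X c y) = cnj c *\<^sub>C lip X x y"
  "lip X (lact X a x) y = a * lip X x y"
  "lip X x (lact X a y) = lip X x y * star a"
  using L.ip_simps(1)[of x y z] L.ip_simps(4)[of x y z] L.ip_simps(2)[of x "cnj c" y] L.ip_simps(5)[of "cnj c" x y]
    L.ip_simps(3)[of x y "star a"] L.ip_simps(6)[of x "star a" y]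
  by (simp_all add: star_star)

lemma is_adjoint_lact: "is_adjoint X (lact X a) (lact X (star a))"
  using bi by (simp add: is_adjoint_def bi_hilbertian_def right_hilbert_bimodule_def)

lemma lip_ract: "lip X (ract X x b) y = lip X x (ract X y (star b))"
  using bi by (simp add: bi_hilbertian_def left_hilbert_bimodule_def)

lemma is_adjoint_left_ract: "is_adjoint (contragradient X) (\<lambda>x. ract X x b) (\<lambda>x. ract X x (star b))"
  by (simp add: is_adjoint_def lip_ract)

lemma norm_equiv:
  obtains c C where "c > 0" "C > 0" "\<And>x. c * nr x \<le> nl x" "\<And>x. nl x \<le> C * nr x"
  using bi unfolding bi_hilbertian_def by blast

lemma op_bound_right_of_left:
  assumes "op_bound (contragradient X) M T" "M \<ge> 0"
  obtains N where "N \<ge> 0" "op_bound X N T"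
proof -
  obtain c C where c: "c > 0" "C > 0" "\<And>x. c * nr x \<le> nl x" "\<And>x. nl x \<le> C * nr x"
    by (rule norm_equiv) blast
  have "op_bound X (M * C / c) T"
    unfolding op_bound_def
  proof
    fix x
    have "c * nr (T x) \<le> nl (T x)" by (rule c)
    also have "\<dots> \<le> M * nl x" using L.op_boundD[OF assms(1), of x] by simp
    also have "\<dots> \<le> M * (C * nr x)" by (intro mult_left_mono c assms)
    finally show "nr (T x) \<le> M * C / c * nr x" using c by (simp add: field_simps)
  qed
  then show ?thesis using that[of "M * C / c"] c assms by simp
qed

text \<open>Apply the row-column inequality on the left module to \<open>x \<mapsto> x b\<^sub>i\<close> with \<open>b\<^sub>i = (x\<^sub>i | y)\<close>:
  then \<open>\<Sum> x\<^sub>i b\<^sub>i = k y\<close> and \<open>\<Sum> b\<^sub>i\<^sup>* b\<^sub>i = (y | k y)\<close> for \<open>k = \<Sum> \<theta>\<^sub>x\<^sub>i\<^sub>,\<^sub>x\<^sub>i\<close>.\<close>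

lemma finite_rank_diag_bound:
  obtains C where "C > 0" "\<And>zs. op_bound X (C * norm (lip_sum X (diag zs))) (finite_rank X (diag zs))"
proof -
  obtain c C where c: "c > 0" "C > 0" "\<And>x. c * nr x \<le> nl x" "\<And>x. nl x \<le> C * nr x"
    by (rule norm_equiv) blast
  have "op_bound X (C / c^3 * norm (lip_sum X (diag zs))) (finite_rank X (diag zs))" for zs
    unfolding op_bound_def
  proof
    fix y
    define k where "k = finite_rank X (diag zs) y"
    define b where "b i = ip (zs ! i) y" for i
    define I where "I = {..<length zs}"
    define s where "s = (\<Sum>i\<in>I. star (b i) * b i)"
    have k_sum: "k = (\<Sum>i\<in>I. ract X (zs ! i) (b i))"
      by (simp add: k_def b_def I_def finite_rank_eq_sum theta_r_def diag_def)
    have s: "s = ip y k"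
      by (simp add: s_def k_sum ip_sum ip_simps b_def ip_star)
    have ract_sum: "(\<Sum>i\<in>I. ract X (ract X x (star (b i))) (b i)) = ract X x s" for x
      unfolding s_def by (induction I rule: infinite_finite_induct) (simp_all add: ract_simps)
    have "op_bound (contragradient X) (C / c * norm s) (\<lambda>x. \<Sum>i\<in>I. ract X (ract X x (star (b i))) (b i))"
      unfolding op_bound_def ract_sum
    proof
      fix x
      have "nl (ract X x s) \<le> C * (nr x * norm s)"
        using c(2) by (intro order_trans[OF c(4)] mult_left_mono nr_ract) simp
      also have "\<dots> = C * norm s * nr x" by simp
      also have "\<dots> \<le> C * norm s * (nl x / c)"
        using c(1,2) c(3)[of x] by (intro mult_left_mono) (simp_all add: field_simps)
      finally show "rnorm (contragradient X) (ract X x s) \<le> C / c * norm s * rnorm (contragradient X) x"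
        by (simp add: mult_ac)
    qed
    from L.row_column_cauchy_schwarz[where I=I and c="\<lambda>i x. ract X x (b i)"
        and c'="\<lambda>i x. ract X x (star (b i))" and y="\<lambda>i. zs ! i", OF is_adjoint_left_ract this]
    have "(nl k)\<^sup>2 \<le> C / c * norm s * norm (lip_sum X (diag zs))"
      using c(1,2) by (simp add: k_sum lip_sum_diag I_def)
    also have "\<dots> \<le> C / c * (nr y * nr k) * norm (lip_sum X (diag zs))"
      unfolding s using c(1,2) by (intro mult_right_mono mult_left_mono norm_ip_le) auto
    finally have le: "(nl k)\<^sup>2 \<le> C / c * (nr y * nr k) * norm (lip_sum X (diag zs))" .
    have "(c * nr k)\<^sup>2 \<le> (nl k)\<^sup>2"
      using c(1) by (intro power_mono c(3)) simp
    then have "c\<^sup>2 * (nr k * nr k) \<le> C / c * (nr y * nr k) * norm (lip_sum X (diag zs))"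
      using le by (simp add: power2_eq_square mult_ac)
    then have *: "nr k * nr k \<le> (C / c^3 * norm (lip_sum X (diag zs)) * nr y) * nr k"
      using c(1) by (simp add: field_simps power2_eq_square power3_eq_cube)
    have "nr k \<le> C / c^3 * norm (lip_sum X (diag zs)) * nr y"
    proof (cases "k = 0")
      case False
      then have "nr k > 0" using nr_ge_0[of k] nr_eq_0[of k] by linarith
      then show ?thesis using * by (rule mult_right_le_imp_le[rotated])
    qed (use c(1,2) in simp)
    then show "nr (finite_rank X (diag zs) y) \<le> C / c^3 * norm (lip_sum X (diag zs)) * nr y"
      by (simp add: k_def)
  qed
  moreover have "C / c^3 > 0" using c by simp
  ultimately show ?thesis using that by blast
qed

section \<open>From diagonal sums to a bound for \<open>lip_sum\<close> on all finite-rank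
  operators\<close>

lemma numerical_index_list:
  assumes "finite_right_numerical_index X"
  obtains l where "l > 0" "\<And>zs. norm (lip_sum X (diag zs)) \<le> l * op_norm_r X (finite_rank X (diag zs))"
proof -
  obtain l where l: "l > 0" "\<And>(n::nat) x. norm (\<Sum>i<n. lip X (x i) (x i))
      \<le> l * op_norm_r X (\<lambda>z. \<Sum>i<n. theta_r X (x i) (x i) z)"
    using assms unfolding finite_right_numerical_index_def by blast
  have "finite_rank X (diag zs) = (\<lambda>z. \<Sum>i<length zs. theta_r X (zs ! i) (zs ! i) z)" for zs
    by (simp add: finite_rank_eq_sum diag_def fun_eq_iff)
  then have "norm (lip_sum X (diag zs)) \<le> l * op_norm_r X (finite_rank X (diag zs))" for zs
    using l(2)[of "\<lambda>i. zs ! i" "length zs"] by (simp add: lip_sum_diag)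
  with l(1) show ?thesis using that by blast
qed

text \<open>A trace-like exchange: right multiplication is adjointable for the left inner product,
  so \<open>lip X x (\<theta>\<^sub>z\<^sub>,\<^sub>z y)\<close> equals
  \<open>lip X (\<theta>\<^sub>x\<^sub>,\<^sub>y z) z\<close>. A general sum with a unit inserted
  becomes a pairing of two families.\<close>

lemma lip_sum_insert_unit:
  "(\<Sum>(x, y)\<leftarrow>ps. lip X x (finite_rank X (diag zs) y)) = (\<Sum>z\<leftarrow>zs. lip X (finite_rank X ps z) z)"
proof -
  have 1: "lip X x (ract X z (ip z y)) = lip X (ract X x (ip y z)) z" for x y z
    by (simp add: lip_ract ip_star)
  have 2: "(\<Sum>(x, y)\<leftarrow>ps. lip X x (ract X z (ip z y))) = lip X (finite_rank X ps z) z" for z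
    by (induction ps) (auto simp: 1 lip_simps L.ip_zero(1)[simplified])
  show ?thesis
  proof (induction zs)
    case Nil
    then show ?case using L.ip_zero(2) by (induction ps) auto
  next
    case (Cons z zs)
    have "(\<Sum>(x, y)\<leftarrow>ps. lip X x (ract X z (ip z y) + finite_rank X (diag zs) y))
        = (\<Sum>(x, y)\<leftarrow>ps. lip X x (ract X z (ip z y))) + (\<Sum>(x, y)\<leftarrow>ps. lip X x (finite_rank X (diag zs) y))"
      by (induction ps) (auto simp: lip_simps)
    then show ?case by (simp add: 2 Cons)
  qed
qed

text \<open>The numerical index controls only diagonal lists. Insert an approximate unit
  \<open>u\<close>, the sum of \<open>\<theta>\<^sub>z\<^sub>,\<^sub>z\<close>, and apply
  Cauchy-Schwarz in the left module to the families \<open>K z\<close> and \<open>z\<close>, where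
  \<open>K\<close> is the operator of \<open>ps\<close>. Both factors are diagonal: they belong to
  \<open>K u\<close> followed by the adjoint of \<open>K\<close>, and to \<open>u\<close>. The
  constant \<open>l\<close> stays the same.\<close>

lemma lip_sum_bound:
  assumes "finite_right_numerical_index X"
  obtains l where "l > 0" "\<And>ps M. M \<ge> 0 \<Longrightarrow> op_bound X M (finite_rank X ps) \<Longrightarrow> norm (lip_sum X ps) \<le> l * M"
proof -
  obtain l where l: "l > 0" "\<And>zs. norm (lip_sum X (diag zs)) \<le> l * op_norm_r X (finite_rank X (diag zs))"
    by (rule numerical_index_list[OF assms]) blast
  obtain c C where c: "c > 0" "C > 0" "\<And>x. c * nr x \<le> nl x" "\<And>x. nl x \<le> C * nr x"
    by (rule norm_equiv) blast
  have l': "norm (lip_sum X (diag zs)) \<le> l * K" if "op_bound X K (finite_rank X (diag zs))" "K \<ge> 0" for zs K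
  proof -
    have "l * op_norm_r X (finite_rank X (diag zs)) \<le> l * K"
      using l(1) op_norm_le[OF that] by simp
    then show ?thesis using l(2)[of zs] by linarith
  qed
  have "norm (lip_sum X ps) \<le> l * M" if M: "M \<ge> 0" "op_bound X M (finite_rank X ps)" for ps M
  proof (rule field_le_epsilon)
    fix e :: real assume e: "e > 0"
    define Y where "Y = (\<Sum>(x, y)\<leftarrow>ps. nl x)"
    have Y: "Y \<ge> 0" unfolding Y_def by (rule sum_list_nonneg) (use L.nr_ge_0 in auto)
    define \<delta> where "\<delta> = e / ((1 + Y) * C)"
    have \<delta>: "\<delta> > 0" using e Y c(2) by (simp add: \<delta>_def)
    obtain u where u: "u \<in> approx_units (map snd ps) \<delta>" using approx_units_nonempty[OF \<delta>] by blast
    then obtain zs where zs: "u = finite_rank X (diag zs)" by (auto simp: approx_units_def)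
    have "norm (lip_sum X qs - (\<Sum>(x, y)\<leftarrow>qs. lip X x (u y))) \<le> (\<Sum>(x, y)\<leftarrow>qs. nl x) * (C * \<delta>)"
      if "set qs \<subseteq> set ps" for qs
      using that
    proof (induction qs)
      case (Cons p qs)
      obtain x y where p: "p = (x, y)" by fastforce
      have y: "nr (u y - y) < \<delta>" using Cons.prems p by (intro approx_unitsD(6)[OF u]) force
      have "norm (lip X x (y - u y)) \<le> nl x * nl (y - u y)"
        using L.norm_ip_le[of x "y - u y"] by simp
      also have "\<dots> \<le> nl x * (C * \<delta>)"
        using y c(2) L.nr_ge_0[of x] nr_diff_commute[of y "u y"]
        by (intro mult_left_mono order_trans[OF c(4)]) auto
      finally have 1: "norm (lip X x (y - u y)) \<le> nl x * (C * \<delta>)" .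
      have "lip_sum X (p # qs) - (\<Sum>(x, y)\<leftarrow>p # qs. lip X x (u y))
          = lip X x (y - u y) + (lip_sum X qs - (\<Sum>(x, y)\<leftarrow>qs. lip X x (u y)))"
        using L.ip_diff(2)[of x y "u y"] by (simp add: p)
      also have "norm \<dots> \<le> nl x * (C * \<delta>) + (\<Sum>(x, y)\<leftarrow>qs. nl x) * (C * \<delta>)"
        using Cons by (intro order_trans[OF norm_triangle_ineq] add_mono 1) auto
      finally show ?case by (simp add: p distrib_right)
    qed simp
    then have "norm (lip_sum X ps - (\<Sum>(x, y)\<leftarrow>ps. lip X x (u y))) \<le> Y * (C * \<delta>)"
      by (simp add: Y_def)
    also have "\<dots> \<le> (1 + Y) * (C * \<delta>)"
      using \<delta> c(2) by (intro mult_right_mono) auto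
    also have "\<dots> = e"
      using Y c(2) by (simp add: \<delta>_def)
    finally have 1: "norm (lip_sum X ps - (\<Sum>(x, y)\<leftarrow>ps. lip X x (u y))) \<le> e" .
    have eq: "(\<Sum>(x, y)\<leftarrow>ps. lip X x (u y)) = (\<Sum>i<length zs. lip X (finite_rank X ps (zs ! i)) (zs ! i))"
      unfolding zs lip_sum_insert_unit by (simp add: sum_list_sum_nth atLeast0LessThan)
    have "(norm (\<Sum>i<length zs. lip X (finite_rank X ps (zs ! i)) (zs ! i)))\<^sup>2
        \<le> norm (lip_sum X (diag (map (finite_rank X ps) zs))) * norm (lip_sum X (diag zs))"
      using L.cauchy_schwarz_family[of "\<lambda>i. finite_rank X ps (zs ! i)" "\<lambda>i. zs ! i" "{..<length zs}"]
      by (simp add: lip_sum_diag)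
    also have "\<dots> \<le> (l * (M * (1 * M))) * (l * 1)"
    proof (intro mult_mono l')
      show "op_bound X 1 (finite_rank X (diag zs))" using approx_unitsD(4)[OF u] by (simp add: zs)
      have "finite_rank X (diag (map (finite_rank X ps) zs)) = (\<lambda>z. finite_rank X ps (u (finite_rank X (map prod.swap ps) z)))"
        unfolding zs using finite_rank_diag_conj[OF is_adjoint_finite_rank[of ps], of zs] by (simp add: fun_eq_iff)
      then show "op_bound X (M * (1 * M)) (finite_rank X (diag (map (finite_rank X ps) zs)))"
        using op_bound_comp[OF M(2) op_bound_comp[OF approx_unitsD(4)[OF u] op_bound_is_adjoint[OF is_adjoint_finite_rank M(2)]] M(1)] by simp
    qed (use l(1) M in auto)
    also have "\<dots> = (l * M)\<^sup>2" by (simp add: power2_eq_square)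
    finally have "norm (\<Sum>(x, y)\<leftarrow>ps. lip X x (u y)) \<le> l * M"
      unfolding eq by (rule power2_le_imp_le) (use l(1) M in simp)
    with 1 show "norm (lip_sum X ps) \<le> l * M + e"
      using norm_triangle_ineq2[of "lip_sum X ps" "\<Sum>(x, y)\<leftarrow>ps. lip X x (u y)"] by linarith
  qed
  with l(1) show ?thesis using that by blast
qed

end

section \<open>The index map on compact operators and its uniqueness\<close>

locale finite_numerical_index = bihilbertian X
  for X :: "('a::cstar_algebra, 'b::cstar_algebra, 'x::ab_group_add) bimodule" +
  assumes fin: "finite_right_numerical_index X"
begin

text \<open>The index map as a graph closed under finite-rank approximation. Linearity is proved for
  the relation, before any function is chosen.\<close>

definition index_value :: "('x \<Rightarrow> 'x) \<Rightarrow> 'a \<Rightarrow> bool" where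
  "index_value T a \<longleftrightarrow> (\<forall>e>0. \<exists>ps. op_bound X e (\<lambda>z. T z - finite_rank X ps z) \<and> norm (a - lip_sum X ps) < e)"

lemma lip_sum_scale: "lip_sum X (map (\<lambda>(x, y). (scale X c x, y)) ps) = c *\<^sub>C lip_sum X ps"
  by (induction ps) (auto simp: lip_simps scaleC_add_right)

lemma finite_rank_scale: "finite_rank X (map (\<lambda>(x, y). (scale X c x, y)) ps) z = scale X c (finite_rank X ps z)"
  using nr_scale[of c 0] by (induction ps) (auto simp: ract_simps scale_simps)

lemma lip_sum_minus: "lip_sum X (map (\<lambda>(x, y). (- x, y)) ps) = - lip_sum X ps"
  using lip_sum_scale[of "- 1" ps] by (simp add: scale_minus_one scaleC_minus_left)

lemma finite_rank_minus: "finite_rank X (map (\<lambda>(x, y). (- x, y)) ps) z = - finite_rank X ps z"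
  using finite_rank_scale[of "- 1" ps z] by (simp add: scale_minus_one)

text \<open>Contains both uniqueness of the value (take \<open>S = T\<close> and
  \<open>M = 0\<close>) and boundedness of the index map (take \<open>S = 0\<close>).\<close>

lemma index_value_diff:
  obtains l where "l > 0"
    "\<And>S T a b M. index_value T a \<Longrightarrow> index_value S b \<Longrightarrow> op_bound X M (\<lambda>z. T z - S z) \<Longrightarrow> M \<ge> 0 \<Longrightarrow> norm (a - b) \<le> l * M"
proof -
  obtain l where l: "l > 0" "\<And>ps M. M \<ge> 0 \<Longrightarrow> op_bound X M (finite_rank X ps) \<Longrightarrow> norm (lip_sum X ps) \<le> l * M"
    by (rule lip_sum_bound[OF fin]) blast
  have "norm (a - b) \<le> l * M"
    if T: "index_value T a" and S: "index_value S b" and M: "op_bound X M (\<lambda>z. T z - S z)" "M \<ge> 0" for S T a b M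
  proof (rule field_le_epsilon)
    fix e :: real assume e: "e > 0"
    define d where "d = e / (2 * (1 + l))"
    have d: "d > 0" using e l(1) by (simp add: d_def)
    obtain ps where ps: "op_bound X d (\<lambda>z. T z - finite_rank X ps z)" "norm (a - lip_sum X ps) < d"
      using T d unfolding index_value_def by blast
    obtain qs where qs: "op_bound X d (\<lambda>z. S z - finite_rank X qs z)" "norm (b - lip_sum X qs) < d"
      using S d unfolding index_value_def by blast
    define rs where "rs = ps @ map (\<lambda>(x, y). (- x, y)) qs"
    have rs: "lip_sum X rs = lip_sum X ps - lip_sum X qs" "finite_rank X rs z = finite_rank X ps z - finite_rank X qs z" for z
      by (simp_all add: rs_def lip_sum_minus finite_rank_minus)
    have "op_bound X (M + d + d) (\<lambda>z. (T z - S z) - (T z - finite_rank X ps z) + (S z - finite_rank X qs z))"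
      by (intro op_bound_add op_bound_diff M ps qs)
    then have "norm (lip_sum X rs) \<le> l * (M + d + d)"
      using M(2) d by (intro l(2)) (simp_all add: rs(2)[abs_def])
    moreover have "norm (a - b) \<le> norm (a - lip_sum X ps) + norm (lip_sum X rs) + norm (b - lip_sum X qs)"
      using norm_triangle_ineq4[of "(a - lip_sum X ps) + lip_sum X rs" "b - lip_sum X qs"]
        norm_triangle_ineq[of "a - lip_sum X ps" "lip_sum X rs"] by (simp add: rs)
    ultimately have "norm (a - b) \<le> l * M + 2 * d * (1 + l)"
      using ps(2) qs(2) by (simp add: algebra_simps)
    also have "\<dots> = l * M + e" using l(1) by (simp add: d_def field_simps)
    finally show "norm (a - b) \<le> l * M + e" .
  qed
  with l(1) show ?thesis using that by blast
qed

lemma index_value_exists: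
  assumes "T \<in> compact_r X"
  shows "\<exists>a. index_value T a"
proof -
  obtain l where l: "l > 0" "\<And>ps M. M \<ge> 0 \<Longrightarrow> op_bound X M (finite_rank X ps) \<Longrightarrow> norm (lip_sum X ps) \<le> l * M"
    by (rule lip_sum_bound[OF fin]) blast
  have "\<forall>n. \<exists>ps. op_bound X (1 / (real n + 1)) (\<lambda>z. T z - finite_rank X ps z)"
  proof
    fix n
    have "1 / (real n + 1) > 0" by simp
    then show "\<exists>ps. op_bound X (1 / (real n + 1)) (\<lambda>z. T z - finite_rank X ps z)"
      using assms compact_r_iff by blast
  qed
  then obtain ps where ps: "\<And>n. op_bound X (1 / (real n + 1)) (\<lambda>z. T z - finite_rank X (ps n) z)"
    by (auto simp: choice_iff)
  have le: "norm (lip_sum X (ps m) - lip_sum X (ps n)) \<le> l * (1 / (real m + 1) + 1 / (real n + 1))" for m n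
  proof -
    define rs where "rs = ps m @ map (\<lambda>(x, y). (- x, y)) (ps n)"
    have rs: "lip_sum X rs = lip_sum X (ps m) - lip_sum X (ps n)" "finite_rank X rs z = finite_rank X (ps m) z - finite_rank X (ps n) z" for z
      by (simp_all add: rs_def lip_sum_minus finite_rank_minus)
    have "op_bound X (1 / (real n + 1) + 1 / (real m + 1)) (\<lambda>z. (T z - finite_rank X (ps n) z) - (T z - finite_rank X (ps m) z))"
      by (intro op_bound_diff ps)
    then have "norm (lip_sum X rs) \<le> l * (1 / (real m + 1) + 1 / (real n + 1))"
      by (intro l(2)) (simp_all add: rs(2)[abs_def] add.commute)
    then show ?thesis by (simp add: rs)
  qed
  have lim: "(\<lambda>n. 1 / (real n + 1)) \<longlonglongrightarrow> 0"
    using LIMSEQ_inverse_real_of_nat by (simp add: inverse_eq_divide add.commute)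
  have "Cauchy (\<lambda>n. lip_sum X (ps n))"
    unfolding Cauchy_def
  proof (intro allI impI)
    fix e :: real assume e: "e > 0"
    then obtain N where N: "\<And>n. n \<ge> N \<Longrightarrow> 1 / (real n + 1) < e / (2 * l)"
      using order_tendstoD(2)[OF lim, of "e / (2 * l)"] l(1) by (auto simp: eventually_sequentially)
    have "dist (lip_sum X (ps m)) (lip_sum X (ps n)) < e" if "m \<ge> N" "n \<ge> N" for m n
    proof -
      have "l * (1 / (real m + 1) + 1 / (real n + 1)) < l * (e / (2 * l) + e / (2 * l))"
        using N[OF that(1)] N[OF that(2)] l(1) by (intro mult_strict_left_mono add_strict_mono) auto
      also have "\<dots> = e" using l(1) by simp
      finally show ?thesis using le[of m n] by (simp add: dist_norm)
    qed
    then show "\<exists>M. \<forall>m\<ge>M. \<forall>n\<ge>M. dist (lip_sum X (ps m)) (lip_sum X (ps n)) < e" by blast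
  qed
  then obtain a where a: "(\<lambda>n. lip_sum X (ps n)) \<longlonglongrightarrow> a"
    by (auto simp: Cauchy_convergent_iff convergent_def)
  have "index_value T a"
    unfolding index_value_def
  proof (intro allI impI)
    fix e :: real assume e: "e > 0"
    have "eventually (\<lambda>n. dist (lip_sum X (ps n)) a < e \<and> 1 / (real n + 1) < e) sequentially"
      using tendstoD[OF a e] order_tendstoD(2)[OF lim e] by eventually_elim simp
    then obtain n where "dist (lip_sum X (ps n)) a < e" "1 / (real n + 1) < e"
      by (auto simp: eventually_sequentially)
    then show "\<exists>ps. op_bound X e (\<lambda>z. T z - finite_rank X ps z) \<and> norm (a - lip_sum X ps) < e"
      using op_bound_mono[OF ps[of n], of e] by (auto simp: dist_norm norm_minus_commute intro!: exI[of _ "ps n"])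
  qed
  then show ?thesis by blast
qed

lemma index_value_finite_rank: "index_value (finite_rank X ps) (lip_sum X ps)"
  unfolding index_value_def by (intro allI impI exI[of _ ps]) (auto simp: op_bound_def)

lemma index_value_add:
  assumes "index_value S a" "index_value T b"
  shows "index_value (\<lambda>z. S z + T z) (a + b)"
  unfolding index_value_def
proof (intro allI impI)
  fix e :: real assume "e > 0"
  then have e: "e/2 > 0" by simp
  obtain ps where ps: "op_bound X (e/2) (\<lambda>z. S z - finite_rank X ps z)" "norm (a - lip_sum X ps) < e/2"
    using assms(1) e unfolding index_value_def by blast
  obtain qs where qs: "op_bound X (e/2) (\<lambda>z. T z - finite_rank X qs z)" "norm (b - lip_sum X qs) < e/2"
    using assms(2) e unfolding index_value_def by blast
  have "op_bound X e (\<lambda>z. (S z + T z) - finite_rank X (ps @ qs) z)"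
    using op_bound_add[OF ps(1) qs(1)] by (simp add: algebra_simps)
  moreover have "norm (a + b - lip_sum X (ps @ qs)) < e"
    using norm_triangle_ineq[of "a - lip_sum X ps" "b - lip_sum X qs"] ps(2) qs(2) by (simp add: algebra_simps)
  ultimately show "\<exists>ps. op_bound X e (\<lambda>z. S z + T z - finite_rank X ps z) \<and> norm (a + b - lip_sum X ps) < e"
    by blast
qed

lemma index_value_scale:
  assumes "index_value T a"
  shows "index_value (\<lambda>z. scale X c (T z)) (c *\<^sub>C a)"
  unfolding index_value_def
proof (intro allI impI)
  fix e :: real assume "e > 0"
  then have e: "e / (1 + cmod c) > 0" by (simp add: add_pos_nonneg)
  have c: "1 + cmod c > 0" by (simp add: add_pos_nonneg)
  then have le: "cmod c * (e / (1 + cmod c)) < e" using \<open>e > 0\<close> by (simp add: field_simps)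
  obtain ps where ps: "op_bound X (e / (1 + cmod c)) (\<lambda>z. T z - finite_rank X ps z)" "norm (a - lip_sum X ps) < e / (1 + cmod c)"
    using assms(1) e unfolding index_value_def by blast
  define qs where "qs = map (\<lambda>(x, y). (scale X c x, y)) ps"
  have "op_bound X (cmod c * (e / (1 + cmod c))) (\<lambda>z. scale X c (T z - finite_rank X ps z))"
    by (rule op_bound_comp[OF _ ps(1)]) (simp_all add: op_bound_def nr_scale)
  then have "op_bound X e (\<lambda>z. scale X c (T z) - finite_rank X qs z)"
    using op_bound_mono less_imp_le[OF le] by (simp add: qs_def finite_rank_scale is_adjoint_linear(2)[OF is_adjoint_scale[OF is_adjoint_id]])
  moreover have "norm (c *\<^sub>C a - lip_sum X qs) = cmod c * norm (a - lip_sum X ps)"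
    by (simp add: qs_def lip_sum_scale norm_scaleC flip: scaleC_diff_right)
  moreover have "cmod c * norm (a - lip_sum X ps) < e"
    using mult_left_mono[OF less_imp_le[OF ps(2)], of "cmod c"] le by simp
  ultimately show "\<exists>ps. op_bound X e (\<lambda>z. scale X c (T z) - finite_rank X ps z) \<and> norm (c *\<^sub>C a - lip_sum X ps) < e"
    by auto
qed

lemma compact_alg_sel [simp]:
  "elems (compact_alg_r X) = compact_r X" "vadd (compact_alg_r X) S T = (\<lambda>z. S z + T z)"
  "vscale (compact_alg_r X) c T = (\<lambda>z. scale X c (T z))" "vnorm (compact_alg_r X) = op_norm_r X"
  "vmult (compact_alg_r X) S T = (\<lambda>z. S (T z))"
  by (simp_all add: compact_alg_r_def comp_def)

lemma index_map_exists:
  "\<exists>F. F \<in> continuous_linear_maps (compact_alg_r X) cstar_alg \<and> (\<forall>x y. F (theta_r X x y) = lip X x y)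
    \<and> (\<forall>T\<in>compact_r X. index_value T (F T))"
proof -
  obtain l where l: "l > 0"
    "\<And>S T a b M. index_value T a \<Longrightarrow> index_value S b \<Longrightarrow> op_bound X M (\<lambda>z. T z - S z) \<Longrightarrow> M \<ge> 0 \<Longrightarrow> norm (a - b) \<le> l * M"
    by (rule index_value_diff) blast
  have uniq: "a = b" if "index_value T a" "index_value T b" for T a b
    using l(2)[OF that, of 0] by (simp add: op_bound_def)
  \<comment> \<open>The restriction matters: \<open>linear_maps\<close> consists of extensional
    functions, and otherwise the \<open>THE\<close> in \<open>index_map_r\<close> would not single
    out one map.\<close>
  define F where "F = (\<lambda>T\<in>compact_r X. SOME a. index_value T a)"
  have F: "index_value T (F T)" if "T \<in> compact_r X" for T
    using index_value_exists[OF that] that by (simp add: F_def someI_ex)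
  have Feq: "F T = a" if "T \<in> compact_r X" "index_value T a" for T a
    using uniq F that by blast
  have "F \<in> continuous_linear_maps (compact_alg_r X) cstar_alg"
    unfolding continuous_linear_maps_def linear_maps_def
  proof (intro CollectI conjI ballI allI exI[of _ l])
    show "F \<in> elems (compact_alg_r X) \<rightarrow>\<^sub>E elems cstar_alg"
      by (simp add: F_def cstar_alg_def)
    fix S T c assume ST: "S \<in> elems (compact_alg_r X)" "T \<in> elems (compact_alg_r X)"
    show "F (vadd (compact_alg_r X) S T) = vadd cstar_alg (F S) (F T)"
      using ST by (simp add: cstar_alg_def Feq compact_add index_value_add F)
  next
    fix T c assume T: "T \<in> elems (compact_alg_r X)"
    show "F (vscale (compact_alg_r X) c T) = vscale cstar_alg c (F T)"
      using T by (simp add: cstar_alg_def Feq compact_scale index_value_scale F)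
  next
    fix T assume T: "T \<in> elems (compact_alg_r X)"
    then obtain S where S: "is_adjoint X T S" using compact_r_is_adjoint by auto
    have "index_value (\<lambda>z. 0) 0" using index_value_finite_rank[of "[]"] by (simp add: finite_rank_def)
    then show "vnorm cstar_alg (F T) \<le> l * vnorm (compact_alg_r X) T"
      using T l(2)[OF F, of T "\<lambda>z. 0" 0 "op_norm_r X T"] op_norm[OF S] op_norm_nonneg[OF S]
      by (simp add: cstar_alg_def)
  qed
  moreover have "F (theta_r X x y) = lip X x y" for x y
  proof -
    have "theta_r X x y = finite_rank X [(x, y)]" by (simp add: finite_rank_def fun_eq_iff)
    then show ?thesis
      using Feq[OF compact_finite_rank index_value_finite_rank, of "[(x, y)]"] by simp
  qed
  ultimately show ?thesis using F by blast
qed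

lemma continuous_linear_map_add:
  assumes "F \<in> continuous_linear_maps (compact_alg_r X) cstar_alg" "S \<in> compact_r X" "T \<in> compact_r X"
  shows "F (\<lambda>z. S z + T z) = F S + F T"
  using assms by (auto simp: continuous_linear_maps_def linear_maps_def cstar_alg_def)

lemma continuous_linear_map_finite_rank:
  assumes F: "F \<in> continuous_linear_maps (compact_alg_r X) cstar_alg" "\<And>x y. F (theta_r X x y) = lip X x y"
  shows "F (finite_rank X ps) = lip_sum X ps"
proof (induction ps)
  case Nil
  show ?case
    using continuous_linear_map_add[OF F(1) compact_zero compact_zero] by (simp add: finite_rank_def)
next
  case (Cons p ps)
  obtain x y where p: "p = (x, y)" by fastforce
  have "theta_r X x y = finite_rank X [(x, y)]" by (simp add: finite_rank_def fun_eq_iff)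
  then have "theta_r X x y \<in> compact_r X" using compact_finite_rank by metis
  then have "F (\<lambda>z. theta_r X x y z + finite_rank X ps z) = F (theta_r X x y) + F (finite_rank X ps)"
    by (intro continuous_linear_map_add[OF F(1)] compact_finite_rank)
  moreover have "finite_rank X (p # ps) = (\<lambda>z. theta_r X x y z + finite_rank X ps z)"
    by (simp add: p theta_r_def fun_eq_iff)
  ultimately show ?case by (simp add: p F(2) Cons)
qed

lemma index_map_unique:
  assumes F: "F \<in> continuous_linear_maps (compact_alg_r X) cstar_alg" "\<And>x y. F (theta_r X x y) = lip X x y"
    and G: "G \<in> continuous_linear_maps (compact_alg_r X) cstar_alg" "\<And>x y. G (theta_r X x y) = lip X x y"
  shows "F = G"
proof (rule PiE_ext)
  show "F \<in> compact_r X \<rightarrow>\<^sub>E UNIV" "G \<in> compact_r X \<rightarrow>\<^sub>E UNIV"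
    using F(1) G(1) by (auto simp: continuous_linear_maps_def linear_maps_def cstar_alg_def)
  fix T assume T: "T \<in> compact_r X"
  have *: "\<exists>C\<ge>0. \<forall>e>0. \<forall>ps. op_bound X e (\<lambda>z. T z - finite_rank X ps z) \<longrightarrow> norm (H T - lip_sum X ps) \<le> C * e"
    if H: "H \<in> continuous_linear_maps (compact_alg_r X) cstar_alg" "\<And>x y. H (theta_r X x y) = lip X x y" for H
  proof -
    obtain C where C: "\<And>S. S \<in> compact_r X \<Longrightarrow> norm (H S) \<le> C * op_norm_r X S"
      using H(1) by (auto simp: continuous_linear_maps_def cstar_alg_def)
    have "norm (H T - lip_sum X ps) \<le> \<bar>C\<bar> * e" if "e > 0" "op_bound X e (\<lambda>z. T z - finite_rank X ps z)" for e ps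
    proof -
      have D: "(\<lambda>z. T z - finite_rank X ps z) \<in> compact_r X" by (intro compact_diff T compact_finite_rank)
      have "H (\<lambda>z. (T z - finite_rank X ps z) + finite_rank X ps z) = H (\<lambda>z. T z - finite_rank X ps z) + H (finite_rank X ps)"
        by (rule continuous_linear_map_add[OF H(1) D compact_finite_rank])
      then have "H T - lip_sum X ps = H (\<lambda>z. T z - finite_rank X ps z)"
        by (simp add: continuous_linear_map_finite_rank[OF H])
      also have "norm \<dots> \<le> C * op_norm_r X (\<lambda>z. T z - finite_rank X ps z)" by (rule C[OF D])
      also have "\<dots> \<le> \<bar>C\<bar> * op_norm_r X (\<lambda>z. T z - finite_rank X ps z)"
        using compact_r_is_adjoint[OF D] op_norm_nonneg by (metis abs_ge_self mult_right_mono)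
      also have "\<dots> \<le> \<bar>C\<bar> * e"
        using op_norm_le[OF that(2)] that(1) by (intro mult_left_mono) auto
      finally show ?thesis .
    qed
    then show ?thesis by (intro exI[of _ "\<bar>C\<bar>"]) auto
  qed
  obtain C where C: "C \<ge> 0" "\<And>e ps. e > 0 \<Longrightarrow> op_bound X e (\<lambda>z. T z - finite_rank X ps z) \<Longrightarrow> norm (F T - lip_sum X ps) \<le> C * e"
    using *[OF F] by blast
  obtain D where D: "D \<ge> 0" "\<And>e ps. e > 0 \<Longrightarrow> op_bound X e (\<lambda>z. T z - finite_rank X ps z) \<Longrightarrow> norm (G T - lip_sum X ps) \<le> D * e"
    using *[OF G] by blast
  have "norm (F T - G T) \<le> 0"
  proof (rule field_le_epsilon)
    fix e :: real assume e: "e > 0"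
    define d where "d = e / (1 + C + D)"
    have d: "d > 0" using e C(1) D(1) by (simp add: d_def)
    obtain ps where ps: "op_bound X d (\<lambda>z. T z - finite_rank X ps z)" using compact_r_approx[OF T d] .
    have "norm (F T - G T) \<le> C * d + D * d"
      using norm_triangle_ineq4[of "F T - lip_sum X ps" "G T - lip_sum X ps"] C(2)[OF d ps] D(2)[OF d ps] by simp
    also have "\<dots> \<le> (1 + C + D) * d" using d by (simp add: distrib_right)
    also have "\<dots> = e" using C(1) D(1) by (simp add: d_def)
    finally show "norm (F T - G T) \<le> 0 + e" by simp
  qed
  then show "F T = G T" by simp
qed

abbreviation "F \<equiv> index_map_r X"

lemma index_map_spec:
  "F \<in> continuous_linear_maps (compact_alg_r X) cstar_alg \<and> (\<forall>x y. F (theta_r X x y) = lip X x y)"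
  unfolding index_map_r_def
proof (rule theI'[of "\<lambda>F. F \<in> continuous_linear_maps (compact_alg_r X) cstar_alg
    \<and> (\<forall>x y. F (theta_r X x y) = lip X x y)"])
  show "\<exists>!F. F \<in> continuous_linear_maps (compact_alg_r X) cstar_alg \<and> (\<forall>x y. F (theta_r X x y) = lip X x y)"
    using index_map_exists index_map_unique by (intro ex_ex1I) blast+
qed

lemma F_finite_rank: "F (finite_rank X ps) = lip_sum X ps"
  using index_map_spec continuous_linear_map_finite_rank by blast

lemma F_add: "S \<in> compact_r X \<Longrightarrow> T \<in> compact_r X \<Longrightarrow> F (\<lambda>z. S z + T z) = F S + F T"
  and F_scale: "T \<in> compact_r X \<Longrightarrow> F (\<lambda>z. scale X c (T z)) = c *\<^sub>C F T"
  using index_map_spec by (auto simp: continuous_linear_maps_def linear_maps_def cstar_alg_def)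

lemma F_diff:
  assumes "S \<in> compact_r X" "T \<in> compact_r X"
  shows "F (\<lambda>z. S z - T z) = F S - F T"
  using F_add[OF compact_diff[OF assms] assms(2)] by simp

lemma F_bound:
  obtains l where "l > 0" "\<And>T M. T \<in> compact_r X \<Longrightarrow> op_bound X M T \<Longrightarrow> M \<ge> 0 \<Longrightarrow> norm (F T) \<le> l * M"
proof -
  obtain C where C: "\<And>T. T \<in> compact_r X \<Longrightarrow> norm (F T) \<le> C * op_norm_r X T"
    using index_map_spec by (auto simp: continuous_linear_maps_def cstar_alg_def)
  have "norm (F T) \<le> (\<bar>C\<bar> + 1) * M" if T: "T \<in> compact_r X" "op_bound X M T" "M \<ge> 0" for T M
  proof -
    have "op_norm_r X T \<ge> 0" using compact_r_is_adjoint[OF T(1)] op_norm_nonneg by metis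
    then have "C * op_norm_r X T \<le> (\<bar>C\<bar> + 1) * op_norm_r X T"
      by (intro mult_right_mono) auto
    also have "\<dots> \<le> (\<bar>C\<bar> + 1) * M"
      using op_norm_le[OF T(2,3)] by (intro mult_left_mono) auto
    finally show ?thesis using C[OF T(1)] by linarith
  qed
  then show ?thesis using that[of "\<bar>C\<bar> + 1"] by simp
qed

lemma is_adjoint_lact': "is_adjoint X (lact X (star a)) (lact X a)"
  by (rule is_adjoint_sym[OF is_adjoint_lact])

lemma F_lact:
  assumes T: "T \<in> compact_r X"
  shows "F (\<lambda>z. lact X a (T (lact X (star a) z))) = a * F T * star a"
proof -
  define W where "W T = (\<lambda>z. lact X a (T (lact X (star a) z)))" for T
  have WK: "W T \<in> compact_r X" if "T \<in> compact_r X" for T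
    unfolding W_def by (rule compact_comp[OF that is_adjoint_lact is_adjoint_lact'])
  have Wfr: "F (W (finite_rank X ps)) = a * F (finite_rank X ps) * star a" for ps
  proof -
    have "W (finite_rank X ps) = finite_rank X (map (\<lambda>(x, y). (lact X a x, lact X a y)) ps)"
      unfolding W_def using finite_rank_conj[OF is_adjoint_lact is_adjoint_lact'] by (simp add: fun_eq_iff)
    moreover have "lip_sum X (map (\<lambda>(x, y). (lact X a x, lact X a y)) ps) = a * lip_sum X ps * star a"
      by (induction ps) (auto simp: lip_simps algebra_simps)
    ultimately show ?thesis by (simp add: F_finite_rank)
  qed
  obtain l where l: "l > 0" "\<And>T M. T \<in> compact_r X \<Longrightarrow> op_bound X M T \<Longrightarrow> M \<ge> 0 \<Longrightarrow> norm (F T) \<le> l * M"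
    by (rule F_bound) blast
  obtain M where M: "M > 0" "op_bound X M (lact X a)" using is_adjoint_bounded[OF is_adjoint_lact] .
  note M' = op_bound_is_adjoint[OF is_adjoint_lact M(2)]
  have "norm (F (W T) - a * F T * star a) \<le> 0"
  proof (rule field_le_epsilon)
    fix e :: real assume e: "e > 0"
    define B where "B = l * (M * M) + norm a * l * norm a + 1"
    have B: "B > 0" unfolding B_def using l(1) M(1) by (intro add_nonneg_pos add_nonneg_nonneg mult_nonneg_nonneg) auto
    define d where "d = e / B"
    have d: "d > 0" using e B by (simp add: d_def)
    obtain ps where ps: "op_bound X d (\<lambda>z. T z - finite_rank X ps z)" using compact_r_approx[OF T d] .
    define D where "D = (\<lambda>z. T z - finite_rank X ps z)"
    have D: "D \<in> compact_r X" unfolding D_def by (intro compact_diff T compact_finite_rank)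
    have FT: "F D = F T - F (finite_rank X ps)" unfolding D_def by (rule F_diff[OF T compact_finite_rank])
    have "W D = (\<lambda>z. W T z - W (finite_rank X ps) z)"
      by (simp add: W_def D_def fun_eq_iff is_adjoint_linear[OF is_adjoint_lact])
    then have FW: "F (W D) = F (W T) - F (W (finite_rank X ps))"
      by (simp add: F_diff WK T compact_finite_rank)
    have "op_bound X (M * (d * M)) (W D)"
      unfolding W_def using M d ps[folded D_def] by (intro op_bound_comp M') auto
    then have 1: "norm (F (W D)) \<le> l * (M * (d * M))"
      using l(2)[OF WK[OF D]] M d by simp
    have "norm (a * F D * star a) \<le> norm a * norm (F D) * norm a"
      using norm_mult_ineq[of "a * F D" "star a"] mult_right_mono[OF norm_mult_ineq[of a "F D"], of "norm a"] by simp
    also have "\<dots> \<le> norm a * (l * d) * norm a"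
      using l(2)[OF D ps[folded D_def]] d by (intro mult_left_mono mult_right_mono) auto
    finally have 2: "norm (a * F D * star a) \<le> norm a * (l * d) * norm a" .
    have "F (W T) - a * F T * star a = F (W D) - a * F D * star a"
      unfolding FT FW Wfr by (simp add: algebra_simps)
    then have "norm (F (W T) - a * F T * star a) \<le> l * (M * (d * M)) + norm a * (l * d) * norm a"
      using norm_triangle_ineq4[of "F (W D)" "a * F D * star a"] 1 2 by simp
    also have "\<dots> = (B - 1) * d" by (simp add: B_def algebra_simps)
    also have "\<dots> \<le> B * d" using d by simp
    also have "\<dots> = e" using B by (simp add: d_def)
    finally show "norm (F (W T) - a * F T * star a) \<le> 0 + e" by simp
  qed
  then show ?thesis by (simp add: W_def)
qed

subsection \<open>A Pimsner-Popa inequality\<close>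

text \<open>The closed cone generated by the \<open>\<theta>\<^sub>z\<^sub>,\<^sub>z\<close>, a
  concrete stand-in for the positive cone of the compact operators. The lower bound for the index
  map passes to it by continuity, and \<open>positive_compacts_of_op_positive\<close> supplies its
  members.\<close>

definition positive_compacts :: "('x \<Rightarrow> 'x) set" where
  "positive_compacts = {T \<in> compact_r X. \<forall>e>0. \<exists>zs. op_bound X e (\<lambda>z. T z - finite_rank X (diag zs) z)}"

lemma positive_compacts_bound:
  obtains C where "C > 0" "\<And>T. T \<in> positive_compacts \<Longrightarrow> op_bound X (C * norm (F T)) T"
proof -
  obtain C where C: "C > 0" "\<And>zs. op_bound X (C * norm (lip_sum X (diag zs))) (finite_rank X (diag zs))"
    by (rule finite_rank_diag_bound) blast
  obtain l where l: "l > 0" "\<And>T M. T \<in> compact_r X \<Longrightarrow> op_bound X M T \<Longrightarrow> M \<ge> 0 \<Longrightarrow> norm (F T) \<le> l * M"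
    by (rule F_bound) blast
  have "op_bound X (C * norm (F T)) T" if T: "T \<in> positive_compacts" for T
    unfolding op_bound_def
  proof (rule allI, rule field_le_epsilon)
    fix x and e :: real assume e: "e > 0"
    have TK: "T \<in> compact_r X" using T by (simp add: positive_compacts_def)
    define d where "d = e / ((1 + C * l) * (1 + nr x))"
    have Cl: "1 + C * l > 0" "1 + nr x > 0" using C(1) l(1) by (simp_all add: add_pos_nonneg)
    then have d: "d > 0" using e by (simp add: d_def)
    then obtain zs where zs: "op_bound X d (\<lambda>z. T z - finite_rank X (diag zs) z)" using T by (auto simp: positive_compacts_def)
    have "norm (F (\<lambda>z. T z - finite_rank X (diag zs) z)) \<le> l * d"
      using d by (intro l(2) compact_diff TK compact_finite_rank zs) auto
    then have "norm (F T - lip_sum X (diag zs)) \<le> l * d"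
      by (simp add: F_diff TK compact_finite_rank F_finite_rank)
    then have L: "norm (lip_sum X (diag zs)) \<le> norm (F T) + l * d"
      using norm_triangle_ineq2[of "lip_sum X (diag zs)" "F T"] by (simp add: norm_minus_commute)
    have "nr (T x) \<le> d * nr x + C * norm (lip_sum X (diag zs)) * nr x"
      using nr_triangle[of "T x - finite_rank X (diag zs) x" "finite_rank X (diag zs) x"] op_boundD[OF zs, of x] op_boundD[OF C(2), of zs x]
      by simp
    also have "\<dots> \<le> d * nr x + C * (norm (F T) + l * d) * nr x"
      using C(1) L by (intro add_left_mono mult_right_mono mult_left_mono) auto
    also have "\<dots> = C * norm (F T) * nr x + d * (1 + C * l) * nr x" by (simp add: algebra_simps)
    also have "\<dots> \<le> C * norm (F T) * nr x + d * (1 + C * l) * (1 + nr x)"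
      using d Cl by (intro add_left_mono mult_left_mono) auto
    also have "\<dots> = C * norm (F T) * nr x + e" using Cl by (simp add: d_def)
    finally show "nr (T x) \<le> C * norm (F T) * nr x + e" .
  qed
  with C(1) show ?thesis using that by blast
qed

lemma positive_compacts_limit:
  assumes T: "T \<in> compact_r X" and lim: "\<And>e. e > 0 \<Longrightarrow> \<exists>S\<in>positive_compacts. op_bound X e (\<lambda>z. T z - S z)"
  shows "T \<in> positive_compacts"
  unfolding positive_compacts_def
proof (intro CollectI conjI T allI impI)
  fix e :: real assume "e > 0"
  then have e: "e/2 > 0" by simp
  obtain S where S: "S \<in> positive_compacts" "op_bound X (e/2) (\<lambda>z. T z - S z)" using lim[OF e] by blast
  obtain zs where "op_bound X (e/2) (\<lambda>z. S z - finite_rank X (diag zs) z)" using S(1) e unfolding positive_compacts_def by blast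
  from op_bound_add[OF S(2) this] show "\<exists>zs. op_bound X e (\<lambda>z. T z - finite_rank X (diag zs) z)" by auto
qed

lemma positive_compacts_finite_rank: "finite_rank X (diag zs) \<in> positive_compacts"
  unfolding positive_compacts_def by (auto simp: compact_finite_rank op_bound_def intro!: exI[of _ zs])

lemma positive_compacts_add:
  assumes "S \<in> positive_compacts" "T \<in> positive_compacts"
  shows "(\<lambda>z. S z + T z) \<in> positive_compacts"
  unfolding positive_compacts_def
proof (intro CollectI conjI allI impI)
  show "(\<lambda>z. S z + T z) \<in> compact_r X" using assms by (simp add: positive_compacts_def compact_add)
  fix e :: real assume "e > 0"
  then have e: "e/2 > 0" by simp
  obtain ys zs where "op_bound X (e/2) (\<lambda>z. S z - finite_rank X (diag ys) z)" "op_bound X (e/2) (\<lambda>z. T z - finite_rank X (diag zs) z)"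
    using assms e unfolding positive_compacts_def by blast
  from op_bound_add[OF this] have "op_bound X e (\<lambda>z. S z + T z - finite_rank X (diag (ys @ zs)) z)"
    by (simp add: algebra_simps)
  then show "\<exists>zs. op_bound X e (\<lambda>z. S z + T z - finite_rank X (diag zs) z)" by blast
qed

lemma positive_compacts_sum: "(\<And>i. i \<in> I \<Longrightarrow> T i \<in> positive_compacts) \<Longrightarrow> (\<lambda>z. \<Sum>i\<in>I. T i z) \<in> positive_compacts"
proof (induction I rule: infinite_finite_induct)
  case (insert i I)
  then show ?case by (simp add: positive_compacts_add)
qed (use positive_compacts_finite_rank[of "[]"] in \<open>simp_all add: finite_rank_def\<close>)

lemma positive_compacts_conj:
  assumes T: "T \<in> positive_compacts" and q: "is_adjoint X q q'"
  shows "(\<lambda>z. q (T (q' z))) \<in> positive_compacts"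
  unfolding positive_compacts_def
proof (intro CollectI conjI allI impI)
  show "(\<lambda>z. q (T (q' z))) \<in> compact_r X"
    using T compact_comp[OF _ q is_adjoint_sym[OF q]] by (simp add: positive_compacts_def)
  fix e :: real assume e: "e > 0"
  obtain M where M: "M > 0" "op_bound X M q" using is_adjoint_bounded[OF q] .
  have "e / (M * M) > 0" using e M by simp
  then obtain zs where zs: "op_bound X (e / (M * M)) (\<lambda>z. T z - finite_rank X (diag zs) z)"
    using T unfolding positive_compacts_def by blast
  have "op_bound X (M * (e / (M * M) * M)) (\<lambda>z. q (T (q' z) - finite_rank X (diag zs) (q' z)))"
    using e M by (intro op_bound_comp[OF M(2) op_bound_comp[OF zs op_bound_is_adjoint[OF q M(2)]]]) auto
  then have "op_bound X e (\<lambda>z. q (T (q' z)) - finite_rank X (diag (map q zs)) z)"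
    using M by (simp add: is_adjoint_linear[OF q] finite_rank_diag_conj[OF q])
  then show "\<exists>zs. op_bound X e (\<lambda>z. q (T (q' z)) - finite_rank X (diag zs) z)" by blast
qed

text \<open>Insert an approximate unit: \<open>k u k\<close> is close to the square of
  \<open>k\<close>, and it is diagonal with vectors \<open>k z\<close>.\<close>

lemma positive_compacts_square:
  assumes k: "k \<in> compact_r X" "is_adjoint X k k"
  shows "(\<lambda>z. k (k z)) \<in> positive_compacts"
proof (rule positive_compacts_limit)
  show "(\<lambda>z. k (k z)) \<in> compact_r X" by (rule compact_mult[OF k(1) k(1)])
  fix e :: real assume e: "e > 0"
  obtain M where M: "M > 0" "op_bound X M k" using is_adjoint_bounded[OF k(2)] .
  have "eventually (\<lambda>u. op_bound X (e / M) (\<lambda>z. k (u z) - k z)) approx_filter"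
    using e M by (intro eventually_approx_filter_right_unit k) auto
  moreover have "eventually (\<lambda>u. u \<in> approx_units [] 1) approx_filter" by (rule eventually_approx_filter_approx_units) simp
  ultimately have "eventually (\<lambda>u. op_bound X (e / M) (\<lambda>z. k (u z) - k z) \<and> u \<in> approx_units [] 1) approx_filter"
    by eventually_elim simp
  then obtain u where u: "op_bound X (e / M) (\<lambda>z. k (u z) - k z)" "u \<in> approx_units [] 1"
    using eventually_happens'[OF approx_filter_neq_bot] by blast
  then obtain zs where zs: "u = finite_rank X (diag zs)" by (auto simp: approx_units_def)
  have "op_bound X (e / M * M) (\<lambda>z. k (u (k z)) - k (k z))"
    using e M by (intro op_bound_comp[OF u(1) M(2)]) auto
  then have "op_bound X e (\<lambda>z. k (k z) - k (u (k z)))"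
    using M by (simp add: op_bound_def nr_diff_commute)
  moreover have "(\<lambda>z. k (u (k z))) \<in> positive_compacts"
    unfolding zs by (rule positive_compacts_conj[OF positive_compacts_finite_rank k(2)])
  ultimately show "\<exists>S\<in>positive_compacts. op_bound X e (\<lambda>z. k (k z) - S z)" by (rule bexI)
qed

text \<open>The iteration with \<open>h = 1\<close> writes \<open>k\<close> as a finite sum of
  squares up to a small error. All iterates are polynomials in \<open>k\<close> without constant
  term, hence compact.\<close>

lemma positive_compacts_of_op_positive:
  assumes k: "k \<in> compact_r X" "op_positive X k" "op_positive X (\<lambda>x. x - k x)"
  shows "k \<in> positive_compacts"
proof (rule positive_compacts_limit[OF k(1)])
  fix e :: real assume e: "e > 0"
  have id1: "op_positive X (\<lambda>x. x - x)" using op_positive_0 by simp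
  define R where "R = quadratic_iterate (\<lambda>x. x) k"
  have RK: "R n \<in> compact_r X" for n
    by (induction n) (simp_all add: R_def k compact_diff compact_mult)
  have Radj: "is_adjoint X (R n) (R n)" for n
    using rn_is_adjoint[OF op_positive_id id1 k(2,3) refl] by (simp add: R_def)
  obtain n :: nat where n: "(1 / e)\<^sup>2 < real n" using reals_Archimedean2 by blast
  moreover have "0 < (1 / e)\<^sup>2" using e by simp
  ultimately have n0: "real n > 0" by linarith
  have "1 / e < sqrt (real n)" using n by (rule real_less_rsqrt)
  then have "1 / sqrt (real n) \<le> e" using e n0 by (simp add: field_simps)
  then have "op_bound X e (R n)"
    using square_decomposition[OF k(2,3), of n] n0 by (auto simp: R_def intro: op_bound_mono)
  moreover have "k x - (\<Sum>j<n. R j (R j x)) = R n x" for x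
    using quadratic_iterate_telescope[OF op_positive_id id1 k(2,3) refl, of x n] by (simp add: R_def)
  ultimately have "op_bound X e (\<lambda>x. k x - (\<Sum>j<n. R j (R j x)))" by simp
  moreover have "(\<lambda>x. \<Sum>j<n. R j (R j x)) \<in> positive_compacts"
    by (intro positive_compacts_sum positive_compacts_square RK Radj)
  ultimately show "\<exists>S\<in>positive_compacts. op_bound X e (\<lambda>x. k x - S x)" by (rule bexI)
qed

end

section \<open>Second duals\<close>

lemma dual_sel [simp]:
  "elems (dual V) = continuous_linear_maps V complex_space"
  "vadd (dual V) f g = (\<lambda>v\<in>elems V. f v + g v)"
  "vscale (dual V) c f = (\<lambda>v\<in>elems V. c * f v)"
  "vnorm (dual V) f = (SUP v\<in>{v \<in> elems V. vnorm V v \<le> 1}. cmod (f v))"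
  by (simp_all add: dual_def)

lemma complex_space_sel [simp]:
  "elems complex_space = UNIV" "vadd complex_space a b = a + b" "vscale complex_space c a = c * a"
  "vnorm complex_space a = cmod a"
  by (simp_all add: complex_space_def)

lemma cstar_alg_sel [simp]:
  "elems cstar_alg = UNIV" "vadd cstar_alg a b = a + b" "vscale cstar_alg c a = c *\<^sub>C a"
  "vnorm cstar_alg a = norm a" "vmult cstar_alg a b = a * b"
  by (simp_all add: cstar_alg_def)

lemma enveloping_vN_sel [simp]:
  "elems (enveloping_vN A) = elems (dual (dual A))"
  "vadd (enveloping_vN A) = vadd (dual (dual A))"
  "vscale (enveloping_vN A) = vscale (dual (dual A))"
  "vmult (enveloping_vN A) = arens A"
  by (simp_all add: enveloping_vN_def)

abbreviation functionals :: "('v, 'p) nspace_scheme \<Rightarrow> ('v \<Rightarrow> complex) set" where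
  "functionals V \<equiv> continuous_linear_maps V complex_space"

lemma functionals_iff:
  "f \<in> functionals V \<longleftrightarrow> f \<in> extensional (elems V) \<and>
     (\<forall>u\<in>elems V. \<forall>v\<in>elems V. f (vadd V u v) = f u + f v) \<and>
     (\<forall>c. \<forall>v\<in>elems V. f (vscale V c v) = c * f v) \<and> (\<exists>C. \<forall>v\<in>elems V. cmod (f v) \<le> C * vnorm V v)"
  by (auto simp: continuous_linear_maps_def linear_maps_def PiE_def)

text \<open>The records carry no axioms; closure under the operations is what makes sums and
  multiples of functionals functionals again.\<close>

definition vclosed :: "('v, 'p) cspace_scheme \<Rightarrow> bool" where
  "vclosed V \<longleftrightarrow> elems V \<noteq> {} \<and> (\<forall>u\<in>elems V. \<forall>v\<in>elems V. vadd V u v \<in> elems V) \<and>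
    (\<forall>c. \<forall>v\<in>elems V. vscale V c v \<in> elems V)"

lemma functionals_add:
  assumes V: "vclosed V" and f: "f \<in> functionals V" and g: "g \<in> functionals V"
  shows "(\<lambda>v\<in>elems V. f v + g v) \<in> functionals V"
proof -
  obtain C D where C: "\<And>v. v \<in> elems V \<Longrightarrow> cmod (f v) \<le> C * vnorm V v"
    and D: "\<And>v. v \<in> elems V \<Longrightarrow> cmod (g v) \<le> D * vnorm V v"
    using f g unfolding functionals_iff by blast
  have "cmod (f v + g v) \<le> (C + D) * vnorm V v" if "v \<in> elems V" for v
    using norm_triangle_ineq[of "f v" "g v"] C[OF that] D[OF that] by (simp add: distrib_right)
  then have "\<exists>C. \<forall>v\<in>elems V. cmod (f v + g v) \<le> C * vnorm V v" by blast
  then show ?thesis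
    using f g V by (auto simp: functionals_iff vclosed_def algebra_simps)
qed

lemma functionals_scale:
  assumes V: "vclosed V" and f: "f \<in> functionals V"
  shows "(\<lambda>v\<in>elems V. c * f v) \<in> functionals V"
proof -
  obtain C where C: "\<And>v. v \<in> elems V \<Longrightarrow> cmod (f v) \<le> C * vnorm V v"
    using f unfolding functionals_iff by blast
  have "cmod (c * f v) \<le> (cmod c * C) * vnorm V v" if "v \<in> elems V" for v
    using mult_left_mono[OF C[OF that], of "cmod c"] by (simp add: norm_mult mult.assoc)
  then have "\<exists>C. \<forall>v\<in>elems V. cmod (c * f v) \<le> C * vnorm V v" by blast
  then show ?thesis
    using f V by (auto simp: functionals_iff vclosed_def algebra_simps)
qed

text \<open>The linear algebra behind weak* density: a functional vanishing on a finite intersection of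
  kernels is a combination of the functionals involved.\<close>

lemma linear_vanishing:
  assumes V: "vclosed V" and "finite S" "S \<subseteq> functionals V" "\<psi> \<in> functionals V"
    and "\<And>v. v \<in> elems V \<Longrightarrow> (\<forall>\<phi>\<in>S. \<phi> v = 0) \<Longrightarrow> \<psi> v = 0"
    and madd: "\<And>f g. f \<in> functionals V \<Longrightarrow> g \<in> functionals V \<Longrightarrow> m (vadd (dual V) f g) = m f + (m g :: complex)"
    and mscale: "\<And>c f. f \<in> functionals V \<Longrightarrow> m (vscale (dual V) c f) = c * m f"
    and "\<And>\<phi>. \<phi> \<in> S \<Longrightarrow> m \<phi> = 0"
  shows "m \<psi> = 0"
  using assms(2-5,8)
proof (induction S arbitrary: \<psi> rule: finite_induct)
  case empty
  have "vscale (dual V) 0 \<psi> = \<psi>"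
    using empty by (auto simp: functionals_iff extensional_def fun_eq_iff)
  then show ?case using mscale[OF empty(2), of 0] by simp
next
  case (insert \<phi> S)
  have \<phi>: "\<phi> \<in> functionals V" using insert by auto
  show ?case
  proof (cases "\<forall>v\<in>elems V. (\<forall>\<phi>\<in>S. \<phi> v = 0) \<longrightarrow> \<phi> v = 0")
    case True
    show ?thesis
    proof (rule insert.IH)
      show "\<psi> v = 0" if "v \<in> elems V" "\<forall>\<phi>\<in>S. \<phi> v = 0" for v
        using True that by (intro insert.prems(3)) auto
    qed (use insert.prems in auto)
  next
    case False
    then obtain v0 where v0: "v0 \<in> elems V" "\<And>\<phi>'. \<phi>' \<in> S \<Longrightarrow> \<phi>' v0 = 0" "\<phi> v0 \<noteq> 0" by blast
    define c where "c = - (\<psi> v0 / \<phi> v0)"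
    define \<psi>' where "\<psi>' = vadd (dual V) \<psi> (vscale (dual V) c \<phi>)"
    have c\<phi>: "vscale (dual V) c \<phi> \<in> functionals V"
      using functionals_scale[OF V \<phi>] by simp
    have "m \<psi>' = 0"
    proof (rule insert.IH)
      show "\<psi>' \<in> functionals V"
        using functionals_add[OF V insert.prems(2) c\<phi>] by (simp add: \<psi>'_def)
      show "\<psi>' v = 0" if v: "v \<in> elems V" "\<forall>\<phi>\<in>S. \<phi> v = 0" for v
      proof -
        \<comment> \<open>Adding this multiple of \<open>v0\<close> moves \<open>v\<close> into the
          kernel of \<open>\<phi>\<close> without changing the values of the functionals in
          \<open>S\<close>.\<close>
        define w where "w = vscale V (- (\<phi> v / \<phi> v0)) v0"
        have w: "w \<in> elems V" "vadd V v w \<in> elems V"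
          using V v v0 by (auto simp: w_def vclosed_def)
        have val: "h (vadd V v w) = h v - \<phi> v / \<phi> v0 * h v0" if "h \<in> functionals V" for h
          using that v v0 w by (simp add: functionals_iff) (simp add: w_def)
        have "\<psi> (vadd V v w) = 0"
        proof (rule insert.prems(3)[OF w(2)])
          show "\<forall>\<phi>'\<in>insert \<phi> S. \<phi>' (vadd V v w) = 0"
          proof
            fix \<phi>' assume \<phi>': "\<phi>' \<in> insert \<phi> S"
            then have "\<phi>' (vadd V v w) = \<phi>' v - \<phi> v / \<phi> v0 * \<phi>' v0"
              using insert.prems(1) by (intro val) blast
            then show "\<phi>' (vadd V v w) = 0"
              using \<phi>' v(2) v0(2,3) by (cases "\<phi>' = \<phi>") auto
          qed
        qed
        then have "\<psi> v = \<phi> v / \<phi> v0 * \<psi> v0" using val[OF insert.prems(2)] by simp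
        then show ?thesis using v v0(3) by (simp add: \<psi>'_def c_def)
      qed
    qed (use insert.prems in auto)
    moreover have "m \<psi>' = m \<psi> + c * m \<phi>"
      unfolding \<psi>'_def by (subst madd[OF insert.prems(2) c\<phi>]) (simp only: mscale[OF \<phi>])
    ultimately show ?thesis using insert.prems(4)[of \<phi>] by simp
  qed
qed

text \<open>Weak* density of \<open>V\<close> in its second dual, as exact interpolation at finitely
  many functionals and without norm control. A new functional either vanishes on the common kernel,
  where \<open>linear_vanishing\<close> forces the right value, or leaves a vector free to correct
  it.\<close>

lemma second_dual_dense:
  assumes V: "vclosed V" and m: "m \<in> functionals (dual V)"
    and "finite S" "S \<subseteq> functionals V"
  shows "\<exists>v\<in>elems V. \<forall>\<phi>\<in>S. \<phi> v = m \<phi>"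
  using assms(3,4)
proof (induction S rule: finite_induct)
  case empty
  then show ?case using V by (auto simp: vclosed_def)
next
  case (insert \<psi> S)
  then obtain v where v: "v \<in> elems V" "\<And>\<phi>. \<phi> \<in> S \<Longrightarrow> \<phi> v = m \<phi>" by auto
  have \<psi>: "\<psi> \<in> functionals V" using insert by auto
  show ?case
  proof (cases "\<forall>v\<in>elems V. (\<forall>\<phi>\<in>S. \<phi> v = 0) \<longrightarrow> \<psi> v = 0")
    case True
    have "m \<psi> - \<psi> v = 0"
    proof (rule linear_vanishing[OF V insert.hyps(1) _ \<psi>, of "\<lambda>f. m f - f v"])
      show "m (vadd (dual V) f g) - vadd (dual V) f g v = m f - f v + (m g - g v)"
        if "f \<in> functionals V" "g \<in> functionals V" for f g
        using m that v(1) by (auto simp: functionals_iff[of m])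
      show "m (vscale (dual V) c f) - vscale (dual V) c f v = c * (m f - f v)" if "f \<in> functionals V" for c f
        using m that v(1) by (auto simp: functionals_iff[of m] algebra_simps)
    qed (use insert.prems True v in auto)
    then show ?thesis using v by (intro bexI[of _ v]) auto
  next
    case False
    then obtain v0 where v0: "v0 \<in> elems V" "\<And>\<phi>'. \<phi>' \<in> S \<Longrightarrow> \<phi>' v0 = 0" "\<psi> v0 \<noteq> 0" by blast
    define w where "w = vscale V ((m \<psi> - \<psi> v) / \<psi> v0) v0"
    have w: "w \<in> elems V" "vadd V v w \<in> elems V"
      using V v v0 by (auto simp: w_def vclosed_def)
    have val: "h (vadd V v w) = h v + (m \<psi> - \<psi> v) / \<psi> v0 * h v0" if "h \<in> functionals V" for h
      using that v v0 w by (simp add: functionals_iff) (simp add: w_def)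
    show ?thesis
    proof (intro bexI[OF _ w(2)] ballI)
      fix \<phi> assume \<phi>: "\<phi> \<in> insert \<psi> S"
      then have "\<phi> (vadd V v w) = \<phi> v + (m \<psi> - \<psi> v) / \<psi> v0 * \<phi> v0"
        using insert.prems by (intro val) blast
      then show "\<phi> (vadd V v w) = m \<phi>"
        using \<phi> v(2) v0(2,3) by (cases "\<phi> = \<psi>") auto
    qed
  qed
qed

text \<open>The uniqueness half of the normal extension: a basic neighbourhood constrains finitely
  many coordinates, so by \<open>second_dual_dense\<close> it contains the image of some
  vector.\<close>

lemma normal_maps_eq:
  fixes V :: "('v, 'p) nspace_scheme" and G H :: "(('v \<Rightarrow> complex) \<Rightarrow> complex) \<Rightarrow> 'w \<Rightarrow> complex"
  assumes V: "vclosed V" and emb: "\<And>v. v \<in> elems V \<Longrightarrow> embed V v \<in> functionals (dual V)"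
    and G: "G \<in> extensional (functionals (dual V))" "continuous_on (functionals (dual V)) G"
    and H: "H \<in> extensional (functionals (dual V))" "continuous_on (functionals (dual V)) H"
    and eq: "\<And>v. v \<in> elems V \<Longrightarrow> G (embed V v) = H (embed V v)"
  shows "G = H"
proof (rule extensionalityI[OF G(1) H(1)])
  fix m assume m: "m \<in> functionals (dual V)"
  show "G m = H m"
  proof (rule ext, rule ccontr)
    fix f assume neq: "G m f \<noteq> H m f"
    define d where "d p = G p f - H p f" for p
    have "continuous_on (functionals (dual V)) d"
      unfolding d_def
      by (rule continuous_on_diff[OF continuous_on_product_then_coordinatewise[OF G(2)]
            continuous_on_product_then_coordinatewise[OF H(2)]])
    then obtain A where A: "open A" "A \<inter> functionals (dual V) = d -` (- {0}) \<inter> functionals (dual V)"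
      unfolding continuous_on_open_invariant by (metis open_Compl closed_singleton)
    have "m \<in> A" using A(2) m neq by (auto simp: d_def)
    then obtain U where U: "m \<in> Pi\<^sub>E UNIV U" "finite {i. U i \<noteq> UNIV}" "Pi\<^sub>E UNIV U \<subseteq> A"
      using A(1) product_topology_open_contains_basis[of "\<lambda>_. euclidean" UNIV A m]
      unfolding open_fun_def by auto
    obtain v where v: "v \<in> elems V" "\<And>\<phi>. U \<phi> \<noteq> UNIV \<Longrightarrow> \<phi> \<in> functionals V \<Longrightarrow> \<phi> v = m \<phi>"
      using second_dual_dense[OF V m, of "{i. U i \<noteq> UNIV} \<inter> functionals V"] U(2) by auto
    have "embed V v \<phi> \<in> U \<phi>" for \<phi>
    proof (cases "\<phi> \<in> functionals V")
      case True
      then show ?thesis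
        using v(2)[of \<phi>] PiE_mem[OF U(1), of \<phi>] by (cases "U \<phi> = UNIV") (simp_all add: embed_def)
    next
      case False
      \<comment> \<open>Off the dual every element of the second dual has the value
        \<open>undefined\<close>, so a constraint at such a coordinate holds automatically.\<close>
      then have "embed V v \<phi> = m \<phi>"
        using m by (auto simp: embed_def functionals_iff[of m] extensional_def)
      then show ?thesis using PiE_mem[OF U(1), of \<phi>] by simp
    qed
    then have "embed V v \<in> A" using U(3) by auto
    then have "d (embed V v) \<noteq> 0" using A(2) emb[OF v(1)] by blast
    then show False using eq[OF v(1)] by (simp add: d_def)
  qed
qed

context finite_numerical_index
begin

section \<open>The unit of the enveloping von Neumann algebra of the compact operators\<close>

abbreviation "\<K> \<equiv> compact_alg_r X"

definition dual_norm :: "(('x \<Rightarrow> 'x) \<Rightarrow> complex) \<Rightarrow> real" where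
  "dual_norm f = vnorm (dual \<K>) f"

lemma dual_norm_eq: "dual_norm f = (SUP T\<in>{T \<in> elems \<K>. vnorm \<K> T \<le> 1}. cmod (f T))"
  by (simp add: dual_norm_def)

lemma second_dual_iff:
  "m \<in> functionals (dual \<K>) \<longleftrightarrow> m \<in> extensional (functionals \<K>) \<and>
     (\<forall>f\<in>functionals \<K>. \<forall>g\<in>functionals \<K>. m (vadd (dual \<K>) f g) = m f + m g) \<and>
     (\<forall>c. \<forall>f\<in>functionals \<K>. m (vscale (dual \<K>) c f) = c * m f) \<and>
     (\<exists>C. \<forall>f\<in>functionals \<K>. cmod (m f) \<le> C * dual_norm f)"
  unfolding functionals_iff[of m] dual_norm_def dual_sel(1) ..

lemma second_dual_add:
  "m \<in> functionals (dual \<K>) \<Longrightarrow> f \<in> functionals \<K> \<Longrightarrow> g \<in> functionals \<K> \<Longrightarrow> m (vadd (dual \<K>) f g) = m f + m g"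
  and second_dual_scale:
  "m \<in> functionals (dual \<K>) \<Longrightarrow> f \<in> functionals \<K> \<Longrightarrow> m (vscale (dual \<K>) c f) = c * m f"
  unfolding second_dual_iff by blast+

lemma vclosed_compact: "vclosed \<K>"
  using compact_zero by (auto simp: vclosed_def intro: compact_add compact_scale)

lemma functional_add: "f \<in> functionals \<K> \<Longrightarrow> S \<in> compact_r X \<Longrightarrow> T \<in> compact_r X \<Longrightarrow> f (\<lambda>z. S z + T z) = f S + f T"
  and functional_scale: "f \<in> functionals \<K> \<Longrightarrow> T \<in> compact_r X \<Longrightarrow> f (\<lambda>z. scale X c (T z)) = c * f T"
  by (auto simp: functionals_iff)

lemma functional_diff:
  assumes "f \<in> functionals \<K>" "S \<in> compact_r X" "T \<in> compact_r X"
  shows "f (\<lambda>z. S z - T z) = f S - f T"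
  using functional_add[OF assms(1) compact_diff[OF assms(2,3)] assms(3)] by simp

lemma dual_norm_bdd_above:
  assumes f: "f \<in> functionals \<K>"
  shows "bdd_above ((\<lambda>T. cmod (f T)) ` {T \<in> elems \<K>. vnorm \<K> T \<le> 1})"
proof -
  obtain C where C: "\<And>T. T \<in> compact_r X \<Longrightarrow> cmod (f T) \<le> C * op_norm_r X T"
    using f by (simp add: functionals_iff) blast
  have "cmod (f T) \<le> \<bar>C\<bar>" if T: "T \<in> compact_r X" "op_norm_r X T \<le> 1" for T
  proof -
    obtain S where S: "is_adjoint X T S" using compact_r_is_adjoint[OF T(1)] .
    have "C * op_norm_r X T \<le> \<bar>C\<bar> * op_norm_r X T"
      using op_norm_nonneg[OF S] by (intro mult_right_mono) auto
    also have "\<dots> \<le> \<bar>C\<bar> * 1" using T(2) by (intro mult_left_mono) auto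
    finally show ?thesis using C[OF T(1)] by simp
  qed
  then show ?thesis by (intro bdd_aboveI[of _ "\<bar>C\<bar>"]) auto
qed

lemma dual_norm_unit_ball:
  assumes f: "f \<in> functionals \<K>" and T: "T \<in> compact_r X" "op_bound X 1 T"
  shows "cmod (f T) \<le> dual_norm f"
  using T op_norm_le[OF T(2)] unfolding dual_norm_eq
  by (intro cSUP_upper dual_norm_bdd_above[OF f]) auto

lemma op_bound_zero: "op_bound X 1 (\<lambda>z. 0)"
  by (simp add: op_bound_def)

lemma dual_norm_nonneg: "f \<in> functionals \<K> \<Longrightarrow> dual_norm f \<ge> 0"
  using dual_norm_unit_ball[OF _ compact_zero op_bound_zero] norm_ge_zero order_trans by blast

lemma dual_norm_bound:
  assumes f: "f \<in> functionals \<K>" and T: "T \<in> compact_r X" "op_bound X M T" "M \<ge> 0"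
  shows "cmod (f T) \<le> dual_norm f * M"
proof -
  have pos: "cmod (f T) \<le> dual_norm f * N" if N: "N > 0" "op_bound X N T" for N
  proof -
    have "op_bound X (1 / N * N) (\<lambda>z. rs (1 / N) (T z))"
      using N by (intro op_bound_comp[OF _ N(2)]) (auto simp: op_bound_def nr_scale norm_divide)
    then have "cmod (f (\<lambda>z. rs (1 / N) (T z))) \<le> dual_norm f"
      using N(1) by (intro dual_norm_unit_ball f compact_scale T(1)) auto
    then have "1 / N * cmod (f T) \<le> dual_norm f"
      using N(1) by (simp add: functional_scale f T(1) norm_mult norm_divide)
    then show ?thesis using N(1) by (simp add: field_simps)
  qed
  show ?thesis
  proof (rule field_le_epsilon)
    fix e :: real assume e: "e > 0"
    \<comment> \<open>Rescaling needs a positive bound while \<open>M\<close> may be 0;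
      \<open>dual_norm f + 1\<close> avoids a zero denominator.\<close>
    define N where "N = M + e / (dual_norm f + 1)"
    have d: "dual_norm f \<ge> 0" by (rule dual_norm_nonneg[OF f])
    then have d1: "dual_norm f + 1 > 0" by linarith
    then have e1: "e / (dual_norm f + 1) > 0" using e by simp
    have "cmod (f T) \<le> dual_norm f * N"
      using T e1 by (intro pos op_bound_mono[OF T(2)]) (auto simp: N_def)
    also have "\<dots> = dual_norm f * M + dual_norm f * (e / (dual_norm f + 1))"
      by (simp add: N_def distrib_left)
    also have "\<dots> \<le> dual_norm f * M + (dual_norm f + 1) * (e / (dual_norm f + 1))"
      using e1 by (intro add_left_mono mult_right_mono) auto
    also have "\<dots> = dual_norm f * M + e" using d1 by simp
    finally show "cmod (f T) \<le> dual_norm f * M + e" .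
  qed
qed

lemma dual_norm_least:
  assumes "N \<ge> 0" "\<And>T. T \<in> compact_r X \<Longrightarrow> op_bound X 1 T \<Longrightarrow> cmod (f T) \<le> N"
  shows "dual_norm f \<le> N"
  unfolding dual_norm_eq
proof (rule cSUP_least)
  have "op_norm_r X (\<lambda>z. 0) \<le> 1" by (intro op_norm_le) (auto simp: op_bound_def)
  then show "{T \<in> elems \<K>. vnorm \<K> T \<le> 1} \<noteq> {}" using compact_zero by auto
  fix T assume "T \<in> {T \<in> elems \<K>. vnorm \<K> T \<le> 1}"
  then have T: "T \<in> compact_r X" "op_norm_r X T \<le> 1" by auto
  obtain S where S: "is_adjoint X T S" using compact_r_is_adjoint[OF T(1)] .
  show "cmod (f T) \<le> N"
    using T by (intro assms op_bound_mono[OF op_norm[OF S]]) auto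
qed

text \<open>The row operator \<open>[u, 1 - u]\<close> is a contraction since \<open>u\<^sup>2 + (1 - u)\<^sup>2 \<le> 1\<close>.\<close>

lemma row_bound:
  assumes u: "u \<in> approx_units xs \<delta>" and a: "is_adjoint X a a'" "op_bound X 1 a" and b: "is_adjoint X b b'" "op_bound X 1 b" and t: "t \<ge> 0"
  shows "op_bound X (sqrt (1 + t\<^sup>2)) (\<lambda>z. u (a z) + rs t (b z - u (b z)))"
proof -
  note ua = approx_unitsD(3)[OF u]
  define c :: "nat \<Rightarrow> 'x \<Rightarrow> 'x" where "c i = (if i = 0 then a' else (\<lambda>z. rs t (b' z)))" for i
  define c' :: "nat \<Rightarrow> 'x \<Rightarrow> 'x" where "c' i = (if i = 0 then a else (\<lambda>z. rs t (b z)))" for i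
  \<comment> \<open>The adjoint is estimated instead: it is the row \<open>(a', t b')\<close>
    applied to the column \<open>(u z, z - u z)\<close>, and the column has inner square at most
    that of \<open>z\<close>.\<close>
  define W where "W z = a' (u z) + rs t (b' (z - u z))" for z
  have cadj: "is_adjoint X (c i) (c' i)" for i
    using is_adjoint_sym[OF a(1)] is_adjoint_scale[OF is_adjoint_sym[OF b(1)], of "complex_of_real t"] by (simp add: c_def c'_def)
  have "op_bound X (1 * 1 + t\<^sup>2 * (1 * 1)) (\<lambda>z. a' (a z) + rs (t\<^sup>2) (b' (b z)))"
  proof (intro op_bound_add)
    show "op_bound X (1 * 1) (\<lambda>z. a' (a z))"
      by (rule op_bound_comp[OF op_bound_is_adjoint[OF a] a(2)]) simp
    have "op_bound X (1 * 1) (\<lambda>z. b' (b z))"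
      by (rule op_bound_comp[OF op_bound_is_adjoint[OF b] b(2)]) simp
    then show "op_bound X (t\<^sup>2 * (1 * 1)) (\<lambda>z. rs (t\<^sup>2) (b' (b z)))"
      by (intro op_bound_comp[of "t\<^sup>2"]) (auto simp: op_bound_def nr_scale norm_mult norm_power)
  qed
  moreover have "a' (a z) + rs (t\<^sup>2) (b' (b z)) = (\<Sum>i\<in>{0,1}. c i (c' i z))" for z
    using is_adjoint_linear(5)[OF is_adjoint_sym[OF b(1)]] by (simp add: c_def c'_def scale_simps power2_eq_square)
  ultimately have row: "op_bound X (1 + t\<^sup>2) (\<lambda>z. \<Sum>i\<in>{0,1}. c i (c' i z))" by simp
  have "op_bound X (sqrt (1 + t\<^sup>2)) W"
    unfolding op_bound_def
  proof
    fix z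
    define y where "y i = (if i = 0 then u z else z - u z)" for i :: nat
    have W: "W z = (\<Sum>i\<in>{0,1}. c i (y i))" by (simp add: W_def c_def y_def)
    have "cpos (ip z (u z - u (u z)) + ip z (u z - u (u z)))"
      by (intro cpos_add op_positive_cpos[OF op_positive_sub_square] approx_unitsD[OF u])
    then have "cpos (ip z z - (\<Sum>i\<in>{0,1}. ip (y i) (y i)))"
      by (simp add: y_def ip_diff is_adjointD[OF ua] is_adjoint_linear[OF ua] algebra_simps)
    then have "norm (\<Sum>i\<in>{0,1}. ip (y i) (y i)) \<le> norm (ip z z)"
      by (intro norm_mono_cpos cpos_sum cpos_ip)
    then have "(nr (W z))\<^sup>2 \<le> (1 + t\<^sup>2) * norm (ip z z)"
      unfolding W
      by (intro order_trans[OF row_column_cauchy_schwarz[OF cadj row]] mult_left_mono) auto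
    also have "\<dots> = (sqrt (1 + t\<^sup>2) * nr z)\<^sup>2"
      by (simp add: power_mult_distrib nr_square)
    finally show "nr (W z) \<le> sqrt (1 + t\<^sup>2) * nr z"
      by (rule power2_le_imp_le) simp
  qed
  moreover have "is_adjoint X W (\<lambda>z. u (a z) + rs t (b z - u (b z)))"
  proof -
    have "is_adjoint X (\<lambda>z. a' (u z) + rs t (b' (z - u z))) (\<lambda>z. u (a z) + rs t (b z - u (b z)))"
      using is_adjoint_add[OF is_adjoint_comp[OF is_adjoint_sym[OF a(1)] ua]
          is_adjoint_scale[OF is_adjoint_comp[OF is_adjoint_sym[OF b(1)] is_adjoint_diff[OF is_adjoint_id ua]], of "complex_of_real t"]] by simp
    then show ?thesis by (simp add: W_def[abs_def])
  qed
  ultimately show ?thesis by (rule op_bound_is_adjoint[rotated])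
qed

lemma functional_phase:
  assumes f: "f \<in> functionals \<K>" and T: "T \<in> compact_r X"
  obtains c where "cmod c = 1" "f (\<lambda>z. scale X c (T z)) = complex_of_real (cmod (f T))"
proof (cases "f T = 0")
  case True
  then show ?thesis using that[of 1] by (simp add: functional_scale f T)
next
  case False
  define c where "c = cnj (f T) / complex_of_real (cmod (f T))"
  have "c * f T = complex_of_real (cmod (f T))"
    using False complex_norm_square[of "f T"] by (simp add: c_def power2_eq_square field_simps)
  moreover have "cmod c = 1" using False by (simp add: c_def norm_divide)
  ultimately show ?thesis using that[of c] by (simp add: functional_scale f T)
qed

lemma op_bound_phase: "cmod c = 1 \<Longrightarrow> op_bound X M T \<Longrightarrow> op_bound X M (\<lambda>z. scale X c (T z))"
  by (simp add: op_bound_def nr_scale)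

text \<open>If \<open>a\<close> in the unit ball almost attains the norm of \<open>f\<close> and \<open>u a \<approx> a\<close>, then
  \<open>f (u a + t (1 - u) T)\<close> can only exceed \<open>f a\<close> by \<open>O (t\<^sup>2)\<close>; hence \<open>f ((1 - u) T)\<close> is small.\<close>

lemma eventually_functional_left_unit:
  assumes f: "f \<in> functionals \<K>" and e: "e > 0"
  shows "eventually (\<lambda>u. \<forall>T\<in>compact_r X. op_bound X 1 T \<longrightarrow> cmod (f (\<lambda>z. u (T z)) - f T) \<le> e) approx_filter"
proof -
  define N where "N = dual_norm f"
  have N: "N \<ge> 0" unfolding N_def by (rule dual_norm_nonneg[OF f])
  \<comment> \<open>Chosen so that the quadratic gain is at most \<open>t * e / 2\<close>. The
    defect of \<open>a\<close> and the error of \<open>u\<close> are allotted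
    \<open>t * e / 4\<close> each, and dividing by \<open>t\<close> leaves \<open>e\<close>.\<close>
  define t where "t = e / (N + 1)"
  have t: "t > 0" using e N by (simp add: t_def)
  define \<eta> where "\<eta> = t * e / 4"
  define \<delta> where "\<delta> = t * e / (4 * (N + 1))"
  have \<eta>: "\<eta> > 0" and \<delta>: "\<delta> > 0" using e N t by (simp_all add: \<eta>_def \<delta>_def)
  obtain a where a: "a \<in> compact_r X" "op_bound X 1 a" "cmod (f a) > N - \<eta>"
  proof (rule ccontr)
    assume "\<not> thesis"
    then have le: "cmod (f a) \<le> N - \<eta>" if "a \<in> compact_r X" "op_bound X 1 a" for a
      using that \<open>\<And>a. a \<in> compact_r X \<Longrightarrow> op_bound X 1 a \<Longrightarrow> N - \<eta> < cmod (f a) \<Longrightarrow> thesis\<close> by force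
    have "0 \<le> N - \<eta>"
      using le[OF compact_zero op_bound_zero] norm_ge_zero order_trans by blast
    then have "N \<le> N - \<eta>" unfolding N_def using le by (intro dual_norm_least) (auto simp: N_def)
    then show False using \<eta> by simp
  qed
  \<comment> \<open>Phases make \<open>f b\<close>, and below \<open>f (S - u S)\<close>,
    nonnegative reals, so that their contributions to the real part of \<open>f W\<close> add
    without cancellation.\<close>
  obtain c where c: "cmod c = 1" "f (\<lambda>z. scale X c (a z)) = complex_of_real (cmod (f a))"
    using functional_phase[OF f a(1)] .
  define b where "b = (\<lambda>z. scale X c (a z))"
  have b: "b \<in> compact_r X" "op_bound X 1 b" "f b = complex_of_real (cmod (f a))"
    using c a by (simp_all add: b_def compact_scale op_bound_phase)
  have "eventually (\<lambda>u. op_bound X \<delta> (\<lambda>z. u (b z) - b z)) approx_filter"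
    by (rule eventually_approx_filter_left_unit[OF b(1) \<delta>])
  moreover have "eventually (\<lambda>u. u \<in> approx_units [] 1) approx_filter" by (rule eventually_approx_filter_approx_units) simp
  ultimately show ?thesis
  proof eventually_elim
    case (elim u)
    note ua = approx_unitsD(3)[OF elim(2)]
    show ?case
    proof (intro ballI impI)
      fix T assume T: "T \<in> compact_r X" "op_bound X 1 T"
      define D where "D = cmod (f (\<lambda>z. u (T z)) - f T)"
      have uT: "(\<lambda>z. u (T z)) \<in> compact_r X" and ub: "(\<lambda>z. u (b z)) \<in> compact_r X"
        using compact_mult[OF approx_unitsD(5)[OF elim(2)] T(1)] compact_mult[OF approx_unitsD(5)[OF elim(2)] b(1)] by auto
      have TuT: "(\<lambda>z. T z - u (T z)) \<in> compact_r X" by (rule compact_diff[OF T(1) uT])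
      obtain d where d: "cmod d = 1" "f (\<lambda>z. scale X d (T z - u (T z))) = complex_of_real (cmod (f (\<lambda>z. T z - u (T z))))"
        using functional_phase[OF f TuT] .
      define S where "S = (\<lambda>z. scale X d (T z))"
      have S: "S \<in> compact_r X" "op_bound X 1 S"
        using d T by (simp_all add: S_def compact_scale op_bound_phase)
      have Su: "(\<lambda>z. S z - u (S z)) = (\<lambda>z. scale X d (T z - u (T z)))"
        by (simp add: S_def is_adjoint_linear[OF ua] is_adjoint_linear(2)[OF is_adjoint_scale[OF is_adjoint_id]])
      have SuK: "(\<lambda>z. S z - u (S z)) \<in> compact_r X"
        unfolding Su by (rule compact_scale[OF TuT])
      have fS: "f (\<lambda>z. S z - u (S z)) = complex_of_real D"
        unfolding Su d(2) by (simp add: D_def functional_diff[OF f T(1) uT] norm_minus_commute)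
      obtain b' where b': "is_adjoint X b b'" using compact_r_is_adjoint[OF b(1)] .
      obtain S' where S': "is_adjoint X S S'" using compact_r_is_adjoint[OF S(1)] .
      define W where "W = (\<lambda>z. u (b z) + rs t (S z - u (S z)))"
      have WK: "W \<in> compact_r X"
        unfolding W_def by (intro compact_add ub compact_scale SuK)
      have "op_bound X (sqrt (1 + t\<^sup>2)) W"
        unfolding W_def using t by (intro row_bound[OF elim(2) b' b(2) S' S(2)]) simp
      then have 1: "cmod (f W) \<le> N * sqrt (1 + t\<^sup>2)"
        unfolding N_def by (intro dual_norm_bound f WK) auto
      have "sqrt (1 + t\<^sup>2) \<le> sqrt ((1 + t\<^sup>2/2)\<^sup>2)"
        using t by (intro real_sqrt_le_mono) (simp add: power2_eq_square algebra_simps)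
      then have "sqrt (1 + t\<^sup>2) \<le> 1 + t\<^sup>2/2" by simp
      then have 1: "cmod (f W) \<le> N * (1 + t\<^sup>2/2)"
        using 1 mult_left_mono[OF _ N] by (meson order_trans)
      have "f W = f (\<lambda>z. u (b z)) + complex_of_real t * complex_of_real D"
        unfolding W_def by (simp only: functional_add[OF f ub compact_scale[OF SuK]] functional_scale[OF f SuK] fS)
      also have "f (\<lambda>z. u (b z)) = f (\<lambda>z. u (b z) - b z) + f b"
        by (simp add: functional_diff[OF f ub b(1)])
      finally have "Re (f W) = Re (f (\<lambda>z. u (b z) - b z)) + cmod (f a) + t * D"
        by (simp add: b(3))
      moreover have "cmod (f (\<lambda>z. u (b z) - b z)) \<le> N * \<delta>"
        unfolding N_def using \<delta> by (intro dual_norm_bound f compact_diff ub b elim) auto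
      ultimately have "N - \<eta> - N * \<delta> + t * D \<le> cmod (f W)"
        using a(3) abs_Re_le_cmod[of "f (\<lambda>z. u (b z) - b z)"] complex_Re_le_cmod[of "f W"] by linarith
      with 1 have "t * D \<le> N * t\<^sup>2/2 + \<eta> + N * \<delta>" by (simp add: algebra_simps)
      also have "N * \<delta> \<le> (N + 1) * \<delta>" using \<delta> by simp
      also have "(N + 1) * \<delta> = t * e / 4" using N by (simp add: \<delta>_def field_simps)
      also have "N * t\<^sup>2/2 \<le> (N + 1) * t * t / 2" using t by (simp add: power2_eq_square)
      also have "(N + 1) * t * t / 2 = t * e / 2" using N by (simp add: t_def)
      finally have "t * D \<le> t * e" by (simp add: \<eta>_def mult.commute)
      then show "cmod (f (\<lambda>z. u (T z)) - f T) \<le> e" using t by (simp add: D_def)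
    qed
  qed
qed

text \<open>Two approximate units \<open>u\<close>, \<open>v\<close> are compared through a third,
  \<open>w\<close>, nearly a right unit for both. Then \<open>f (u w)\<close> is close to
  \<open>f u\<close>, and it is close to \<open>f w\<close> by the left estimate, which is uniform
  over the unit ball and so applies to \<open>w\<close> chosen after \<open>u\<close>. Four errors
  of \<open>e / 5\<close> arise.\<close>

lemma functional_limit_exists:
  assumes f: "f \<in> functionals \<K>"
  shows "\<exists>L. (f \<longlongrightarrow> L) approx_filter"
proof -
  have "cauchy_filter (filtermap f approx_filter)"
    unfolding cauchy_filter_metric_filtermap
  proof (intro allI impI)
    fix e :: real assume "e > 0"
    then have e: "e / 5 > 0" by simp
    define N where "N = dual_norm f"
    have N: "N \<ge> 0" unfolding N_def by (rule dual_norm_nonneg[OF f])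
    define \<delta> where "\<delta> = e / 5 / (N + 1)"
    have \<delta>: "\<delta> > 0" using e N by (simp add: \<delta>_def)
    have N\<delta>: "N * \<delta> \<le> e / 5"
    proof -
      have "N * \<delta> \<le> (N + 1) * \<delta>" using \<delta> by simp
      also have "\<dots> = e / 5" using N by (simp add: \<delta>_def field_simps)
      finally show ?thesis .
    qed
    define P where "P u \<longleftrightarrow> u \<in> approx_units [] 1 \<and>
      (\<forall>T\<in>compact_r X. op_bound X 1 T \<longrightarrow> cmod (f (\<lambda>z. u (T z)) - f T) \<le> e / 5)" for u
    have ev1: "eventually (\<lambda>u. u \<in> approx_units [] 1) approx_filter" by (rule eventually_approx_filter_approx_units) simp
    have "eventually P approx_filter"
      unfolding P_def using ev1 eventually_functional_left_unit[OF f e] by eventually_elim simp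
    moreover have "dist (f u) (f v) < e" if "P u" "P v" for u v
    proof -
      have u: "u \<in> approx_units [] 1" and v: "v \<in> approx_units [] 1" using that by (auto simp: P_def)
      have "eventually (\<lambda>w. w \<in> approx_units [] 1 \<and> op_bound X \<delta> (\<lambda>z. u (w z) - u z) \<and> op_bound X \<delta> (\<lambda>z. v (w z) - v z)) approx_filter"
        using ev1 eventually_approx_filter_right_unit[OF approx_unitsD(5)[OF u] \<delta>] eventually_approx_filter_right_unit[OF approx_unitsD(5)[OF v] \<delta>]
        by eventually_elim simp
      then obtain w where w: "w \<in> approx_units [] 1" "op_bound X \<delta> (\<lambda>z. u (w z) - u z)" "op_bound X \<delta> (\<lambda>z. v (w z) - v z)"
        using eventually_happens'[OF approx_filter_neq_bot] by blast
      have close: "cmod (f p - f w) \<le> 2 * (e / 5)" if p: "P p" "op_bound X \<delta> (\<lambda>z. p (w z) - p z)" for p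
      proof -
        have pK: "p \<in> compact_r X" using p by (auto simp: P_def dest: approx_unitsD(5))
        note pw = compact_mult[OF pK approx_unitsD(5)[OF w(1)]]
        have "cmod (f (\<lambda>z. p (w z)) - f w) \<le> e / 5"
          using p(1) approx_unitsD(4,5)[OF w(1)] by (auto simp: P_def)
        moreover have "cmod (f (\<lambda>z. p (w z) - p z)) \<le> N * \<delta>"
          unfolding N_def using \<delta> by (intro dual_norm_bound f compact_diff pw pK p(2)) simp
        then have "cmod (f (\<lambda>z. p (w z)) - f p) \<le> e / 5"
          using N\<delta> by (simp add: functional_diff[OF f pw pK])
        ultimately show ?thesis
          using norm_triangle_ineq4[of "f (\<lambda>z. p (w z)) - f w" "f (\<lambda>z. p (w z)) - f p"] by simp
      qed
      have "cmod (f u - f v) \<le> cmod (f u - f w) + cmod (f v - f w)"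
        using norm_triangle_ineq4[of "f u - f w" "f v - f w"] by simp
      also have "\<dots> \<le> 4 * (e / 5)"
        using close[OF that(1) w(2)] close[OF that(2) w(3)] by simp
      also have "\<dots> < e" using \<open>e > 0\<close> by simp
      finally show ?thesis by (simp add: dist_norm)
    qed
    ultimately show "\<exists>P. eventually P approx_filter \<and> (\<forall>x y. P x \<and> P y \<longrightarrow> dist (f x) (f y) < e)" by blast
  qed
  then have "convergent_filter (filtermap f approx_filter)" by (rule cauchy_filter_convergent)
  then show ?thesis by (auto simp: convergent_filter_iff filterlim_def)
qed

text \<open>The weak* limit of the approximate units in the second dual.\<close>

definition kunit :: "(('x \<Rightarrow> 'x) \<Rightarrow> complex) \<Rightarrow> complex" where
  "kunit = (\<lambda>f\<in>functionals \<K>. Lim approx_filter f)"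

lemma kunit_tendsto:
  assumes "f \<in> functionals \<K>"
  shows "(f \<longlongrightarrow> kunit f) approx_filter"
  using functional_limit_exists[OF assms] tendsto_Lim[OF approx_filter_neq_bot] assms by (auto simp: kunit_def)

lemma kunit_eqI: "f \<in> functionals \<K> \<Longrightarrow> (f \<longlongrightarrow> L) approx_filter \<Longrightarrow> kunit f = L"
  using tendsto_unique[OF approx_filter_neq_bot kunit_tendsto] by blast

lemma eventually_approx_filter_compact: "eventually (\<lambda>u. u \<in> compact_r X \<and> op_bound X 1 u) approx_filter"
proof (rule eventually_mono)
  show "eventually (\<lambda>u. u \<in> approx_units [] 1) approx_filter" by (rule eventually_approx_filter_approx_units) simp
qed (auto dest: approx_unitsD)

lemma kunit_functional: "kunit \<in> functionals (dual \<K>)"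
  unfolding second_dual_iff
proof (intro conjI ballI allI exI[of _ 1])
  show "kunit \<in> extensional (functionals \<K>)" by (simp add: kunit_def)
  fix f g assume f: "f \<in> functionals \<K>" and g: "g \<in> functionals \<K>"
  have "eventually (\<lambda>u. f u + g u = vadd (dual \<K>) f g u) approx_filter"
    using eventually_approx_filter_compact by eventually_elim simp
  then have "(vadd (dual \<K>) f g \<longlongrightarrow> kunit f + kunit g) approx_filter"
    using tendsto_add[OF kunit_tendsto[OF f] kunit_tendsto[OF g]] by (rule Lim_transform_eventually[rotated])
  then show "kunit (vadd (dual \<K>) f g) = kunit f + kunit g"
    using functionals_add[OF vclosed_compact f g] by (intro kunit_eqI) auto
next
  fix c f assume f: "f \<in> functionals \<K>"
  have "eventually (\<lambda>u. c * f u = vscale (dual \<K>) c f u) approx_filter"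
    using eventually_approx_filter_compact by eventually_elim simp
  then have "(vscale (dual \<K>) c f \<longlongrightarrow> c * kunit f) approx_filter"
    using tendsto_mult_left[OF kunit_tendsto[OF f]] by (rule Lim_transform_eventually[rotated])
  then show "kunit (vscale (dual \<K>) c f) = c * kunit f"
    using functionals_scale[OF vclosed_compact f] by (intro kunit_eqI) auto
next
  fix f assume f: "f \<in> functionals \<K>"
  have "cmod (kunit f) \<le> dual_norm f"
  proof (rule tendsto_upperbound[OF tendsto_norm[OF kunit_tendsto[OF f]] _ approx_filter_neq_bot])
    show "eventually (\<lambda>u. cmod (f u) \<le> dual_norm f) approx_filter"
      using eventually_approx_filter_compact by eventually_elim (rule dual_norm_unit_ball[OF f], auto)
  qed
  then show "cmod (kunit f) \<le> 1 * dual_norm f" by simp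
qed

lemma arens1_functional:
  assumes f: "f \<in> functionals \<K>" and T: "T \<in> compact_r X"
  shows "arens1 \<K> f T \<in> functionals \<K>"
proof -
  obtain T' where T': "is_adjoint X T T'" using compact_r_is_adjoint[OF T] .
  obtain M where M: "M > 0" "op_bound X M T" using is_adjoint_bounded[OF T'] .
  have val: "arens1 \<K> f T S = f (\<lambda>z. T (S z))" if "S \<in> compact_r X" for S
    using that by (simp add: arens1_def)
  have "cmod (f (\<lambda>z. T (S z))) \<le> (dual_norm f * M) * op_norm_r X S" if S: "S \<in> compact_r X" for S
  proof -
    obtain S' where S': "is_adjoint X S S'" using compact_r_is_adjoint[OF S] .
    have "cmod (f (\<lambda>z. T (S z))) \<le> dual_norm f * (M * op_norm_r X S)"
      using M op_norm_nonneg[OF S']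
      by (intro dual_norm_bound f compact_mult[OF T S] op_bound_comp[OF M(2) op_norm[OF S']]) auto
    then show ?thesis by (simp add: mult.assoc)
  qed
  then have ex: "\<exists>C. \<forall>S\<in>compact_r X. cmod (arens1 \<K> f T S) \<le> C * op_norm_r X S"
    using val by auto
  have "arens1 \<K> f T (\<lambda>z. R z + S z) = arens1 \<K> f T R + arens1 \<K> f T S"
    if "R \<in> compact_r X" "S \<in> compact_r X" for R S
    using that functional_add[OF f compact_mult[OF T that(1)] compact_mult[OF T that(2)]]
    by (simp add: val compact_add is_adjoint_linear[OF T'])
  moreover have "arens1 \<K> f T (\<lambda>z. scale X c (S z)) = c * arens1 \<K> f T S"
    if "S \<in> compact_r X" for c S
    using that functional_scale[OF f compact_mult[OF T that]]
    by (simp add: val compact_scale is_adjoint_linear[OF T'])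
  ultimately show ?thesis
    using ex by (simp add: functionals_iff) (simp add: arens1_def)
qed

text \<open>Here the limit is taken inside: \<open>arens2 \<K> kunit f\<close> at \<open>T\<close>
  is the limit of \<open>f (T u)\<close>, which is \<open>f T\<close>. No property of
  \<open>m\<close> enters beyond its being a function of \<open>f\<close>.\<close>

lemma kunit_right_unit:
  assumes m: "m \<in> functionals (dual \<K>)"
  shows "arens \<K> m kunit = m"
proof (rule extensionalityI)
  show "arens \<K> m kunit \<in> extensional (functionals \<K>)" by (simp add: arens_def)
  show "m \<in> extensional (functionals \<K>)" using m by (simp add: functionals_iff[of m])
  fix f assume f: "f \<in> functionals \<K>"
  have "arens2 \<K> kunit f = f"
  proof (rule extensionalityI)
    show "arens2 \<K> kunit f \<in> extensional (compact_r X)" by (simp add: arens2_def)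
    show "f \<in> extensional (compact_r X)" using f by (simp add: functionals_iff)
    fix T assume T: "T \<in> compact_r X"
    have "(arens1 \<K> f T \<longlongrightarrow> f T) approx_filter"
    proof (rule tendstoI)
      fix e :: real assume e: "e > 0"
      have d: "dual_norm f + 1 > 0" using dual_norm_nonneg[OF f] by linarith
      have ed: "e / (dual_norm f + 1) > 0" using e d by simp
      show "eventually (\<lambda>u. dist (arens1 \<K> f T u) (f T) < e) approx_filter"
        using eventually_approx_filter_compact eventually_approx_filter_right_unit[OF T ed]
      proof eventually_elim
        case (elim u)
        note Tu = compact_mult[OF T conjunct1[OF elim(1)]]
        have "dist (arens1 \<K> f T u) (f T) = cmod (f (\<lambda>z. T (u z) - T z))"
          using elim by (simp add: arens1_def dist_norm functional_diff[OF f Tu T])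
        also have "\<dots> \<le> dual_norm f * (e / (dual_norm f + 1))"
          using ed by (intro dual_norm_bound f compact_diff Tu T elim(2)) simp
        also have "\<dots> < (dual_norm f + 1) * (e / (dual_norm f + 1))"
          using ed by (intro mult_strict_right_mono) auto
        also have "\<dots> = e" using d by simp
        finally show ?case .
      qed
    qed
    then show "arens2 \<K> kunit f T = f T"
      using T arens1_functional[OF f T] by (simp add: arens2_def kunit_eqI)
  qed
  then show "arens \<K> m kunit f = m f" using f by (simp add: arens_def)
qed

lemma arens2_functional:
  assumes m: "m \<in> functionals (dual \<K>)" and f: "f \<in> functionals \<K>"
  shows "arens2 \<K> m f \<in> functionals \<K>"
proof -
  obtain C where C: "\<And>g. g \<in> functionals \<K> \<Longrightarrow> cmod (m g) \<le> C * dual_norm g"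
    using m unfolding second_dual_iff by blast
  have "cmod (m (arens1 \<K> f T)) \<le> (\<bar>C\<bar> * dual_norm f) * op_norm_r X T" if T: "T \<in> compact_r X" for T
  proof -
    obtain T' where T': "is_adjoint X T T'" using compact_r_is_adjoint[OF T] .
    have "dual_norm (arens1 \<K> f T) \<le> dual_norm f * op_norm_r X T"
    proof (rule dual_norm_least)
      show "0 \<le> dual_norm f * op_norm_r X T" using dual_norm_nonneg[OF f] op_norm_nonneg[OF T'] by simp
      fix S assume S: "S \<in> compact_r X" "op_bound X 1 S"
      have "op_bound X (op_norm_r X T * 1) (\<lambda>z. T (S z))"
        by (rule op_bound_comp[OF op_norm[OF T'] S(2) op_norm_nonneg[OF T']])
      then show "cmod (arens1 \<K> f T S) \<le> dual_norm f * op_norm_r X T"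
        using S dual_norm_bound[OF f compact_mult[OF T S(1)], of "op_norm_r X T"] op_norm_nonneg[OF T']
        by (simp add: arens1_def)
    qed
    then have "\<bar>C\<bar> * dual_norm (arens1 \<K> f T) \<le> \<bar>C\<bar> * (dual_norm f * op_norm_r X T)"
      by (intro mult_left_mono) auto
    moreover have "C * dual_norm (arens1 \<K> f T) \<le> \<bar>C\<bar> * dual_norm (arens1 \<K> f T)"
      using dual_norm_nonneg[OF arens1_functional[OF f T]] by (intro mult_right_mono) auto
    ultimately show ?thesis
      using C[OF arens1_functional[OF f T]] by (simp add: mult.assoc)
  qed
  then have ex: "\<exists>C. \<forall>T\<in>compact_r X. cmod (arens2 \<K> m f T) \<le> C * op_norm_r X T"
    by (auto simp: arens2_def)
  have "arens2 \<K> m f (\<lambda>z. S z + T z) = arens2 \<K> m f S + arens2 \<K> m f T"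
    if ST: "S \<in> compact_r X" "T \<in> compact_r X" for S T
  proof -
    have "arens1 \<K> f (\<lambda>z. S z + T z) = vadd (dual \<K>) (arens1 \<K> f S) (arens1 \<K> f T)"
      using ST by (auto simp: arens1_def fun_eq_iff functional_add[OF f compact_mult compact_mult])
    moreover have "m (vadd (dual \<K>) (arens1 \<K> f S) (arens1 \<K> f T)) = m (arens1 \<K> f S) + m (arens1 \<K> f T)"
      using m arens1_functional[OF f] ST unfolding second_dual_iff by auto
    ultimately show ?thesis using ST by (simp add: arens2_def compact_add)
  qed
  moreover have "arens2 \<K> m f (\<lambda>z. scale X c (T z)) = c * arens2 \<K> m f T"
    if T: "T \<in> compact_r X" for c T
  proof -
    have "arens1 \<K> f (\<lambda>z. scale X c (T z)) = vscale (dual \<K>) c (arens1 \<K> f T)"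
      using T by (auto simp: arens1_def fun_eq_iff functional_scale[OF f compact_mult])
    moreover have "m (vscale (dual \<K>) c (arens1 \<K> f T)) = c * m (arens1 \<K> f T)"
      using m arens1_functional[OF f T] unfolding second_dual_iff by auto
    ultimately show ?thesis using T by (simp add: arens2_def compact_scale)
  qed
  ultimately show ?thesis
    using ex by (simp add: functionals_iff) (simp add: arens2_def)
qed

text \<open>The harder side: the limit is of \<open>m\<close> at the functionals
  \<open>arens1 \<K> f u\<close>, and \<open>m\<close> is only norm continuous. These functionals
  must converge to \<open>f\<close> in the dual norm, which is why
  \<open>eventually_functional_left_unit\<close> is uniform over the unit ball.\<close>

lemma kunit_left_unit:
  assumes m: "m \<in> functionals (dual \<K>)"
  shows "arens \<K> kunit m = m"
proof (rule extensionalityI)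
  show "arens \<K> kunit m \<in> extensional (functionals \<K>)" by (simp add: arens_def)
  show "m \<in> extensional (functionals \<K>)" using m by (simp add: functionals_iff[of m])
  fix f assume f: "f \<in> functionals \<K>"
  obtain C where C: "\<And>g. g \<in> functionals \<K> \<Longrightarrow> cmod (m g) \<le> C * dual_norm g"
    using m unfolding second_dual_iff by blast
  have "(arens2 \<K> m f \<longlongrightarrow> m f) approx_filter"
  proof (rule tendstoI)
    fix e :: real assume e: "e > 0"
    define d where "d = e / (\<bar>C\<bar> + 1)"
    have d: "d > 0" "(\<bar>C\<bar> + 1) * d = e" using e by (simp_all add: d_def)
    show "eventually (\<lambda>u. dist (arens2 \<K> m f u) (m f) < e) approx_filter"
      using eventually_approx_filter_compact eventually_functional_left_unit[OF f d(1)]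
    proof eventually_elim
      case (elim u)
      have uK: "u \<in> compact_r X" using elim by simp
      note a1 = arens1_functional[OF f uK]
      define g where "g = vadd (dual \<K>) (arens1 \<K> f u) (vscale (dual \<K>) (- 1) f)"
      have sf: "vscale (dual \<K>) (- 1) f \<in> functionals \<K>"
        using functionals_scale[OF vclosed_compact f, of "- 1"] by simp
      have g: "g \<in> functionals \<K>"
        using functionals_add[OF vclosed_compact a1 sf] by (simp add: g_def)
      have "m g = m (arens1 \<K> f u) + m (vscale (dual \<K>) (- 1) f)"
        unfolding g_def by (rule second_dual_add[OF m a1 sf])
      also have "m (vscale (dual \<K>) (- 1) f) = (- 1) * m f"
        by (rule second_dual_scale[OF m f])
      finally have mg: "m g = m (arens1 \<K> f u) - m f" by simp
      have "dual_norm g \<le> d"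
        using d elim(2) uK by (intro dual_norm_least) (auto simp: g_def arens1_def)
      then have "cmod (m g) \<le> \<bar>C\<bar> * d"
      proof -
        have "C * dual_norm g \<le> \<bar>C\<bar> * dual_norm g" using dual_norm_nonneg[OF g] by (intro mult_right_mono) auto
        also have "\<dots> \<le> \<bar>C\<bar> * d" using \<open>dual_norm g \<le> d\<close> by (intro mult_left_mono) auto
        finally show ?thesis using C[OF g] by linarith
      qed
      also have "\<dots> < e" using d by (simp add: distrib_right flip: d(2))
      finally show ?case using uK by (simp add: dist_norm arens2_def mg)
    qed
  qed
  then show "arens \<K> kunit m f = m f"
    using f arens2_functional[OF m f] by (simp add: arens_def kunit_eqI)
qed

lemma unit_of_compact: "unit_of (enveloping_vN \<K>) = kunit"
  unfolding unit_of_def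
proof (rule the_equality)
  show "kunit \<in> elems (enveloping_vN \<K>) \<and> (\<forall>m\<in>elems (enveloping_vN \<K>).
      vmult (enveloping_vN \<K>) kunit m = m \<and> vmult (enveloping_vN \<K>) m kunit = m)"
    using kunit_functional kunit_left_unit kunit_right_unit by simp
  fix e assume e: "e \<in> elems (enveloping_vN \<K>) \<and> (\<forall>m\<in>elems (enveloping_vN \<K>).
      vmult (enveloping_vN \<K>) e m = m \<and> vmult (enveloping_vN \<K>) m e = m)"
  then have "arens \<K> e kunit = kunit" using kunit_functional by simp
  moreover have "arens \<K> e kunit = e" using e by (intro kunit_right_unit) simp
  ultimately show "e = kunit" by simp
qed

end

section \<open>Hahn-Banach separation from a convex set\<close>

text \<open>Homogeneity is asked as an inequality, the form in which infima inherit it; applying it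
  to \<open>1 / r\<close> gives equality.\<close>

definition sublinear :: "('v::real_vector \<Rightarrow> real) \<Rightarrow> bool" where
  "sublinear p \<longleftrightarrow> (\<forall>x y. p (x + y) \<le> p x + p y) \<and> (\<forall>r>0. \<forall>x. p (r *\<^sub>R x) \<le> r * p x)"

lemma sublinearD:
  assumes "sublinear p"
  shows "p (x + y) \<le> p x + p y" "r > 0 \<Longrightarrow> p (r *\<^sub>R x) \<le> r * p x" "p 0 = 0" "- p (- x) \<le> p x"
    "r > 0 \<Longrightarrow> p (r *\<^sub>R x) = r * p x"
proof -
  have add: "p (x + y) \<le> p x + p y" and scale: "r > 0 \<Longrightarrow> p (r *\<^sub>R x) \<le> r * p x" for x y r
    using assms by (auto simp: sublinear_def)
  show "p (x + y) \<le> p x + p y" "r > 0 \<Longrightarrow> p (r *\<^sub>R x) \<le> r * p x" by (fact add, fact scale)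
  show z: "p 0 = 0"
    using scale[of "1/2" 0] scale[of 2 0] by simp
  show "- p (- x) \<le> p x" using add[of x "- x"] z by simp
  show "p (r *\<^sub>R x) = r * p x" if "r > 0"
  proof (rule antisym[OF scale[OF that]])
    have "p x \<le> (1 / r) * p (r *\<^sub>R x)" using scale[of "1 / r" "r *\<^sub>R x"] that by simp
    then show "r * p x \<le> p (r *\<^sub>R x)" using that by (simp add: field_simps)
  qed
qed

text \<open>A minimal sublinear functional is linear, so Zorn's lemma yields Hahn-Banach.\<close>

lemma minimal_sublinear_additive:
  assumes m: "sublinear m" and min: "\<And>q. sublinear q \<Longrightarrow> (\<And>x. q x \<le> m x) \<Longrightarrow> q = m"
  shows "m (x + y) = m x + m y"
proof (rule antisym[OF sublinearD(1)[OF m]])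
  \<comment> \<open>A sublinear minorant of \<open>m\<close>, the trial functional of Hahn-Banach.
    By minimality it equals \<open>m\<close>, and the entry \<open>t = 1\<close> is the missing
    superadditivity.\<close>
  define q where "q x = (INF t\<in>{0..}. m (x + t *\<^sub>R y) - t * m y)" for x
  have my: "m (t *\<^sub>R y) = t * m y" if "t \<ge> 0" for t
    using sublinearD(3,5)[OF m] that by (cases "t = 0") auto
  have low: "- m (- x) \<le> m (x + t *\<^sub>R y) - t * m y" if "t \<ge> 0" for x t
    using sublinearD(1)[OF m, of "x + t *\<^sub>R y" "- x"] my[OF that] by simp
  have bb: "bdd_below ((\<lambda>t. m (x + t *\<^sub>R y) - t * m y) ` {0..})" for x
    using low by (intro bdd_belowI[of _ "- m (- x)"]) auto
  have qle: "q x \<le> m (x + t *\<^sub>R y) - t * m y" if "t \<ge> 0" for x t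
    unfolding q_def using that by (intro cINF_lower bb) auto
  have "sublinear q"
    unfolding sublinear_def
  proof (intro conjI allI impI)
    fix x1 x2
    have *: "q (x1 + x2) \<le> (m (x1 + t1 *\<^sub>R y) - t1 * m y) + (m (x2 + t2 *\<^sub>R y) - t2 * m y)"
      if "t1 \<ge> 0" "t2 \<ge> 0" for t1 t2
      using qle[of "t1 + t2" "x1 + x2"] that sublinearD(1)[OF m, of "x1 + t1 *\<^sub>R y" "x2 + t2 *\<^sub>R y"]
      by (simp add: algebra_simps)
    have "q (x1 + x2) - (m (x2 + t2 *\<^sub>R y) - t2 * m y) \<le> q x1" if "t2 \<ge> 0" for t2
      unfolding q_def[of x1] using *[OF _ that] by (intro cINF_greatest) (auto simp: diff_le_eq)
    then have "q (x1 + x2) - q x1 \<le> q x2"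
      unfolding q_def[of x2] by (intro cINF_greatest) (auto simp: algebra_simps)
    then show "q (x1 + x2) \<le> q x1 + q x2" by simp
  next
    fix r :: real and x assume r: "r > 0"
    have "q (r *\<^sub>R x) / r \<le> q x"
      unfolding q_def[of x]
    proof (rule cINF_greatest)
      fix t :: real assume t: "t \<in> {0..}"
      have "q (r *\<^sub>R x) \<le> m (r *\<^sub>R x + (r * t) *\<^sub>R y) - (r * t) * m y"
        using r t by (intro qle) simp
      also have "r *\<^sub>R x + (r * t) *\<^sub>R y = r *\<^sub>R (x + t *\<^sub>R y)" by (simp add: scaleR_add_right)
      also have "m (r *\<^sub>R (x + t *\<^sub>R y)) = r * m (x + t *\<^sub>R y)" by (rule sublinearD(5)[OF m r])
      finally show "q (r *\<^sub>R x) / r \<le> m (x + t *\<^sub>R y) - t * m y"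
        using r by (simp add: field_simps)
    qed auto
    then show "q (r *\<^sub>R x) \<le> r * q x" using r by (simp add: field_simps)
  qed
  moreover have "q x \<le> m x" for x using qle[of 0 x] by simp
  ultimately have "q = m" by (rule min)
  then show "m x + m y \<le> m (x + y)" using qle[of 1 x] by simp
qed

lemma exists_minimal_sublinear:
  assumes p: "sublinear (p :: 'v::real_vector \<Rightarrow> real)"
  shows "\<exists>m. sublinear m \<and> (\<forall>x. m x \<le> p x) \<and> (\<forall>q. sublinear q \<longrightarrow> (\<forall>x. q x \<le> m x) \<longrightarrow> q = m)"
proof -
  define A where "A = {q :: 'v \<Rightarrow> real. sublinear q \<and> (\<forall>x. q x \<le> p x)}"
  \<comment> \<open>The order is reversed, so that a maximal element for Zorn is pointwise minimal
    and pointwise infima bound chains.\<close>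
  define P where "P q q' \<longleftrightarrow> (\<forall>x. q' x \<le> q x)" for q q' :: "'v \<Rightarrow> real"
  have "\<exists>m\<in>A. \<forall>a\<in>A. P m a \<longrightarrow> a = m"
  proof (rule predicate_Zorn)
    show "partial_order_on A (relation_of P A)"
      by (intro partial_order_on_relation_ofI) (auto simp: P_def fun_eq_iff intro: order_trans antisym)
  next
    fix C assume "C \<in> Chains (relation_of P A)"
    then have CA: "C \<subseteq> A" and chain: "\<And>q q'. q \<in> C \<Longrightarrow> q' \<in> C \<Longrightarrow> P q q' \<or> P q' q"
      by (auto simp: Chains_def relation_of_def)
    show "\<exists>u\<in>A. \<forall>a\<in>C. P a u"
    proof (cases "C = {}")
      case True
      then show ?thesis using p by (auto simp: A_def)
    next
      case False
      define u where "u x = (INF q\<in>C. q x)" for x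
      have C: "sublinear q" "q x \<le> p x" if "q \<in> C" for q x using CA that by (auto simp: A_def)
      have bb: "bdd_below ((\<lambda>q. q x) ` C)" for x
      proof (intro bdd_belowI[of _ "- p (- x)"])
        fix r assume "r \<in> (\<lambda>q. q x) ` C"
        then obtain q where "q \<in> C" "r = q x" by auto
        then show "- p (- x) \<le> r" using sublinearD(4)[OF C(1), of q x] C(2)[of q "- x"] by linarith
      qed
      have ule: "u x \<le> q x" if "q \<in> C" for q x
        unfolding u_def using that by (intro cINF_lower bb)
      have "sublinear u"
        unfolding sublinear_def
      proof (intro conjI allI impI)
        fix x y
        have *: "u (x + y) \<le> q x + q' y" if "q \<in> C" "q' \<in> C" for q q'
          using chain[OF that]
        proof
          assume "P q q'"
          then have "q' x \<le> q x" by (simp add: P_def)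
          then show ?thesis
            using ule[OF that(2), of "x + y"] sublinearD(1)[OF C(1)[OF that(2)], of x y] by linarith
        next
          assume "P q' q"
          then have "q y \<le> q' y" by (simp add: P_def)
          then show ?thesis
            using ule[OF that(1), of "x + y"] sublinearD(1)[OF C(1)[OF that(1)], of x y] by linarith
        qed
        have "u (x + y) - q' y \<le> u x" if "q' \<in> C" for q'
          unfolding u_def[of x] using *[OF _ that] False by (intro cINF_greatest) (auto simp: diff_le_eq)
        then have "u (x + y) - u x \<le> u y"
          unfolding u_def[of y] using False by (intro cINF_greatest) (auto simp: algebra_simps)
        then show "u (x + y) \<le> u x + u y" by simp
      next
        fix r :: real and x assume r: "r > 0"
        have "u (r *\<^sub>R x) / r \<le> u x"
          unfolding u_def[of x]
        proof (rule cINF_greatest[OF False])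
          fix q assume q: "q \<in> C"
          have "u (r *\<^sub>R x) \<le> r * q x"
            using ule[OF q, of "r *\<^sub>R x"] sublinearD(2)[OF C(1)[OF q] r, of x] by linarith
          then show "u (r *\<^sub>R x) / r \<le> q x" using r by (simp add: field_simps)
        qed
        then show "u (r *\<^sub>R x) \<le> r * u x" using r by (simp add: field_simps)
      qed
      moreover have "u x \<le> p x" for x
        using False ule C(2) by (meson ex_in_conv order_trans)
      ultimately have "u \<in> A" by (simp add: A_def)
      then show ?thesis using ule by (auto simp: P_def)
    qed
  qed
  then obtain m where m: "m \<in> A" "\<And>a. a \<in> A \<Longrightarrow> P m a \<Longrightarrow> a = m" by blast
  have "q = m" if "sublinear q" "\<And>x. q x \<le> m x" for q
  proof (rule m(2))
    show "q \<in> A" using that m(1) by (auto simp: A_def intro: order_trans)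
    show "P m q" using that by (simp add: P_def)
  qed
  then show ?thesis using m(1) by (auto simp: A_def)
qed

lemma hahn_banach_sublinear:
  assumes "sublinear (p :: 'v::real_vector \<Rightarrow> real)"
  obtains g where "linear g" "\<And>x. g x \<le> p x"
proof -
  obtain m where m: "sublinear m" "\<And>x. m x \<le> p x" "\<And>q. sublinear q \<Longrightarrow> (\<And>x. q x \<le> m x) \<Longrightarrow> q = m"
    using exists_minimal_sublinear[OF assms] by blast
  have add: "m (x + y) = m x + m y" for x y
    by (rule minimal_sublinear_additive[OF m(1,3)])
  have neg: "m (- x) = - m x" for x
    using add[of x "- x"] sublinearD(3)[OF m(1)] by simp
  have "m (r *\<^sub>R x) = r * m x" for r x
  proof (cases r "0::real" rule: linorder_cases)
    case less
    then show ?thesis using sublinearD(5)[OF m(1), of "- r" x] neg[of "r *\<^sub>R x"] by simp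
  qed (use sublinearD(3,5)[OF m(1)] in auto)
  then have "linear m" by (intro linearI) (simp_all add: add)
  with m(2) show ?thesis using that by blast
qed

text \<open>Both requirements are put into one sublinear functional, the infimum of
  \<open>norm (x + t *\<^sub>R (q - c)) - t * e\<close>. The entries \<open>t = 0\<close> and
  \<open>t = 1\<close> give the norm bound and the gap for every linear minorant. Convexity of
  \<open>Q\<close> yields subadditivity, and the distance \<open>e\<close> keeps the infimum
  finite.\<close>

lemma separate_point_convex:
  fixes c :: "'v::real_normed_vector"
  assumes Q: "convex Q" "Q \<noteq> {}" and e: "e > 0" "\<And>q. q \<in> Q \<Longrightarrow> norm (q - c) \<ge> e"
  obtains g where "linear g" "\<And>x. g x \<le> norm x" "\<And>q. q \<in> Q \<Longrightarrow> g q \<ge> g c + e"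
proof -
  define I where "I = {0::real..} \<times> Q"
  define v where "v x = (\<lambda>(t, q). norm (x + t *\<^sub>R (q - c)) - t * e)" for x
  define p where "p x = (INF i\<in>I. v x i)" for x
  have Ine: "I \<noteq> {}" using Q(2) by (auto simp: I_def)
  have low: "- norm x \<le> v x i" if iI: "i \<in> I" for x i
  proof -
    obtain t q where i: "i = (t, q)" "t \<ge> 0" "q \<in> Q" using iI by (auto simp: I_def)
    have "t * e \<le> t * norm (q - c)" using i e by (intro mult_left_mono) auto
    also have "\<dots> = norm (t *\<^sub>R (q - c))" using i by simp
    also have "\<dots> \<le> norm (x + t *\<^sub>R (q - c)) + norm x"
      using norm_triangle_ineq4[of "x + t *\<^sub>R (q - c)" x] by simp
    finally show ?thesis by (simp add: v_def i)
  qed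
  have bb: "bdd_below (v x ` I)" for x
    using low by (intro bdd_belowI[of _ "- norm x"]) auto
  have ple: "p x \<le> v x i" if "i \<in> I" for x i
    unfolding p_def using that by (intro cINF_lower bb)
  have "sublinear p"
    unfolding sublinear_def
  proof (intro conjI allI impI)
    fix x y
    have *: "p (x + y) \<le> v x i + v y j" if ij: "i \<in> I" "j \<in> I" for i j
    proof -
      obtain t q s r where i: "i = (t, q)" "t \<ge> 0" "q \<in> Q" "j = (s, r)" "s \<ge> 0" "r \<in> Q"
        using ij by (auto simp: I_def)
      show ?thesis
      proof (cases "t + s = 0")
        case True
        then have "t = 0" "s = 0" using i by auto
        then show ?thesis
          using ple[OF ij(1), of "x + y"] norm_triangle_ineq[of x y] by (simp add: v_def i)
      next
        case False
        then have ts: "t + s > 0" using i by auto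
        define w where "w = (t / (t + s)) *\<^sub>R q + (s / (t + s)) *\<^sub>R r"
        have "w \<in> Q"
          unfolding w_def using i ts by (intro convexD[OF Q(1)]) (auto simp flip: add_divide_distrib)
        have "(t + s) *\<^sub>R w = t *\<^sub>R q + s *\<^sub>R r" using ts by (simp add: w_def scaleR_add_right)
        then have eq: "(x + y) + (t + s) *\<^sub>R (w - c) = (x + t *\<^sub>R (q - c)) + (y + s *\<^sub>R (r - c))"
          by (simp add: algebra_simps)
        have "p (x + y) \<le> v (x + y) (t + s, w)"
          using \<open>w \<in> Q\<close> ts by (intro ple) (simp add: I_def)
        also have "\<dots> \<le> v x i + v y j"
          unfolding v_def i prod.case eq
          using norm_triangle_ineq[of "x + t *\<^sub>R (q - c)" "y + s *\<^sub>R (r - c)"] by (simp add: algebra_simps)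
        finally show ?thesis .
      qed
    qed
    have "p (x + y) - v y j \<le> p x" if "j \<in> I" for j
      unfolding p_def[of x] using *[OF _ that] Ine by (intro cINF_greatest) (auto simp: diff_le_eq)
    then have "p (x + y) - p x \<le> p y"
      unfolding p_def[of y] using Ine by (intro cINF_greatest) (auto simp: algebra_simps)
    then show "p (x + y) \<le> p x + p y" by simp
  next
    fix r :: real and x assume r: "r > 0"
    have "p (r *\<^sub>R x) / r \<le> p x"
      unfolding p_def[of x]
    proof (rule cINF_greatest[OF Ine])
      fix i assume "i \<in> I"
      then obtain t q where i: "i = (t, q)" "t \<ge> 0" "q \<in> Q" by (auto simp: I_def)
      have "p (r *\<^sub>R x) \<le> v (r *\<^sub>R x) (r * t, q)" using i r by (intro ple) (simp add: I_def)
      also have "\<dots> = r * v x i"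
      proof -
        have "r *\<^sub>R x + (r * t) *\<^sub>R (q - c) = r *\<^sub>R (x + t *\<^sub>R (q - c))" by (simp add: scaleR_add_right)
        then show ?thesis using r by (simp add: v_def i(1) right_diff_distrib)
      qed
      finally show "p (r *\<^sub>R x) / r \<le> v x i" using r by (simp add: field_simps)
    qed
    then show "p (r *\<^sub>R x) \<le> r * p x" using r by (simp add: field_simps)
  qed
  then obtain g where g: "linear g" "\<And>x. g x \<le> p x"
    by (rule hahn_banach_sublinear) blast
  obtain q0 where q0: "q0 \<in> Q" using Q(2) by blast
  have "g x \<le> norm x" for x
    using g(2)[of x] ple[of "(0, q0)" x] q0 by (simp add: I_def v_def)
  moreover have "g q \<ge> g c + e" if "q \<in> Q" for q
  proof -
    have "g (- (q - c)) \<le> - e"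
      using g(2)[of "- (q - c)"] ple[of "(1, q)" "- (q - c)"] that by (simp add: I_def v_def)
    moreover have "g (- (q - c)) = g c - g q"
      using linear_diff[OF g(1), of c q] by simp
    ultimately show ?thesis by simp
  qed
  ultimately show ?thesis using that g(1) by blast
qed

text \<open>The usual \<open>g a - \<i> * g (\<i> a)\<close>. Membership in
  \<open>functionals\<close> asks only for some bound, here twice the norm.\<close>

lemma complexify_functional:
  fixes g :: "'a::cstar_algebra \<Rightarrow> real"
  assumes g: "linear g" "\<And>x. g x \<le> norm x"
  obtains f where "f \<in> functionals cstar_alg" "\<And>a. Re (f a) = g a"
proof -
  have ab: "\<bar>g x\<bar> \<le> norm x" for x
    using g(2)[of x] g(2)[of "- x"] linear_neg[OF g(1), of x] by simp
  define f where "f a = Complex (g a) (- g (\<i> *\<^sub>C a))" for a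
  have add: "f (a + b) = f a + f b" for a b
    by (simp add: f_def scaleC_add_right linear_add[OF g(1)] complex_eq_iff)
  have scale: "f (c *\<^sub>C a) = c * f a" for c a
  proof -
    have ca: "c *\<^sub>C a = Re c *\<^sub>R a + Im c *\<^sub>R (\<i> *\<^sub>C a)"
      unfolding scaleR_scaleC scaleC_scaleC scaleC_add_left[symmetric]
      by (rule arg_cong[of _ _ "\<lambda>c. c *\<^sub>C a"]) (simp add: complex_eq_iff)
    have ica: "\<i> *\<^sub>C (c *\<^sub>C a) = Re c *\<^sub>R (\<i> *\<^sub>C a) + (- Im c) *\<^sub>R a"
      unfolding scaleR_scaleC scaleC_scaleC scaleC_add_left[symmetric]
      by (rule arg_cong[of _ _ "\<lambda>c. c *\<^sub>C a"]) (simp add: complex_eq_iff)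
    have "g (c *\<^sub>C a) = Re c * g a + Im c * g (\<i> *\<^sub>C a)"
      by (subst ca) (simp add: linear_add[OF g(1)] linear_scale[OF g(1)])
    moreover have "g (\<i> *\<^sub>C (c *\<^sub>C a)) = Re c * g (\<i> *\<^sub>C a) + (- Im c) * g a"
      unfolding ica by (simp only: linear_add[OF g(1)] linear_scale[OF g(1)] real_scaleR_def)
    ultimately show ?thesis
      by (simp add: f_def complex_eq_iff)
  qed
  have bound: "cmod (f a) \<le> 2 * norm a" for a
  proof -
    have "cmod (f a) \<le> \<bar>Re (f a)\<bar> + \<bar>Im (f a)\<bar>" by (rule cmod_le)
    also have "\<dots> \<le> norm a + norm (\<i> *\<^sub>C a)"
      using ab[of a] ab[of "\<i> *\<^sub>C a"] by (simp add: f_def)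
    finally show ?thesis by (simp add: norm_scaleC)
  qed
  have "f \<in> functionals cstar_alg"
    unfolding functionals_iff cstar_alg_sel using add scale bound by (auto simp: extensional_def)
  then show ?thesis using that[of f] by (simp add: f_def)
qed

context finite_numerical_index
begin

section \<open>The index element\<close>

lemma embed_compact_functional:
  assumes T: "T \<in> compact_r X"
  shows "embed \<K> T \<in> functionals (dual \<K>)"
  unfolding second_dual_iff
proof (intro conjI ballI allI exI[of _ "op_norm_r X T"])
  obtain S where S: "is_adjoint X T S" using compact_r_is_adjoint[OF T] .
  show "embed \<K> T \<in> extensional (functionals \<K>)" by (simp add: embed_def)
  fix f g assume "f \<in> functionals \<K>" "g \<in> functionals \<K>"
  then show "embed \<K> T (vadd (dual \<K>) f g) = embed \<K> T f + embed \<K> T g"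
    using functionals_add[OF vclosed_compact, of f g] T by (simp add: embed_def)
next
  fix c f assume "f \<in> functionals \<K>"
  then show "embed \<K> T (vscale (dual \<K>) c f) = c * embed \<K> T f"
    using functionals_scale[OF vclosed_compact, of f c] T by (simp add: embed_def)
next
  obtain S where S: "is_adjoint X T S" using compact_r_is_adjoint[OF T] .
  fix f assume f: "f \<in> functionals \<K>"
  show "cmod (embed \<K> T f) \<le> op_norm_r X T * dual_norm f"
    using dual_norm_bound[OF f T op_norm[OF S] op_norm_nonneg[OF S]] f by (simp add: embed_def mult.commute)
qed

lemma cstar_functional_bdd_above:
  assumes g: "g \<in> functionals (cstar_alg :: 'a nalg)"
  shows "bdd_above ((\<lambda>v. cmod (g v)) ` {v \<in> elems (cstar_alg :: 'a nalg). vnorm cstar_alg v \<le> 1})"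
proof -
  obtain C where C: "\<And>a. cmod (g a) \<le> C * norm a"
    using g by (simp add: functionals_iff) blast
  show ?thesis
  proof (rule bdd_aboveI[of _ "\<bar>C\<bar>"])
    fix r assume "r \<in> (\<lambda>v. cmod (g v)) ` {v \<in> elems (cstar_alg :: 'a nalg). vnorm cstar_alg v \<le> 1}"
    then obtain v where v: "norm v \<le> 1" "r = cmod (g v)" by auto
    have "C * norm v \<le> \<bar>C\<bar> * norm v" by (intro mult_right_mono) auto
    also have "\<dots> \<le> \<bar>C\<bar> * 1" using v by (intro mult_left_mono) auto
    finally show "r \<le> \<bar>C\<bar>" using C[of v] v by simp
  qed
qed

definition cstar_dual_norm :: "('a \<Rightarrow> complex) \<Rightarrow> real" where
  "cstar_dual_norm g = vnorm (dual (cstar_alg :: 'a nalg)) g"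

lemma cstar_dual_norm_nonneg: "g \<in> functionals cstar_alg \<Longrightarrow> cstar_dual_norm g \<ge> 0"
  unfolding cstar_dual_norm_def dual_sel by (rule cSUP_upper2[OF cstar_functional_bdd_above, of _ 0]) auto

lemma cstar_functional_bound:
  assumes g: "g \<in> functionals cstar_alg"
  shows "cmod (g a) \<le> cstar_dual_norm g * norm a"
proof (cases "a = 0")
  case True
  obtain C where "\<And>a. cmod (g a) \<le> C * norm a"
    using g by (simp add: functionals_iff) blast
  from this[of 0] show ?thesis using True by simp
next
  case False
  have "cmod (g (complex_of_real (1 / norm a) *\<^sub>C a)) \<le> cstar_dual_norm g"
    unfolding cstar_dual_norm_def dual_sel using False
    by (intro cSUP_upper cstar_functional_bdd_above[OF g]) (simp add: norm_scaleC norm_divide)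
  moreover have "g (complex_of_real (1 / norm a) *\<^sub>C a) = complex_of_real (1 / norm a) * g a"
    using g by (simp add: functionals_iff)
  ultimately have "cmod (complex_of_real (1 / norm a) * g a) \<le> cstar_dual_norm g" by simp
  then show ?thesis using False by (simp add: norm_mult norm_divide field_simps)
qed

lemma functional_F:
  assumes g: "g \<in> functionals cstar_alg"
  shows "(\<lambda>T\<in>compact_r X. g (F T)) \<in> functionals \<K>"
proof -
  obtain C where C: "\<And>a. cmod (g a) \<le> C * norm a"
    using g by (simp add: functionals_iff) blast
  obtain D where D: "\<And>T. T \<in> compact_r X \<Longrightarrow> norm (F T) \<le> D * op_norm_r X T"
    using index_map_spec by (simp add: continuous_linear_maps_def) blast
  have "cmod (g (F T)) \<le> (\<bar>C\<bar> * D) * op_norm_r X T" if "T \<in> compact_r X" for T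
  proof -
    have "C * norm (F T) \<le> \<bar>C\<bar> * norm (F T)" by (intro mult_right_mono) auto
    also have "\<dots> \<le> \<bar>C\<bar> * (D * op_norm_r X T)" using D[OF that] by (intro mult_left_mono) auto
    finally show ?thesis using C[of "F T"] by simp
  qed
  then have ex: "\<exists>C. \<forall>T\<in>compact_r X. cmod (g (F T)) \<le> C * op_norm_r X T" by blast
  show ?thesis
    using g ex
    by (simp add: functionals_iff compact_add compact_scale F_add F_scale)
qed

text \<open>The double transpose of the index map. The two restrictions produce the extensional
  values that \<open>linear_maps\<close> and the second dual require.\<close>

definition index_bidual :: "((('x \<Rightarrow> 'x) \<Rightarrow> complex) \<Rightarrow> complex) \<Rightarrow> (('a \<Rightarrow> complex) \<Rightarrow> complex)" where
  "index_bidual = (\<lambda>m\<in>functionals (dual \<K>). \<lambda>g\<in>functionals cstar_alg. m (\<lambda>T\<in>compact_r X. g (F T)))"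

lemma vclosed_cstar: "vclosed cstar_alg"
  by (simp add: vclosed_def)

lemma index_bidual_functional:
  assumes m: "m \<in> functionals (dual \<K>)"
  shows "index_bidual m \<in> functionals (dual cstar_alg)"
proof -
  obtain C where C: "\<And>g. g \<in> functionals \<K> \<Longrightarrow> cmod (m g) \<le> C * dual_norm g"
    using m unfolding second_dual_iff by blast
  obtain l where l: "l > 0" "\<And>T M. T \<in> compact_r X \<Longrightarrow> op_bound X M T \<Longrightarrow> M \<ge> 0 \<Longrightarrow> norm (F T) \<le> l * M"
    by (rule F_bound) blast
  have bound: "cmod (m (\<lambda>T\<in>compact_r X. g (F T))) \<le> (\<bar>C\<bar> * l) * cstar_dual_norm g" if g: "g \<in> functionals cstar_alg" for g
  proof -
    note gF = functional_F[OF g]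
    have "dual_norm (\<lambda>T\<in>compact_r X. g (F T)) \<le> cstar_dual_norm g * l"
    proof (rule dual_norm_least)
      show "0 \<le> cstar_dual_norm g * l" using cstar_dual_norm_nonneg[OF g] l(1) by simp
      fix T assume T: "T \<in> compact_r X" "op_bound X 1 T"
      have "cmod (g (F T)) \<le> cstar_dual_norm g * norm (F T)" by (rule cstar_functional_bound[OF g])
      also have "\<dots> \<le> cstar_dual_norm g * l" using l(2)[OF T] cstar_dual_norm_nonneg[OF g] by (intro mult_left_mono) auto
      finally show "cmod ((\<lambda>T\<in>compact_r X. g (F T)) T) \<le> cstar_dual_norm g * l" using T by simp
    qed
    then have "\<bar>C\<bar> * dual_norm (\<lambda>T\<in>compact_r X. g (F T)) \<le> \<bar>C\<bar> * (cstar_dual_norm g * l)" by (intro mult_left_mono) auto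
    moreover have "C * dual_norm (\<lambda>T\<in>compact_r X. g (F T)) \<le> \<bar>C\<bar> * dual_norm (\<lambda>T\<in>compact_r X. g (F T))"
      using dual_norm_nonneg[OF gF] by (intro mult_right_mono) auto
    ultimately show ?thesis using C[OF gF] by (simp add: mult_ac)
  qed
  have iff: "n \<in> functionals (dual (cstar_alg :: 'a nalg)) \<longleftrightarrow> n \<in> extensional (functionals cstar_alg) \<and>
     (\<forall>f\<in>functionals cstar_alg. \<forall>g\<in>functionals cstar_alg. n (\<lambda>a. f a + g a) = n f + n g) \<and>
     (\<forall>c. \<forall>f\<in>functionals cstar_alg. n (\<lambda>a. c * f a) = c * n f) \<and>
     (\<exists>C. \<forall>f\<in>functionals cstar_alg. cmod (n f) \<le> C * cstar_dual_norm f)" for n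
    unfolding functionals_iff[of n] cstar_dual_norm_def by (simp add: restrict_UNIV)
  have add: "index_bidual m (\<lambda>a. f a + g a) = index_bidual m f + index_bidual m g"
    if fg: "f \<in> functionals cstar_alg" "g \<in> functionals cstar_alg" for f g
  proof -
    have "(\<lambda>T\<in>compact_r X. f (F T) + g (F T))
        = vadd (dual \<K>) (\<lambda>T\<in>compact_r X. f (F T)) (\<lambda>T\<in>compact_r X. g (F T))"
      by (auto simp: fun_eq_iff)
    then show ?thesis
      using functionals_add[OF vclosed_cstar fg] fg m
        second_dual_add[OF m functional_F[OF fg(1)] functional_F[OF fg(2)]]
      by (simp add: index_bidual_def restrict_UNIV del: dual_sel)
  qed
  have scale: "index_bidual m (\<lambda>a. c * f a) = c * index_bidual m f"
    if f: "f \<in> functionals cstar_alg" for c f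
  proof -
    have "(\<lambda>T\<in>compact_r X. c * f (F T)) = vscale (dual \<K>) c (\<lambda>T\<in>compact_r X. f (F T))"
      by (auto simp: fun_eq_iff)
    then show ?thesis
      using functionals_scale[OF vclosed_cstar f, of c] f m second_dual_scale[OF m functional_F[OF f], of c]
      by (simp add: index_bidual_def restrict_UNIV del: dual_sel)
  qed
  have "\<exists>C. \<forall>f\<in>functionals cstar_alg. cmod (index_bidual m f) \<le> C * cstar_dual_norm f"
    using bound m by (intro exI[of _ "\<bar>C\<bar> * l"]) (simp add: index_bidual_def del: dual_sel)
  then show ?thesis
    unfolding iff using add scale m by (simp add: index_bidual_def del: dual_sel)
qed

lemma index_bidual_embed:
  assumes T: "T \<in> compact_r X"
  shows "index_bidual (embed \<K> T) = embed cstar_alg (F T)"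
proof (rule extensionalityI)
  show "index_bidual (embed \<K> T) \<in> extensional (functionals cstar_alg)"
    using embed_compact_functional[OF T] by (simp add: index_bidual_def)
  show "embed cstar_alg (F T) \<in> extensional (functionals cstar_alg)"
    by (simp add: embed_def)
  fix g :: "'a \<Rightarrow> complex" assume g: "g \<in> functionals cstar_alg"
  then show "index_bidual (embed \<K> T) g = embed cstar_alg (F T) g"
    using embed_compact_functional[OF T] functional_F[OF g] T
    by (simp add: index_bidual_def del: dual_sel) (simp add: embed_def)
qed

lemma continuous_index_bidual: "continuous_on (functionals (dual \<K>)) index_bidual"
proof (rule continuous_on_coordinatewise_then_product)
  fix g :: "'a \<Rightarrow> complex"
  have "continuous_on (functionals (dual \<K>)) (\<lambda>m. if g \<in> functionals cstar_alg then m (\<lambda>T\<in>compact_r X. g (F T)) else undefined)"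
  proof (cases "g \<in> functionals cstar_alg")
    case True
    then show ?thesis
      by (simp add: continuous_on_product_then_coordinatewise[OF continuous_on_id])
  qed simp
  then show "continuous_on (functionals (dual \<K>)) (\<lambda>m. index_bidual m g)"
    by (rule continuous_on_eq) (auto simp: index_bidual_def simp del: dual_sel)
qed

lemma index_bidual_linear: "index_bidual \<in> linear_maps (enveloping_vN \<K>) (enveloping_vN cstar_alg)"
proof -
  have closed: "(\<lambda>f\<in>functionals \<K>. m f + n f) \<in> functionals (dual \<K>)"
    "(\<lambda>f\<in>functionals \<K>. c * m f) \<in> functionals (dual \<K>)"
    if "m \<in> functionals (dual \<K>)" "n \<in> functionals (dual \<K>)" for m n c
  proof -
    have "(\<lambda>_. 0) \<in> functionals (cstar_alg :: 'a nalg)"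
      by (auto simp: functionals_iff extensional_def intro: exI[of _ 0])
    then have "functionals \<K> \<noteq> {}" using functional_F by blast
    then have "vclosed (dual \<K>)"
      using functionals_add[OF vclosed_compact] functionals_scale[OF vclosed_compact]
      by (auto simp: vclosed_def)
    from functionals_add[OF this that] functionals_scale[OF this that(1), of c]
    show "(\<lambda>f\<in>functionals \<K>. m f + n f) \<in> functionals (dual \<K>)"
      "(\<lambda>f\<in>functionals \<K>. c * m f) \<in> functionals (dual \<K>)" by auto
  qed
  show ?thesis
    unfolding linear_maps_def
  proof (intro CollectI conjI ballI allI)
    show "index_bidual \<in> elems (enveloping_vN \<K>) \<rightarrow>\<^sub>E elems (enveloping_vN cstar_alg)"
      using index_bidual_functional by (simp add: PiE_def index_bidual_def)
  next
    fix m n assume mn: "m \<in> elems (enveloping_vN \<K>)" "n \<in> elems (enveloping_vN \<K>)"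
    then have "m \<in> functionals (dual \<K>)" "n \<in> functionals (dual \<K>)" by auto
    then show "index_bidual (vadd (enveloping_vN \<K>) m n) = vadd (enveloping_vN cstar_alg) (index_bidual m) (index_bidual n)"
      using closed(1)[of m n] functional_F by (auto simp: index_bidual_def fun_eq_iff)
  next
    fix c m assume "m \<in> elems (enveloping_vN \<K>)"
    then have "m \<in> functionals (dual \<K>)" by auto
    then show "index_bidual (vscale (enveloping_vN \<K>) c m) = vscale (enveloping_vN cstar_alg) c (index_bidual m)"
      using closed(2)[of m m c] functional_F by (auto simp: index_bidual_def fun_eq_iff)
  qed
qed

lemma normal_extension_index_map: "normal_extension \<K> cstar_alg F = index_bidual"
  unfolding normal_extension_def
proof (rule the_equality)
  show "index_bidual \<in> linear_maps (enveloping_vN \<K>) (enveloping_vN cstar_alg) \<and>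
      continuous_on (elems (enveloping_vN \<K>)) index_bidual \<and>
      (\<forall>T\<in>elems \<K>. index_bidual (embed \<K> T) = embed cstar_alg (F T))"
    using index_bidual_linear continuous_index_bidual index_bidual_embed by simp
  fix G assume G: "G \<in> linear_maps (enveloping_vN \<K>) (enveloping_vN cstar_alg) \<and>
      continuous_on (elems (enveloping_vN \<K>)) G \<and>
      (\<forall>T\<in>elems \<K>. G (embed \<K> T) = embed cstar_alg (F T))"
  show "G = index_bidual"
  proof (rule normal_maps_eq[OF vclosed_compact])
    show "embed \<K> T \<in> functionals (dual \<K>)" if "T \<in> elems \<K>" for T
      using embed_compact_functional that by simp
    show "G \<in> extensional (functionals (dual \<K>))" "continuous_on (functionals (dual \<K>)) G"
      using G by (auto simp: linear_maps_def PiE_def)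
    show "index_bidual \<in> extensional (functionals (dual \<K>))" by (simp add: index_bidual_def)
    show "continuous_on (functionals (dual \<K>)) index_bidual" by (rule continuous_index_bidual)
    show "G (embed \<K> T) = index_bidual (embed \<K> T)" if "T \<in> elems \<K>" for T
      using G that index_bidual_embed by simp
  qed
qed

text \<open>The concrete meaning of the index element: the weak* limit of \<open>F u\<close>. From
  here on \<open>r_Ind\<close> enters through this limit.\<close>

lemma r_Ind_tendsto:
  assumes g: "g \<in> functionals cstar_alg"
  shows "((\<lambda>u. g (F u)) \<longlongrightarrow> r_Ind X g) approx_filter"
proof -
  have eq: "r_Ind X g = kunit (\<lambda>T\<in>compact_r X. g (F T))"
    unfolding r_Ind_def normal_extension_index_map unit_of_compact
    using kunit_functional g by (simp add: index_bidual_def del: dual_sel)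
  have "eventually (\<lambda>u. (\<lambda>T\<in>compact_r X. g (F T)) u = g (F u)) approx_filter"
    using eventually_approx_filter_compact by eventually_elim simp
  then show ?thesis
    unfolding eq using kunit_tendsto[OF functional_F[OF g]] by (rule Lim_transform_eventually[rotated])
qed

lemma functional_mult:
  assumes g: "g \<in> functionals (cstar_alg :: 'a nalg)"
  shows "(\<lambda>b. g (a * b * c)) \<in> functionals cstar_alg"
proof -
  obtain C where C: "\<And>a. cmod (g a) \<le> C * norm a"
    using g by (simp add: functionals_iff) blast
  have "cmod (g (a * b * c)) \<le> (\<bar>C\<bar> * (norm a * norm c)) * norm b" for b
  proof -
    have "norm (a * b * c) \<le> norm a * norm b * norm c"
      by (rule order_trans[OF norm_mult_ineq mult_right_mono[OF norm_mult_ineq]]) simp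
    then have "\<bar>C\<bar> * norm (a * b * c) \<le> \<bar>C\<bar> * (norm a * norm b * norm c)"
      by (intro mult_left_mono) auto
    moreover have "C * norm (a * b * c) \<le> \<bar>C\<bar> * norm (a * b * c)"
      by (intro mult_right_mono) auto
    ultimately show ?thesis using C[of "a * b * c"] by (simp add: mult_ac)
  qed
  then have "\<exists>D. \<forall>b. cmod (g (a * b * c)) \<le> D * norm b" by blast
  then show ?thesis
    using g by (simp add: functionals_iff distrib_left distrib_right mult_scaleC_left mult_scaleC_right extensional_def)
qed

text \<open>The product of \<open>r_Ind X\<close> with \<open>star a\<close> on the right lies in A,
  say at \<open>c1\<close>, and the limit is \<open>a * c1\<close>. Unfolding the Arens product at
  \<open>g (a * _)\<close> gives \<open>r_Ind X\<close> evaluated at the functional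
  \<open>g (a * _ * star a)\<close>.\<close>

lemma multiplier_limit:
  assumes m: "r_Ind X \<in> multiplier_algebra cstar_alg"
  obtains c where "\<And>g. g \<in> functionals cstar_alg \<Longrightarrow> ((\<lambda>u. g (a * F u * star a)) \<longlongrightarrow> g c) approx_filter"
proof -
  have "arens cstar_alg (r_Ind X) (embed cstar_alg (star a)) \<in> range (embed (cstar_alg :: 'a nalg))"
    using m by (auto simp: multiplier_algebra_def)
  then obtain c1 where c1: "arens cstar_alg (r_Ind X) (embed cstar_alg (star a)) = embed (cstar_alg :: 'a nalg) c1"
    by auto
  have "((\<lambda>u. g (a * F u * star a)) \<longlongrightarrow> g (a * c1)) approx_filter" if g: "g \<in> functionals cstar_alg" for g
  proof -
    have g1: "arens1 cstar_alg h b = (\<lambda>x. h (b * x))" for h :: "'a \<Rightarrow> complex" and b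
      by (simp add: arens1_def restrict_UNIV)
    have ga: "(\<lambda>x. g (b * x)) \<in> functionals cstar_alg" if gf: "g \<in> functionals cstar_alg" for b and g :: "'a \<Rightarrow> complex"
    proof -
      obtain C where C: "\<And>a. cmod (g a) \<le> C * norm a"
        using gf by (simp add: functionals_iff) blast
      have "cmod (g (b * x)) \<le> (\<bar>C\<bar> * norm b) * norm x" for x
      proof -
        have "\<bar>C\<bar> * norm (b * x) \<le> \<bar>C\<bar> * (norm b * norm x)"
          by (intro mult_left_mono norm_mult_ineq) auto
        moreover have "C * norm (b * x) \<le> \<bar>C\<bar> * norm (b * x)"
          by (intro mult_right_mono) auto
        ultimately show ?thesis using C[of "b * x"] by simp
      qed
      then have "\<exists>D. \<forall>x. cmod (g (b * x)) \<le> D * norm x" by blast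
      then show ?thesis
        using gf by (simp add: functionals_iff distrib_left mult_scaleC_right extensional_def)
    qed
    have "g (a * c1) = embed cstar_alg c1 (\<lambda>x. g (a * x))"
      using ga[OF g] by (simp add: embed_def)
    also have "\<dots> = r_Ind X (arens2 cstar_alg (embed cstar_alg (star a)) (\<lambda>x. g (a * x)))"
      unfolding c1[symmetric] using ga[OF g] by (simp add: arens_def)
    also have "arens2 cstar_alg (embed cstar_alg (star a)) (\<lambda>x. g (a * x)) = (\<lambda>b. g (a * b * star a))"
      using ga[OF g] ga[OF ga[OF g]] by (simp add: arens2_def restrict_UNIV g1 embed_def mult.assoc)
    finally have "g (a * c1) = r_Ind X (\<lambda>b. g (a * b * star a))" .
    then show ?thesis
      using r_Ind_tendsto[OF functional_mult[OF g, of a "star a"]] by simp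
  qed
  then show ?thesis using that by blast
qed

end

section \<open>Compactness of the left action\<close>

context finite_numerical_index
begin

lemma F_rs: "T \<in> compact_r X \<Longrightarrow> F (\<lambda>z. rs t (T z)) = t *\<^sub>R F T"
  by (simp add: F_scale scaleR_scaleC)

text \<open>Mazur's argument. Since the approximate units in a given set are convex, no combination
  has to be named: some member of the set already comes close in norm, however far along the filter
  the set is.\<close>

lemma multiplier_norm_limit:
  assumes m: "r_Ind X \<in> multiplier_algebra cstar_alg"
  obtains c where "\<And>xs \<delta> e. \<delta> > 0 \<Longrightarrow> e > 0 \<Longrightarrow> \<exists>u\<in>approx_units xs \<delta>. norm (a * F u * star a - c) < e"
proof -
  obtain c where c: "\<And>g. g \<in> functionals cstar_alg \<Longrightarrow> ((\<lambda>u. g (a * F u * star a)) \<longlongrightarrow> g c) approx_filter"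
    using multiplier_limit[OF m, of a] by blast
  have "\<exists>u\<in>approx_units xs \<delta>. norm (a * F u * star a - c) < e" if \<delta>: "\<delta> > 0" and e: "e > 0" for xs \<delta> e
  proof (rule ccontr)
    assume neg: "\<not> ?thesis"
    define Q where "Q = (\<lambda>u. a * F u * star a) ` approx_units xs \<delta>"
    have "convex Q"
    proof (rule convexI)
      fix x y and s t :: real assume x: "x \<in> Q" and y: "y \<in> Q" and st: "s \<ge> 0" "t \<ge> 0" "s + t = 1"
      obtain u v where u: "u \<in> approx_units xs \<delta>" "x = a * F u * star a" and v: "v \<in> approx_units xs \<delta>" "y = a * F v * star a"
        using x y by (auto simp: Q_def)
      have t: "t = 1 - s" using st by simp
      have "F (\<lambda>z. rs s (u z) + rs (1 - s) (v z)) = s *\<^sub>R F u + (1 - s) *\<^sub>R F v"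
        using approx_unitsD(5)[OF u(1)] approx_unitsD(5)[OF v(1)]
        by (simp only: F_add compact_scale F_rs)
      then have "a * F (\<lambda>z. rs s (u z) + rs (1 - s) (v z)) * star a = s *\<^sub>R x + t *\<^sub>R y"
        by (simp add: t u v distrib_left distrib_right)
      then show "s *\<^sub>R x + t *\<^sub>R y \<in> Q"
        using approx_units_convex[OF u(1) v(1), of s] st unfolding Q_def by (intro image_eqI[OF sym]) auto
    qed
    moreover have "Q \<noteq> {}" using approx_units_nonempty[OF \<delta>] by (simp add: Q_def)
    moreover have "norm (q - c) \<ge> e" if "q \<in> Q" for q
      using neg that by (force simp: Q_def)
    ultimately obtain g where g: "linear g" "\<And>x. g x \<le> norm x" "\<And>q. q \<in> Q \<Longrightarrow> g q \<ge> g c + e"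
      using separate_point_convex[OF _ _ e] by blast
    obtain f where f: "f \<in> functionals cstar_alg" "\<And>a. Re (f a) = g a"
      using complexify_functional[OF g(1,2)] by blast
    have "((\<lambda>u. Re (f (a * F u * star a))) \<longlongrightarrow> Re (f c)) approx_filter"
      by (rule tendsto_Re[OF c[OF f(1)]])
    then have "eventually (\<lambda>u. g (a * F u * star a) < g c + e) approx_filter"
      unfolding f(2) using e by (intro order_tendstoD(2)) auto
    moreover have "eventually (\<lambda>u. g (a * F u * star a) \<ge> g c + e) approx_filter"
      using eventually_approx_filter_approx_units[OF \<delta>, of xs] by (rule eventually_mono) (auto simp: Q_def intro: g(3))
    ultimately have "eventually (\<lambda>u. False) approx_filter" by eventually_elim simp
    then show False using approx_filter_neq_bot by (simp add: trivial_limit_def)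
  qed
  then show ?thesis using that by blast
qed

text \<open>The operator is \<open>(v - v\<^sup>2) + v (1 - u) v\<close>, and its complement is
  \<open>(1 - v) + v u v\<close>.\<close>

lemma op_positive_minus_conj:
  assumes u: "u \<in> approx_units xs \<delta>" and v: "v \<in> approx_units ys \<epsilon>"
  shows "op_positive X (\<lambda>z. v z - v (u (v z)))" "op_positive X (\<lambda>z. z - (v z - v (u (v z))))"
proof -
  note va = approx_unitsD(3)[OF v]
  have "op_positive X (\<lambda>z. (v z - v (v z)) + v (v z - u (v z)))"
    by (intro op_positive_add op_positive_sub_square approx_unitsD[OF v] op_positive_conj[OF approx_unitsD(2)[OF u] va])
  then show "op_positive X (\<lambda>z. v z - v (u (v z)))"
    by (simp add: is_adjoint_linear[OF va])
  have "op_positive X (\<lambda>z. (z - v z) + v (u (v z)))"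
    by (intro op_positive_add approx_unitsD(2)[OF v] op_positive_conj[OF approx_unitsD(1)[OF u] va])
  then show "op_positive X (\<lambda>z. z - (v z - v (u (v z))))"
    by (simp add: algebra_simps)
qed

text \<open>If \<open>a F(u) a\<^sup>*\<close> and \<open>a F(v) a\<^sup>*\<close> are both close to the limit and \<open>v\<close> is almost a unit for \<open>u\<close>, then
  the Pimsner-Popa inequality for the positive operator \<open>v - v u v\<close> shows that \<open>a u a\<^sup>*\<close> and \<open>a v a\<^sup>*\<close> are
  close; letting \<open>v\<close> tend to the identity gives \<open>a u a\<^sup>* \<approx> a a\<^sup>*\<close>.\<close>

lemma left_action_approx:
  assumes m: "r_Ind X \<in> multiplier_algebra cstar_alg" and e: "e > 0"
  obtains u where "u \<in> approx_units [] 1"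
    "op_bound X e (\<lambda>x. lact X a (lact X (star a) x) - lact X a (u (lact X (star a) x)))"
proof -
  obtain c where c: "\<And>xs \<delta> e. \<delta> > 0 \<Longrightarrow> e > 0 \<Longrightarrow> \<exists>u\<in>approx_units xs \<delta>. norm (a * F u * star a - c) < e"
    using multiplier_norm_limit[OF m, of a] by blast
  obtain C where C: "C > 0" "\<And>T. T \<in> positive_compacts \<Longrightarrow> op_bound X (C * norm (F T)) T"
    using positive_compacts_bound by blast
  obtain l where l: "l > 0" "\<And>T M. T \<in> compact_r X \<Longrightarrow> op_bound X M T \<Longrightarrow> M \<ge> 0 \<Longrightarrow> norm (F T) \<le> l * M"
    by (rule F_bound) blast
  obtain M where M: "M > 0" "op_bound X M (lact X a)" using is_adjoint_bounded[OF is_adjoint_lact] .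
  note M' = op_bound_is_adjoint[OF is_adjoint_lact M(2)]
  \<comment> \<open>Both \<open>u\<close> and \<open>v\<close> are \<open>\<epsilon>\<close>-close
    to the limit, and the lower bound of the index map costs the factor \<open>C\<close>.\<close>
  define \<epsilon> where "\<epsilon> = e / (2 * C)"
  have \<epsilon>: "\<epsilon> > 0" using e C(1) by (simp add: \<epsilon>_def)
  obtain u where u: "u \<in> approx_units [] 1" "norm (a * F u * star a - c) < \<epsilon>"
    using c[of 1 \<epsilon> "[]"] \<epsilon> by auto
  note uK = approx_unitsD(5)[OF u(1)] and uadj = approx_unitsD(3)[OF u(1)]
  define W where "W T = (\<lambda>z. lact X a (T (lact X (star a) z)))" for T
  have "op_bound X e (\<lambda>x. lact X a (lact X (star a) x) - lact X a (u (lact X (star a) x)))"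
    unfolding op_bound_def
  proof (rule allI, rule field_le_epsilon)
    \<comment> \<open>Only \<open>u\<close> is fixed in advance; \<open>v\<close> may depend on
      \<open>x\<close> and on the slack \<open>d\<close>. The constant \<open>B\<close> below
      collects the coefficients of the errors caused by \<open>v\<close>.\<close>
    fix x and d :: real assume d: "d > 0"
    define y where "y = lact X (star a) x"
    define B where "B = M + (2 * C * (norm a * l * norm a) + 2 * M * M) * nr x"
    have B: "B > 0"
      unfolding B_def using M(1) C(1) l(1)
      by (intro add_pos_nonneg mult_nonneg_nonneg add_nonneg_nonneg) auto
    define \<eta> where "\<eta> = d / B"
    have \<eta>: "\<eta> > 0" using d B by (simp add: \<eta>_def)
    have "eventually (\<lambda>v. v \<in> approx_units [y] \<eta> \<and> op_bound X \<eta> (\<lambda>z. v (u z) - u z) \<and> op_bound X \<eta> (\<lambda>z. u (v z) - u z)) approx_filter"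
      using eventually_approx_filter_approx_units[OF \<eta>, of "[y]"] eventually_approx_filter_left_unit[OF uK \<eta>] eventually_approx_filter_right_unit[OF uK \<eta>]
      by eventually_elim simp
    then obtain xs \<delta> where xs: "\<delta> > 0" "\<And>v. v \<in> approx_units xs \<delta> \<Longrightarrow>
        v \<in> approx_units [y] \<eta> \<and> op_bound X \<eta> (\<lambda>z. v (u z) - u z) \<and> op_bound X \<eta> (\<lambda>z. u (v z) - u z)"
      unfolding eventually_approx_filter by blast
    obtain v where v: "v \<in> approx_units xs \<delta>" "norm (a * F v * star a - c) < \<epsilon>"
      using c[OF xs(1) \<epsilon>] by blast
    note v' = xs(2)[OF v(1)]
    note vK = approx_unitsD(5)[OF v(1)] and vadj = approx_unitsD(3)[OF v(1)]
    define k where "k = (\<lambda>z. v z - v (u (v z)))"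
    define r where "r = (\<lambda>z. v (u (v z)) - u z)"
    have vuv: "(\<lambda>z. v (u (v z))) \<in> compact_r X" by (rule compact_comp[OF uK vadj vadj])
    have kK: "k \<in> compact_r X" and rK: "r \<in> compact_r X"
      unfolding k_def r_def by (rule compact_diff[OF vK vuv], rule compact_diff[OF vuv uK])
    have "op_bound X (1 * \<eta> + \<eta>) (\<lambda>z. v (u (v z) - u z) + (v (u z) - u z))"
      using v' by (intro op_bound_add op_bound_comp approx_unitsD(4)[OF v(1)]) auto
    then have rb: "op_bound X (2 * \<eta>) r"
      by (simp add: r_def is_adjoint_linear[OF vadj])
    have Wadj: "is_adjoint X (W T) (W S)" if "is_adjoint X T S" for T S
      unfolding W_def by (rule is_adjoint_comp[OF is_adjoint_lact is_adjoint_comp[OF that is_adjoint_lact', simplified]])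
    have WK: "W T \<in> compact_r X" if "T \<in> compact_r X" for T
      unfolding W_def by (rule compact_comp[OF that is_adjoint_lact is_adjoint_lact'])
    have "k \<in> positive_compacts"
      unfolding k_def using op_positive_minus_conj[OF u(1) v(1)] kK
      by (intro positive_compacts_of_op_positive) (simp_all add: k_def)
    then have "W k \<in> positive_compacts"
      unfolding W_def by (rule positive_compacts_conj[OF _ is_adjoint_lact])
    then have Wk: "op_bound X (C * norm (F (W k))) (W k)" by (rule C(2))
    have "k = (\<lambda>z. (v z - u z) - r z)" by (simp add: k_def r_def fun_eq_iff)
    then have Fk: "F k = F v - F u - F r"
      by (simp add: F_diff compact_diff vK uK rK)
    have "F (W k) = (a * F v * star a - c) - (a * F u * star a - c) - a * F r * star a"
      unfolding W_def F_lact[OF kK] Fk by (simp add: algebra_simps)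
    then have "norm (F (W k)) \<le> \<epsilon> + \<epsilon> + norm (a * F r * star a)"
      using norm_triangle_ineq4[of "a * F v * star a - c" "a * F u * star a - c"]
        norm_triangle_ineq4[of "(a * F v * star a - c) - (a * F u * star a - c)" "a * F r * star a"] u(2) v(2)
      by simp
    also have "norm (a * F r * star a) \<le> norm a * norm (F r) * norm a"
      using norm_mult_ineq[of "a * F r" "star a"] mult_right_mono[OF norm_mult_ineq[of a "F r"], of "norm a"] by simp
    also have "norm a * norm (F r) * norm a \<le> norm a * (l * (2 * \<eta>)) * norm a"
      using \<eta> by (intro mult_right_mono mult_left_mono l(2) rK rb) auto
    finally have FWk: "norm (F (W k)) \<le> 2 * \<epsilon> + 2 * (norm a * l * norm a) * \<eta>"
      by (simp add: mult_ac)
    \<comment> \<open>Splits \<open>1 - u\<close> as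
      \<open>(1 - v) + (v - v u v) + (v u v - u)\<close>. The first part is small at
      \<open>y\<close>, the second by positivity, the third because \<open>v\<close> is nearly a
      unit for \<open>u\<close>.\<close>
    have "lact X a y - lact X a (u y) = lact X a (y - v y) + W k x + W r x"
      by (simp add: W_def k_def r_def y_def is_adjoint_linear[OF is_adjoint_lact])
    then have "nr (lact X a y - lact X a (u y)) \<le> nr (lact X a (y - v y)) + nr (W k x) + nr (W r x)"
      using nr_triangle[of "lact X a (y - v y) + W k x" "W r x"] nr_triangle[of "lact X a (y - v y)" "W k x"]
      by simp
    also have "nr (lact X a (y - v y)) \<le> M * \<eta>"
    proof -
      have "nr (y - v y) < \<eta>"
        using v' approx_unitsD(6)[of v "[y]" \<eta> y] nr_diff_commute[of y "v y"] by simp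
      then have "M * nr (y - v y) \<le> M * \<eta>" using M(1) by (intro mult_left_mono) auto
      then show ?thesis using op_boundD[OF M(2), of "y - v y"] by linarith
    qed
    also have "nr (W k x) \<le> C * (2 * \<epsilon> + 2 * (norm a * l * norm a) * \<eta>) * nr x"
      using FWk C(1) by (intro order_trans[OF op_boundD[OF Wk]] mult_right_mono mult_left_mono) auto
    also have "nr (W r x) \<le> M * (2 * \<eta> * M) * nr x"
    proof -
      have "op_bound X (M * (2 * \<eta> * M)) (W r)"
        unfolding W_def using \<eta> M(1) by (intro op_bound_comp[OF M(2) op_bound_comp[OF rb M']]) auto
      then show ?thesis by (rule op_boundD)
    qed
    finally have "nr (lact X a y - lact X a (u y))
        \<le> M * \<eta> + C * (2 * \<epsilon> + 2 * (norm a * l * norm a) * \<eta>) * nr x + M * (2 * \<eta> * M) * nr x"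
      by simp
    also have "\<dots> = 2 * C * \<epsilon> * nr x + B * \<eta>"
      by (simp add: B_def algebra_simps)
    also have "\<dots> = e * nr x + d" using C(1) B by (simp add: \<epsilon>_def \<eta>_def)
    finally show "nr (lact X a (lact X (star a) x) - lact X a (u (lact X (star a) x))) \<le> e * nr x + d"
      by (simp add: y_def)
  qed
  with u(1) show ?thesis using that by blast
qed

end

section \<open>Adjointability of bimodule maps\<close>

context bihilbertian
begin

text \<open>Passes from products \<open>a * star a\<close> to arbitrary products: the fourth roots
  of unity and their squares both sum to 0, so only \<open>a * b\<close> survives. The trivial
  factors \<open>1\<close> are kept so that all four summands match one pattern.\<close>

lemma lact_polarization:
  "lact X a (lact X b z) = scale X (1/4)
     (scale X 1 (lact X (a + 1 *\<^sub>C star b) (lact X (star (a + 1 *\<^sub>C star b)) z))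
    + scale X (- 1) (lact X (a + (- 1) *\<^sub>C star b) (lact X (star (a + (- 1) *\<^sub>C star b)) z))
    + scale X \<i> (lact X (a + \<i> *\<^sub>C star b) (lact X (star (a + \<i> *\<^sub>C star b)) z))
    + scale X (- \<i>) (lact X (a + (- \<i>) *\<^sub>C star b) (lact X (star (a + (- \<i>) *\<^sub>C star b)) z)))"
proof -
  define A B C D where "A = lact X a (lact X (star a) z)" "B = lact X a (lact X b z)"
    "C = lact X (star b) (lact X (star a) z)" "D = lact X (star b) (lact X b z)"
  have neg: "scale X (- c) x = - scale X c x" for c x
    using scale_simps(3)[of "- 1" c x] by (simp add: scale_minus_one)
  have summand: "scale X w (lact X (a + w *\<^sub>C star b) (lact X (star (a + w *\<^sub>C star b)) z))
      = scale X w A + B + scale X (w * w) C + scale X w D" if "w * cnj w = 1" for w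
  proof -
    have "scale X w (scale X (cnj w) x) = x" "scale X w (scale X w (scale X (cnj w) x)) = scale X w x" for x
      using that by (simp_all add: scale_simps)
    then show ?thesis
      by (simp add: A_B_C_D_def star_add star_scaleC star_star lact_simps scale_simps(1) scale_simps(3)[symmetric])
  qed
  have "scale X (1/4) (B + B + B + B) = scale X (1/4) (scale X (1 + 1 + 1 + 1) B)"
    by (simp only: scale_simps(2,4))
  also have "\<dots> = B" by (simp add: scale_simps)
  finally have quarter: "scale X (1/4) (B + B + B + B) = B" .
  have total: "(scale X 1 A + B + scale X (1 * 1) C + scale X 1 D)
      + (scale X (- 1) A + B + scale X ((- 1) * (- 1)) C + scale X (- 1) D)
      + (scale X \<i> A + B + scale X (\<i> * \<i>) C + scale X \<i> D)
      + (scale X (- \<i>) A + B + scale X ((- \<i>) * (- \<i>)) C + scale X (- \<i>) D) = B + B + B + B"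
    by (simp add: neg scale_simps(4))
  have "1 * cnj 1 = 1" "(- 1) * cnj (- 1) = 1" "\<i> * cnj \<i> = 1" "(- \<i>) * cnj (- \<i>) = 1"
    by simp_all
  note summands = this[THEN summand]
  show ?thesis
    unfolding summands total quarter by (simp add: A_B_C_D_def)
qed

text \<open>Membership of \<open>y\<close> in the domain of the adjoint of \<open>T\<close>.\<close>

definition is_adjoint_at :: "('x \<Rightarrow> 'x) \<Rightarrow> 'x \<Rightarrow> bool" where
  "is_adjoint_at T y \<longleftrightarrow> (\<exists>s. \<forall>x. ip (T x) y = ip x s)"

text \<open>Approximate adjoint vectors form a Cauchy sequence, as one sees by testing two of them
  against their difference; completeness supplies the adjoint vector.\<close>

lemma is_adjoint_at_approx:
  assumes approx: "\<And>e. e > 0 \<Longrightarrow> \<exists>s. \<forall>x. norm (ip (T x) y - ip x s) \<le> e * nr x"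
  shows "is_adjoint_at T y"
proof -
  have "\<forall>n. \<exists>s. \<forall>x. norm (ip (T x) y - ip x s) \<le> 1 / (real n + 1) * nr x"
    by (intro allI approx) simp
  then obtain s where s: "\<And>n x. norm (ip (T x) y - ip x (s n)) \<le> 1 / (real n + 1) * nr x"
    by (auto simp: choice_iff)
  have diff: "nr (s p - s q) \<le> 1 / (real p + 1) + 1 / (real q + 1)" for p q
  proof (cases "s p - s q = 0")
    case False
    define x where "x = s p - s q"
    have x: "nr x > 0" using False nr_ge_0[of x] nr_eq_0[of x] unfolding x_def by linarith
    have "nr x * nr x = norm (ip x (s p) - ip x (s q))"
      by (simp add: x_def nr_square[symmetric] power2_eq_square flip: ip_diff(2))
    also have "\<dots> \<le> norm (ip (T x) y - ip x (s p)) + norm (ip (T x) y - ip x (s q))"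
      using norm_triangle_ineq4[of "ip (T x) y - ip x (s q)" "ip (T x) y - ip x (s p)"] by simp
    also have "\<dots> \<le> (1 / (real p + 1) + 1 / (real q + 1)) * nr x"
      using s[of x p] s[of x q] by (simp add: distrib_right)
    finally show ?thesis using x by (simp add: x_def[symmetric])
  qed simp
  have lim: "(\<lambda>n. 1 / (real n + 1)) \<longlonglongrightarrow> 0"
    using LIMSEQ_inverse_real_of_nat by (simp add: inverse_eq_divide add.commute)
  obtain l where l: "(\<lambda>n. nr (s n - l)) \<longlonglongrightarrow> 0"
  proof (rule complete_sequence[of s])
    fix e :: real assume e: "e > 0"
    then obtain N where N: "\<And>n. n \<ge> N \<Longrightarrow> 1 / (real n + 1) < e / 2"
      using order_tendstoD(2)[OF lim, of "e / 2"] by (auto simp: eventually_sequentially)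
    have "nr (s p - s q) < e" if "p \<ge> N" "q \<ge> N" for p q
      using diff[of p q] N[OF that(1)] N[OF that(2)] by linarith
    then show "\<exists>N. \<forall>m\<ge>N. \<forall>n\<ge>N. nr (s m - s n) < e" by blast
  qed
  have "ip (T x) y = ip x l" for x
  proof -
    have "norm (ip (T x) y - ip x l) \<le> 1 / (real n + 1) * nr x + nr x * nr (s n - l)" for n
      using norm_triangle_ineq[of "ip (T x) y - ip x (s n)" "ip x (s n - l)"] s[of x n] norm_ip_le[of x "s n - l"]
      by (simp add: ip_diff)
    moreover have "(\<lambda>n. 1 / (real n + 1) * nr x + nr x * nr (s n - l)) \<longlonglongrightarrow> 0 * nr x + nr x * 0"
      by (intro tendsto_intros lim l)
    ultimately have "norm (ip (T x) y - ip x l) \<le> 0 * nr x + nr x * 0"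
      by (intro LIMSEQ_le_const) auto
    then show ?thesis by simp
  qed
  then show ?thesis unfolding is_adjoint_at_def by blast
qed

lemma is_adjoint_at_closed:
  assumes T: "op_bound X N T" and cl: "\<And>e. e > 0 \<Longrightarrow> \<exists>y'. is_adjoint_at T y' \<and> nr (y - y') < e"
  shows "is_adjoint_at T y"
proof (rule is_adjoint_at_approx)
  fix e :: real assume e: "e > 0"
  have N: "\<bar>N\<bar> + 1 > 0" by linarith
  then have "e / (\<bar>N\<bar> + 1) > 0" using e by simp
  then obtain y' where y': "is_adjoint_at T y'" "nr (y - y') < e / (\<bar>N\<bar> + 1)" using cl by blast
  then obtain s where s: "\<And>x. ip (T x) y' = ip x s" unfolding is_adjoint_at_def by blast
  have "norm (ip (T x) y - ip x s) \<le> e * nr x" for x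
  proof -
    have "norm (ip (T x) y - ip x s) = norm (ip (T x) (y - y'))" by (simp add: ip_diff s)
    also have "\<dots> \<le> nr (T x) * nr (y - y')" by (rule norm_ip_le)
    also have "\<dots> \<le> ((\<bar>N\<bar> + 1) * nr x) * (e / (\<bar>N\<bar> + 1))"
    proof (intro mult_mono)
      have "N * nr x \<le> (\<bar>N\<bar> + 1) * nr x" by (intro mult_right_mono) auto
      then show "nr (T x) \<le> (\<bar>N\<bar> + 1) * nr x" using op_boundD[OF T, of x] by linarith
    qed (use y' in auto)
    also have "\<dots> = e * nr x" using N by simp
    finally show ?thesis .
  qed
  then show "\<exists>s. \<forall>x. norm (ip (T x) y - ip x s) \<le> e * nr x" by blast
qed

lemma is_adjoint_at_add: "is_adjoint_at T x \<Longrightarrow> is_adjoint_at T y \<Longrightarrow> is_adjoint_at T (x + y)"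
  unfolding is_adjoint_at_def by (metis ip_simps(1))

lemma is_adjoint_at_scale: "is_adjoint_at T x \<Longrightarrow> is_adjoint_at T (scale X c x)"
  unfolding is_adjoint_at_def by (metis ip_simps(2))

lemma is_adjoint_at_zero: "is_adjoint_at T 0"
  unfolding is_adjoint_at_def by (metis ip_zero(2))

text \<open>Density of the span of A X as an induction rule. The approximate unit of the left module
  has values that are sums of vectors \<open>lact X a z\<close>, and equivalence of the norms
  transfers the approximation to the right norm.\<close>

lemma left_action_dense:
  assumes add: "\<And>x y. P x \<Longrightarrow> P y \<Longrightarrow> P (x + y)" and zero: "P 0" and lact: "\<And>a x. P (lact X a x)"
    and closed: "\<And>y. (\<And>e. e > 0 \<Longrightarrow> \<exists>y'. P y' \<and> nr (y - y') < e) \<Longrightarrow> P y"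
  shows "P y"
proof (rule closed)
  fix e :: real assume e: "e > 0"
  obtain c C where c: "c > 0" "C > 0" "\<And>x. c * nr x \<le> nl x" "\<And>x. nl x \<le> C * nr x"
    by (rule norm_equiv) blast
  have "c * e > 0" using c e by simp
  then obtain zs where zs: "\<forall>x\<in>set [y]. nl (finite_rank (contragradient X) (diag zs) x - x) < c * e"
    using L.approximate_unit[of "c * e" "[y]"] by auto
  define y' where "y' = finite_rank (contragradient X) (diag zs) y"
  have "P (finite_rank (contragradient X) (diag ws) y)" for ws
    by (induction ws) (auto simp: zero lact intro!: add)
  then have "P y'" by (simp add: y'_def)
  moreover have "nr (y - y') < e"
  proof -
    have "c * nr (y - y') < c * e"
      using zs c(3)[of "y' - y"] nr_diff_commute[of y y'] by (simp add: y'_def)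
    then show ?thesis using c(1) by simp
  qed
  ultimately show "\<exists>y'. P y' \<and> nr (y - y') < e" by blast
qed

end

lemma (in finite_numerical_index) adjointable_of_bimodule_map:
  assumes m: "r_Ind X \<in> multiplier_algebra cstar_alg"
    and T: "op_bound X N T" and add: "\<And>x y. T (x + y) = T x + T y" and Tz: "T 0 = 0"
    and lact: "\<And>a x. T (lact X a x) = lact X a (T x)" and ract: "\<And>x b. T (ract X x b) = ract X (T x) b"
  shows "T \<in> right_adjointable X"
proof -
  have N: "\<bar>N\<bar> + 1 > 0" by linarith
  have T': "op_bound X (\<bar>N\<bar> + 1) T" by (rule op_bound_mono[OF T]) simp
  have Tdiff: "T (x - y) = T x - T y" for x y
    using add[of "x - y" y] by simp
  have Tfr: "T (finite_rank X ps z) = finite_rank X (map (\<lambda>(x, y). (T x, y)) ps) z" for ps z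
    by (induction ps) (auto simp: add Tz ract)
  have "is_adjoint_at (\<lambda>x. T (lact X a (lact X (star a) x))) y" for a y
  proof (rule is_adjoint_at_approx)
    fix e :: real assume e: "e > 0"
    define d where "d = e / ((\<bar>N\<bar> + 1) * (nr y + 1))"
    have y1: "nr y + 1 > 0" by (simp add: add_nonneg_pos)
    have d: "d > 0" using e N y1 by (simp add: d_def)
    obtain u where u: "u \<in> approx_units [] 1"
      "op_bound X d (\<lambda>x. lact X a (lact X (star a) x) - lact X a (u (lact X (star a) x)))"
      by (rule left_action_approx[OF m d]) blast
    obtain zs where zs: "u = finite_rank X (diag zs)" using u(1) by (auto simp: approx_units_def)
    \<comment> \<open>Composing with \<open>T\<close> only changes the first vectors of the pairs,
      so the approximant keeps an explicit adjoint, given by the swapped list.\<close>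
    define qs where "qs = map (\<lambda>(x, y). (T x, y)) (map (\<lambda>(x, y). (lact X a x, lact X a y)) (diag zs))"
    have TS: "T (lact X a (u (lact X (star a) x))) = finite_rank X qs x" for x
      unfolding zs finite_rank_conj[OF is_adjoint_lact is_adjoint_lact'] qs_def Tfr ..
    define s where "s = finite_rank X (map prod.swap qs) y"
    have s: "ip x s = ip (finite_rank X qs x) y" for x
      unfolding s_def by (rule is_adjointD[OF is_adjoint_finite_rank, symmetric])
    have "norm (ip (T (lact X a (lact X (star a) x))) y - ip x s) \<le> e * nr x" for x
    proof -
      define w where "w = lact X a (lact X (star a) x) - lact X a (u (lact X (star a) x))"
      have "ip (T (lact X a (lact X (star a) x))) y - ip x s = ip (T w) y"
        by (simp add: s w_def Tdiff ip_diff TS)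
      also have "norm \<dots> \<le> nr (T w) * nr y" by (rule norm_ip_le)
      also have "\<dots> \<le> ((\<bar>N\<bar> + 1) * (d * nr x)) * (nr y + 1)"
      proof (intro mult_mono)
        have "nr (T w) \<le> (\<bar>N\<bar> + 1) * nr w" by (rule op_boundD[OF T'])
        also have "\<dots> \<le> (\<bar>N\<bar> + 1) * (d * nr x)"
          using op_boundD[OF u(2), of x] by (intro mult_left_mono) (auto simp: w_def)
        finally show "nr (T w) \<le> (\<bar>N\<bar> + 1) * (d * nr x)" .
      qed (use d in auto)
      also have "\<dots> = e * nr x" using N y1 by (simp add: d_def)
      finally show ?thesis .
    qed
    then show "\<exists>s. \<forall>x. norm (ip (T (lact X a (lact X (star a) x))) y - ip x s) \<le> e * nr x" by blast
  qed
  \<comment> \<open>\<open>T\<close> commutes with the self-adjoint operator of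
    \<open>a * star a\<close>, which can therefore be moved to the other side of the inner
    product.\<close>
  then have pos: "is_adjoint_at T (lact X a (lact X (star a) z))" for a z
    unfolding is_adjoint_at_def by (simp add: lact is_adjointD[OF is_adjoint_lact] star_star)
  have prod: "is_adjoint_at T (lact X a (lact X b z))" for a b z
    unfolding lact_polarization[of a b z] by (intro is_adjoint_at_scale is_adjoint_at_add pos)
  \<comment> \<open>Density is used twice: here to pass from vectors \<open>a (b z)\<close> to
    \<open>a z\<close>, by continuity of the action of \<open>a\<close>, and then from these to all
    vectors.\<close>
  have all: "is_adjoint_at T (lact X a z)" for a z
  proof (rule left_action_dense[of "\<lambda>z. is_adjoint_at T (lact X a z)"])
    show "is_adjoint_at T (lact X a 0)" using is_adjoint_linear(3)[OF is_adjoint_lact, of a] is_adjoint_at_zero by simp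
    obtain M where M: "M > 0" "op_bound X M (lact X a)" using is_adjoint_bounded[OF is_adjoint_lact] .
    fix y assume y: "\<And>e. e > 0 \<Longrightarrow> \<exists>y'. is_adjoint_at T (lact X a y') \<and> nr (y - y') < e"
    show "is_adjoint_at T (lact X a y)"
    proof (rule is_adjoint_at_closed[OF T])
      fix e :: real assume e: "e > 0"
      then obtain y' where y': "is_adjoint_at T (lact X a y')" "nr (y - y') < e / M" using y[of "e / M"] M(1) by auto
      have "nr (lact X a y - lact X a y') \<le> M * nr (y - y')"
        using op_boundD[OF M(2), of "y - y'"] by (simp add: is_adjoint_linear[OF is_adjoint_lact])
      also have "\<dots> < e" using y'(2) M(1) by (simp add: field_simps)
      finally show "\<exists>y'. is_adjoint_at T y' \<and> nr (lact X a y - y') < e" using y'(1) by blast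
    qed
  qed (simp_all add: lact_simps is_adjoint_at_add prod)
  have "is_adjoint_at T y" for y
    by (rule left_action_dense[of "is_adjoint_at T", OF is_adjoint_at_add is_adjoint_at_zero all is_adjoint_at_closed[OF T]])
  then have "\<forall>y. \<exists>s. \<forall>x. ip (T x) y = ip x s" by (simp add: is_adjoint_at_def)
  then show ?thesis by (auto simp: right_adjointable_def choice_iff)
qed

text \<open>Adjointability for the left inner product makes \<open>T\<close> A-linear and bounded in
  the left norm; equivalence of the norms carries the bound over to the right one.\<close>

lemma LB_left_subset_AL_right:
  fixes X :: "('a::cstar_algebra, 'b::cstar_algebra, 'x::ab_group_add) bimodule"
  assumes bi: "bi_hilbertian X" and fin: "finite_right_index X" and T: "T \<in> LB_left X"
  shows "T \<in> right_adjointable X \<and> T \<in> AL_right X"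
proof -
  interpret finite_numerical_index X
    using bi fin by unfold_locales (simp_all add: finite_right_index_def)
  obtain S where S: "is_adjoint (contragradient X) T S"
    using T by (auto simp: LB_left_def left_adjointable_def is_adjoint_def)
  have ract: "T (ract X x b) = ract X (T x) b" for x b
    using T by (simp add: LB_left_def)
  have lact: "T (lact X a x) = lact X a (T x)" for a x
    using L.is_adjoint_linear(6)[OF S, of x "star a"] by (simp add: star_star)
  obtain M where M: "M > 0" "op_bound (contragradient X) M T" using L.is_adjoint_bounded[OF S] .
  obtain N where N: "N \<ge> 0" "op_bound X N T"
    by (rule op_bound_right_of_left[OF M(2) less_imp_le[OF M(1)]]) blast
  have "r_Ind X \<in> multiplier_algebra cstar_alg"
    using assms(2) unfolding finite_right_index_def by (rule conjunct2)
  then have "T \<in> right_adjointable X"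
    by (rule adjointable_of_bimodule_map[OF _ N(2) L.is_adjoint_linear(1,3)[OF S] lact ract])
  then show ?thesis using lact by (simp add: AL_right_def)
qed

theorem corollary4p6:
  fixes X :: "('a::cstar_algebra, 'b::cstar_algebra, 'x::ab_group_add) bimodule"
  assumes "bi_hilbertian X" and "finite_index X"
  shows "(\<forall>T \<in> AL_right X. T \<in> left_adjointable X \<and> T \<in> LB_left X) \<and>
         (\<forall>T \<in> LB_left X. T \<in> right_adjointable X \<and> T \<in> AL_right X) \<and>
         AL_right_alg X = LB_left_alg X"
proof -
  have right: "finite_right_index X" and left: "finite_right_index (contragradient X)"
    using assms(2) by (simp_all add: finite_index_def finite_left_index_def)
  have 1: "T \<in> right_adjointable X \<and> T \<in> AL_right X" if "T \<in> LB_left X" for T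
    by (rule LB_left_subset_AL_right[OF assms(1) right that])
  have 2: "T \<in> left_adjointable X \<and> T \<in> LB_left X" if T: "T \<in> AL_right X" for T
  proof -
    \<comment> \<open>Passing to the contragradient exchanges the two sides. The actions acquire a
      \<open>star\<close>, which is removed at the end by substituting
      \<open>star b\<close>.\<close>
    have "T \<in> LB_left (contragradient X)"
      using T by (simp add: AL_right_def LB_left_def right_adjointable_def left_adjointable_def)
    then have "T \<in> right_adjointable (contragradient X) \<and> T \<in> AL_right (contragradient X)"
      by (rule LB_left_subset_AL_right[OF bi_hilbertian_contragradient[OF assms(1)] left])
    then have is_adjoint: "T \<in> left_adjointable X" and comm: "\<And>b x. T (ract X x (star b)) = ract X (T x) (star b)"
      by (auto simp: AL_right_def right_adjointable_def left_adjointable_def)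
    have "T (ract X x b) = ract X (T x) b" for x b
      using comm[of x "star b"] by (simp add: star_star)
    then show ?thesis using is_adjoint by (simp add: LB_left_def)
  qed
  have "AL_right X = LB_left X" using 1 2 by blast
  then show ?thesis using 1 2 by (simp add: AL_right_alg_def LB_left_alg_def)
qed

end
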